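(* Let $d\ge 2$ and let $p\in\mathbb{C}[z_1,\dots,z_d]$ be a homogeneous polynomial of positive degree that does not vanish (identically) on the $d$-th coordinate axis, i.e. $p(0,\dots,0,1)\neq 0$. Let $\mathcal{H}_p=H^2_d\ominus M_pH^2_d$ and let $S_j=P_{\mathcal{H}_p}M_{z_j}|_{\mathcal{H}_p}$, $1\le j\le d$, be the compressions of the Arveson $d$-shift. Then there exists a (connected open) neighborhood of the origin $U\subset\mathbb{B}_{d-1}$ such that the $(d-1)$-tuple $(S_1^*,\dots,S_{d-1}^* )$ is in the Cowen-Douglas class on $U$.
   Context: $\mathbb{B}_d$ is the open unit ball of $\mathbb{C}^d$. The Drury-Arveson space $H^2_d$ is the reproducing kernel Hilbert space of holomorphic functions on $\mathbb{B}_d$ with kernel $\frac{1}{1-\langle z,w\rangle}$; $M_f$ denotes multiplication by $f$. $H^2_d\ominus M_pH^2_d$ is the orthogonal complement of $pH^2_d$ in $H^2_d$, and $P_{\mathcal{H}_p}$ is the orthogonal projection onto it. A commuting $m$-tuple $T=(T_1,\dots,T_m)$ of bounded operators on a Hilbert space $\mathcal{H}$ is in the Cowen-Douglas class on a connected open set $U\subset\mathbb{C}^m$ if there is a positive integer $r$ such that: (i) for every $w\in U$ the operator $\mathcal{H}\to\mathcal{H}\otimes\mathbb{C}^m$, $h\mapsto((T_1-w_1)h,\dots,(T_m-w_m)h)$ has closed range; (ii) $\dim\bigcap_{j=1}^m\ker(T_j-w_j)=r$ for every $w\in U$; (iii) the closed linear span of $\bigcup_{w\in U}\bigcap_{j=1}^m\ker(T_j-w_j)$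 is $\mathcal{H}$. *)

theory Defs
  imports
    "HOL-Analysis.Analysis"
    "HOL-Library.Function_Algebras"
    "HOL-Library.Poly_Mapping"
begin

class complex_vector = ab_group_add +
  fixes scaleC :: "complex \<Rightarrow> 'a \<Rightarrow> 'a" (infixr \<open>*\<^sub>C\<close> 75)
  assumes scaleC_add_right: "a *\<^sub>C (x + y) = a *\<^sub>C x + a *\<^sub>C y"
    and scaleC_add_left: "(a + b) *\<^sub>C x = a *\<^sub>C x + b *\<^sub>C x"
    and scaleC_scaleC: "a *\<^sub>C (b *\<^sub>C x) = (a * b) *\<^sub>C x"
    and scaleC_one: "1 *\<^sub>C x = x"

global_interpretation complex_vector: vector_space "scaleC :: complex \<Rightarrow> 'a \<Rightarrow> 'a::complex_vector"
  by unfold_locales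
    (simp_all add: scaleC_add_right scaleC_add_left scaleC_scaleC scaleC_one)

instantiation complex :: complex_vector
begin

definition scaleC_complex_def: "(a::complex) *\<^sub>C (x::complex) = a * x"

instance
  by standard (simp_all add: scaleC_complex_def algebra_simps)

end

instantiation "fun" :: (type, complex_vector) complex_vector
begin

definition scaleC_fun_def: "a *\<^sub>C f = (\<lambda>x. a *\<^sub>C f x)"

instance
  by standard
    (simp_all add: scaleC_fun_def fun_eq_iff scaleC_add_right scaleC_add_left
      scaleC_scaleC scaleC_one)

end

text \<open>
  A Hilbert space is given by a carrier \<open>H\<close>, a complex subspace of an ambient vector space,
  together with an inner product \<open>ip\<close>, linear in its first argument, of which only the values
  on \<open>H\<close> are relevant.  The distance is cut off outside \<open>H\<close> because the library locale
  \<open>Metric_space\<close> asks for nonnegativity and symmetry on the whole type.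
\<close>

definition hnorm :: "('v \<Rightarrow> 'v \<Rightarrow> complex) \<Rightarrow> 'v \<Rightarrow> real" where
  "hnorm ip x = sqrt (Re (ip x x))"

definition hdist :: "'v::complex_vector set \<Rightarrow> ('v \<Rightarrow> 'v \<Rightarrow> complex) \<Rightarrow> 'v \<Rightarrow> 'v \<Rightarrow> real" where
  "hdist H ip x y = (if x \<in> H \<and> y \<in> H then hnorm ip (x - y) else 0)"

definition inner_product_space :: "'v::complex_vector set \<Rightarrow> ('v \<Rightarrow> 'v \<Rightarrow> complex) \<Rightarrow> bool" where
  "inner_product_space H ip \<longleftrightarrow>
     complex_vector.subspace H \<and>
     (\<forall>x\<in>H. \<forall>y\<in>H. \<forall>z\<in>H. ip (x + y) z = ip x z + ip y z) \<and>
     (\<forall>x\<in>H. \<forall>y\<in>H. \<forall>c. ip (c *\<^sub>C x) y = c * ip x y) \<and>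
     (\<forall>x\<in>H. \<forall>y\<in>H. ip y x = cnj (ip x y)) \<and>
     (\<forall>x\<in>H. 0 \<le> Re (ip x x)) \<and>
     (\<forall>x\<in>H. ip x x = 0 \<longrightarrow> x = 0)"

definition hilbert_space :: "'v::complex_vector set \<Rightarrow> ('v \<Rightarrow> 'v \<Rightarrow> complex) \<Rightarrow> bool" where
  "hilbert_space H ip \<longleftrightarrow>
     inner_product_space H ip \<and> Metric_space.mcomplete H (hdist H ip)"

definition hilbert_topology :: "'v::complex_vector set \<Rightarrow> ('v \<Rightarrow> 'v \<Rightarrow> complex) \<Rightarrow> 'v topology" where
  "hilbert_topology H ip = Metric_space.mtopology H (hdist H ip)"

definition bounded_operator ::
    "'v::complex_vector set \<Rightarrow> ('v \<Rightarrow> 'v \<Rightarrow> complex) \<Rightarrow> ('v \<Rightarrow> 'v) \<Rightarrow> bool" where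
  "bounded_operator H ip A \<longleftrightarrow>
     (\<forall>x\<in>H. A x \<in> H) \<and>
     (\<forall>x\<in>H. \<forall>y\<in>H. A (x + y) = A x + A y) \<and>
     (\<forall>c. \<forall>x\<in>H. A (c *\<^sub>C x) = c *\<^sub>C A x) \<and>
     (\<exists>C. \<forall>x\<in>H. hnorm ip (A x) \<le> C * hnorm ip x)"

definition hilbert_adjoint ::
    "'v set \<Rightarrow> ('v \<Rightarrow> 'v \<Rightarrow> complex) \<Rightarrow> ('v \<Rightarrow> 'v) \<Rightarrow> 'v \<Rightarrow> 'v" where
  "hilbert_adjoint H ip A y = (THE z. z \<in> H \<and> (\<forall>x\<in>H. ip (A x) y = ip x z))"

definition orthocomplement :: "'v set \<Rightarrow> ('v \<Rightarrow> 'v \<Rightarrow> complex) \<Rightarrow> 'v set \<Rightarrow> 'v set" where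
  "orthocomplement H ip M = {x \<in> H. \<forall>y\<in>M. ip x y = 0}"

definition orth_projection ::
    "'v::complex_vector set \<Rightarrow> ('v \<Rightarrow> 'v \<Rightarrow> complex) \<Rightarrow> 'v \<Rightarrow> 'v" where
  "orth_projection M ip x = (THE y. y \<in> M \<and> (\<forall>z\<in>M. ip (x - y) z = 0))"

text \<open>The Hilbert space \<open>H \<otimes> \<complex>\<^sup>m\<close>, as the space of \<open>m\<close>-tuples of elements of \<open>H\<close>.\<close>

definition tuple_space :: "'v set \<Rightarrow> ('m \<Rightarrow> 'v) set" where
  "tuple_space H = {f. \<forall>j. f j \<in> H}"

definition tuple_ip ::
    "('v \<Rightarrow> 'v \<Rightarrow> complex) \<Rightarrow> ('m::finite \<Rightarrow> 'v) \<Rightarrow> ('m \<Rightarrow> 'v) \<Rightarrow> complex" where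
  "tuple_ip ip f g = (\<Sum>j\<in>UNIV. ip (f j) (g j))"

definition commuting_bounded_tuple ::
    "'v::complex_vector set \<Rightarrow> ('v \<Rightarrow> 'v \<Rightarrow> complex) \<Rightarrow> ('m \<Rightarrow> 'v \<Rightarrow> 'v) \<Rightarrow> bool" where
  "commuting_bounded_tuple H ip T \<longleftrightarrow>
     (\<forall>j. bounded_operator H ip (T j)) \<and>
     (\<forall>i j. \<forall>x\<in>H. T i (T j x) = T j (T i x))"

definition shifted_tuple ::
    "('m::finite \<Rightarrow> 'v::complex_vector \<Rightarrow> 'v) \<Rightarrow> complex ^ 'm \<Rightarrow> 'v \<Rightarrow> 'm \<Rightarrow> 'v" where
  "shifted_tuple T w h = (\<lambda>j. T j h - (w $ j) *\<^sub>C h)"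

definition joint_eigenspace ::
    "'v::complex_vector set \<Rightarrow> ('m::finite \<Rightarrow> 'v \<Rightarrow> 'v) \<Rightarrow> complex ^ 'm \<Rightarrow> 'v set" where
  "joint_eigenspace H T w = (\<Inter>j. {h \<in> H. T j h - (w $ j) *\<^sub>C h = 0})"

text \<open>
  \<open>complex_vector.dim\<close> is \<open>0\<close> on infinite-dimensional spaces, so for \<open>r > 0\<close> the equation
  \<open>dim = r\<close> entails finite dimension.
\<close>

definition cowen_douglas ::
    "'v::complex_vector set \<Rightarrow> ('v \<Rightarrow> 'v \<Rightarrow> complex) \<Rightarrow> ('m::finite \<Rightarrow> 'v \<Rightarrow> 'v) \<Rightarrow>
      (complex ^ 'm) set \<Rightarrow> bool" where
  "cowen_douglas H ip T U \<longleftrightarrow>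
     hilbert_space H ip \<and> commuting_bounded_tuple H ip T \<and> open U \<and> connected U \<and>
     (\<exists>r::nat. r > 0 \<and>
        (\<forall>w\<in>U. closedin (hilbert_topology (tuple_space H) (tuple_ip ip)) (shifted_tuple T w ` H)) \<and>
        (\<forall>w\<in>U. complex_vector.dim (joint_eigenspace H T w) = r) \<and>
        hilbert_topology H ip closure_of
          complex_vector.span (\<Union>w\<in>U. joint_eigenspace H T w) = H)"

definition holomorphic_in :: "(complex ^ 'd::finite \<Rightarrow> complex) \<Rightarrow> (complex ^ 'd) set \<Rightarrow> bool" where
  "holomorphic_in f X \<longleftrightarrow>
     (\<forall>z\<in>X. \<exists>D. (f has_derivative D) (at z) \<and> (\<forall>c v. D (c *s v) = c * D v))"

text \<open>
  Functions on a set \<open>X\<close> are encoded as functions on the whole type that vanish outside \<open>X\<close>.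
  A reproducing kernel Hilbert space is determined by its kernel, both as a set of functions
  and in its inner product on that set; hence ``the'' space with a given kernel is any pair
  \<open>(H, ip)\<close> that satisfies the predicate.
\<close>

definition kernel_section :: "'x set \<Rightarrow> ('x \<Rightarrow> 'x \<Rightarrow> complex) \<Rightarrow> 'x \<Rightarrow> 'x \<Rightarrow> complex" where
  "kernel_section X K w = (\<lambda>z. if z \<in> X then K z w else 0)"

definition rkhs :: "'x set \<Rightarrow> ('x \<Rightarrow> 'x \<Rightarrow> complex) \<Rightarrow>
    ('x \<Rightarrow> complex) set \<Rightarrow> (('x \<Rightarrow> complex) \<Rightarrow> ('x \<Rightarrow> complex) \<Rightarrow> complex) \<Rightarrow> bool" where
  "rkhs X K H ip \<longleftrightarrow>
     hilbert_space H ip \<and>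
     (\<forall>f\<in>H. \<forall>z. z \<notin> X \<longrightarrow> f z = 0) \<and>
     (\<forall>w\<in>X. kernel_section X K w \<in> H \<and> (\<forall>f\<in>H. ip f (kernel_section X K w) = f w))"

definition drury_arveson_kernel :: "complex ^ 'd::finite \<Rightarrow> complex ^ 'd \<Rightarrow> complex" where
  "drury_arveson_kernel z w = 1 / (1 - (\<Sum>i\<in>UNIV. z $ i * cnj (w $ i)))"

definition drury_arveson_space ::
    "(complex ^ 'd::finite \<Rightarrow> complex) set \<Rightarrow>
      ((complex ^ 'd \<Rightarrow> complex) \<Rightarrow> (complex ^ 'd \<Rightarrow> complex) \<Rightarrow> complex) \<Rightarrow> bool" where
  "drury_arveson_space H ip \<longleftrightarrow>
     rkhs (ball 0 1) drury_arveson_kernel H ip \<and> (\<forall>f\<in>H. holomorphic_in f (ball 0 1))"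

definition mult_op :: "('x \<Rightarrow> complex) \<Rightarrow> ('x \<Rightarrow> complex) \<Rightarrow> 'x \<Rightarrow> complex" where
  "mult_op f h = (\<lambda>z. f z * h z)"

text \<open>A polynomial is the finitely supported map from exponent vectors to coefficients.\<close>

type_synonym 'd mpoly = "('d \<Rightarrow>\<^sub>0 nat) \<Rightarrow>\<^sub>0 complex"

definition poly_eval :: "'d::finite mpoly \<Rightarrow> complex ^ 'd \<Rightarrow> complex" where
  "poly_eval p z =
     (\<Sum>a\<in>Poly_Mapping.keys p.
        Poly_Mapping.lookup p a * (\<Prod>i\<in>UNIV. (z $ i) ^ Poly_Mapping.lookup a i))"

definition homogeneous_of_degree :: "'d::finite mpoly \<Rightarrow> nat \<Rightarrow> bool" where
  "homogeneous_of_degree p n \<longleftrightarrow>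
     (\<forall>a\<in>Poly_Mapping.keys p. (\<Sum>i\<in>UNIV. Poly_Mapping.lookup a i) = n)"

definition quotient_space ::
    "(complex ^ 'd::finite \<Rightarrow> complex) set \<Rightarrow>
      ((complex ^ 'd \<Rightarrow> complex) \<Rightarrow> (complex ^ 'd \<Rightarrow> complex) \<Rightarrow> complex) \<Rightarrow>
      'd mpoly \<Rightarrow> (complex ^ 'd \<Rightarrow> complex) set" where
  "quotient_space H ip p = orthocomplement H ip (mult_op (poly_eval p) ` H)"

definition compression ::
    "(complex ^ 'd::finite \<Rightarrow> complex) set \<Rightarrow>
      ((complex ^ 'd \<Rightarrow> complex) \<Rightarrow> (complex ^ 'd \<Rightarrow> complex) \<Rightarrow> complex) \<Rightarrow>
      'd \<Rightarrow> (complex ^ 'd \<Rightarrow> complex) \<Rightarrow> complex ^ 'd \<Rightarrow> complex" where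
  "compression M ip i h = orth_projection M ip (mult_op (\<lambda>z. z $ i) h)"

text \<open>
  With \<open>d - 1 = CARD('m)\<close>, the \<open>d\<close> coordinates are indexed by \<open>'m option\<close>: the index \<open>None\<close> is
  the last coordinate and the indices \<open>Some j\<close> are the first \<open>d - 1\<close> ones.  Since \<open>'m\<close> is
  nonempty, \<open>d \<ge> 2\<close>.
\<close>

definition last_unit_vector :: "complex ^ ('m::finite option)" where
  "last_unit_vector = axis None 1"

end

theory Submission
  imports Defs "HOL-Complex_Analysis.Complex_Analysis"
begin

text \<open>
  Write \<open>t\<close> for the last coordinate, and \<open>Q\<close> for the quotient module \<open>H \<ominus> p H\<close>.  Since \<open>Q\<close> is
  invariant under the adjoints \<open>B\<^sub>j\<close> of the multiplications by the coordinates, the operators of the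
  theorem are the restrictions of \<open>B\<^sub>1, \<dots>, B\<^sub>d\<^sub>-\<^sub>1\<close> to \<open>Q\<close>.  The hypothesis on \<open>p\<close> says that
  \<open>p = c t\<^sup>n + (terms divisible by some z\<^sub>j with j < d)\<close>, where \<open>c \<noteq> 0\<close>.  The three
  conditions hold on a small ball, with \<open>r = n\<close>, for the following reasons.

  Estimate (\<open>fundamental_estimate\<close>).  The kernel gives the identity
  \<open>\<Sum>\<^sub>j |B\<^sub>j h|\<^sup>2 = |h|\<^sup>2 - |h(0)|\<^sup>2\<close> (\<open>sum_bshift_sq\<close>).  Iterating it along \<open>B\<^sub>d\<close> bounds \<open>|h|\<^sup>2\<close> by
  \<open>|\<langle>h, t\<^sup>i\<rangle>|\<^sup>2\<close> for \<open>i < n\<close>, by \<open>|B\<^sub>j h|\<^sup>2\<close> for \<open>j < d\<close>, and by \<open>|B\<^sub>d\<^sup>n h|\<^sup>2\<close>; for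
  \<open>h\<close> in \<open>Q\<close> the last term is itself controlled by the \<open>B\<^sub>j h\<close> with \<open>j < d\<close>, because the adjoint of
  multiplication by \<open>p\<close> kills \<open>h\<close>.  So on the subspace of \<open>Q\<close> orthogonal to \<open>1, t, \<dots>, t\<^sup>n\<^sup>-\<^sup>1\<close> the
  column operator \<open>(B\<^sub>1, \<dots>, B\<^sub>d\<^sub>-\<^sub>1)\<close> is bounded below, and by perturbation so is its shift by any
  small \<open>w\<close> (\<open>perturbed_estimate\<close>).

  Eigenvectors (\<open>eigenvector_of_solution\<close>).  Let \<open>a\<close> be the conjugate of \<open>w\<close>.  A joint eigenvector for
  \<open>w\<close> represents a functional that factors through the restriction of a function to the slice
  \<open>t \<mapsto> f(a, t)\<close> and vanishes on multiples of \<open>p(a, t)\<close>, a polynomial of degree \<open>n\<close> in \<open>t\<close>.  In terms of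
  the values \<open>c\<^sub>k\<close> on \<open>t\<^sup>k\<close> this is a linear recurrence of order \<open>n\<close>.  For small \<open>a\<close> the solutions
  decay faster than the Taylor coefficients of a slice may grow, so each of them gives a bounded functional.
  The initial values \<open>c\<^sub>0, \<dots>, c\<^sub>n\<^sub>-\<^sub>1\<close> are arbitrary, which gives dimension at least \<open>n\<close>; the estimate
  gives at most \<open>n\<close> (\<open>eigenspace_dim\<close>).

  Closed range (\<open>shifted_range_closed\<close>).  Subtracting an eigenvector, one may choose a preimage
  orthogonal to \<open>1, \<dots>, t\<^sup>n\<^sup>-\<^sup>1\<close>; there the operator is bounded below.

  Totality (\<open>eigenvectors_total\<close>).  If \<open>f\<close> in \<open>Q\<close> is orthogonal to all eigenvectors, replacing \<open>a\<close> by
  \<open>s a\<close> and comparing powers of \<open>s\<close> shows that the same is true of each homogeneous component of \<open>f\<close>.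
  Dividing a component by \<open>p\<close> with respect to \<open>t\<close> leaves a remainder of degree below \<open>n\<close> in \<open>t\<close>, on
  which the functionals include evaluation at points near the \<open>t\<close>-axis; hence the remainder vanishes,
  the component lies in \<open>p H\<close>, and being in \<open>Q\<close> it is zero.
\<close>

unbundle no fps_syntax

section \<open>Inner product spaces and the variational Riesz lemma\<close>

locale ip_space =
  fixes H :: "'v::complex_vector set" and ip :: "'v \<Rightarrow> 'v \<Rightarrow> complex"
  assumes ips: "inner_product_space H ip"
begin

abbreviation nrm :: "'v \<Rightarrow> real" where "nrm \<equiv> hnorm ip"

lemma subspace_H: "complex_vector.subspace H"
  using ips unfolding inner_product_space_def by blast

lemma zero_mem [simp]: "0 \<in> H"
  using subspace_H by (rule complex_vector.subspace_0)

lemma add_mem [simp]: "x \<in> H \<Longrightarrow> y \<in> H \<Longrightarrow> x + y \<in> H"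
  using subspace_H by (rule complex_vector.subspace_add)

lemma diff_mem [simp]: "x \<in> H \<Longrightarrow> y \<in> H \<Longrightarrow> x - y \<in> H"
  using subspace_H by (rule complex_vector.subspace_diff)

lemma scale_mem [simp]: "x \<in> H \<Longrightarrow> c *\<^sub>C x \<in> H"
  using subspace_H by (rule complex_vector.subspace_scale)

lemma sum_mem [simp]: "(\<And>i. i \<in> I \<Longrightarrow> f i \<in> H) \<Longrightarrow> sum f I \<in> H"
  using subspace_H by (rule complex_vector.subspace_sum)

lemma ip_add_left:
  assumes "x \<in> H" "y \<in> H" "z \<in> H"
  shows "ip (x + y) z = ip x z + ip y z"
proof -
  have "\<forall>x\<in>H. \<forall>y\<in>H. \<forall>z\<in>H. ip (x + y) z = ip x z + ip y z"
    using ips unfolding inner_product_space_def by (elim conjE)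
  then show ?thesis using assms by (elim ballE) auto
qed

lemma ip_scale_left:
  assumes "x \<in> H" "y \<in> H"
  shows "ip (c *\<^sub>C x) y = c * ip x y"
proof -
  have "\<forall>x\<in>H. \<forall>y\<in>H. \<forall>c. ip (c *\<^sub>C x) y = c * ip x y"
    using ips unfolding inner_product_space_def by (elim conjE)
  then show ?thesis using assms by auto
qed

lemma ip_commute:
  assumes "x \<in> H" "y \<in> H"
  shows "ip y x = cnj (ip x y)"
proof -
  have "\<forall>x\<in>H. \<forall>y\<in>H. ip y x = cnj (ip x y)"
    using ips unfolding inner_product_space_def by (elim conjE)
  then show ?thesis using assms by (elim ballE) auto
qed

lemma ip_add_right: "x \<in> H \<Longrightarrow> y \<in> H \<Longrightarrow> z \<in> H \<Longrightarrow> ip z (x + y) = ip z x + ip z y"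
  by (simp add: ip_commute[of _ z] ip_add_left)

lemma ip_scale_right: "x \<in> H \<Longrightarrow> y \<in> H \<Longrightarrow> ip y (c *\<^sub>C x) = cnj c * ip y x"
  by (simp add: ip_commute[of _ y] ip_scale_left)

lemma ip_zero_left [simp]: "x \<in> H \<Longrightarrow> ip 0 x = 0"
  using ip_scale_left[of 0 x 0] by simp

lemma ip_zero_right [simp]: "x \<in> H \<Longrightarrow> ip x 0 = 0"
  using ip_scale_right[of 0 x 0] by simp

lemma ip_diff_left: "x \<in> H \<Longrightarrow> y \<in> H \<Longrightarrow> z \<in> H \<Longrightarrow> ip (x - y) z = ip x z - ip y z"
  using ip_add_left[of "x - y" y z] by simp

lemma ip_diff_right: "x \<in> H \<Longrightarrow> y \<in> H \<Longrightarrow> z \<in> H \<Longrightarrow> ip z (x - y) = ip z x - ip z y"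
  using ip_add_right[of "x - y" y z] by simp

lemma ip_sum_left:
  "(\<And>i. i \<in> I \<Longrightarrow> f i \<in> H) \<Longrightarrow> y \<in> H \<Longrightarrow> ip (sum f I) y = (\<Sum>i\<in>I. ip (f i) y)"
  by (induction I rule: infinite_finite_induct) (simp_all add: ip_add_left)

lemma ip_sum_right:
  "(\<And>i. i \<in> I \<Longrightarrow> f i \<in> H) \<Longrightarrow> y \<in> H \<Longrightarrow> ip y (sum f I) = (\<Sum>i\<in>I. ip y (f i))"
  by (induction I rule: infinite_finite_induct) (simp_all add: ip_add_right)

lemmas ip_expand = ip_add_left ip_add_right ip_diff_left ip_diff_right ip_scale_left ip_scale_right

lemma Re_ip_self_nonneg: "x \<in> H \<Longrightarrow> 0 \<le> Re (ip x x)"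
  using ips unfolding inner_product_space_def by blast

lemma ip_self_eq_0: "x \<in> H \<Longrightarrow> ip x x = 0 \<Longrightarrow> x = 0"
  using ips unfolding inner_product_space_def by blast

lemma nrm_sq: "x \<in> H \<Longrightarrow> (nrm x)\<^sup>2 = Re (ip x x)"
  by (simp add: hnorm_def Re_ip_self_nonneg)

lemma ip_self: "x \<in> H \<Longrightarrow> ip x x = of_real ((nrm x)\<^sup>2)"
  using ip_commute[of x x] by (simp add: complex_eq_iff nrm_sq)

lemma nrm_nonneg [simp]: "x \<in> H \<Longrightarrow> 0 \<le> nrm x"
  by (simp add: hnorm_def Re_ip_self_nonneg)

lemma nrm_zero [simp]: "nrm 0 = 0"
  by (simp add: hnorm_def)

lemma nrm_eq_0: "x \<in> H \<Longrightarrow> nrm x = 0 \<Longrightarrow> x = 0"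
  using ip_self ip_self_eq_0 by simp

lemma nrm_scale: "x \<in> H \<Longrightarrow> nrm (c *\<^sub>C x) = cmod c * nrm x"
proof -
  assume x: "x \<in> H"
  have "complex_of_real ((nrm (c *\<^sub>C x))\<^sup>2) = of_real ((cmod c * nrm x)\<^sup>2)"
    using x ip_self[of "c *\<^sub>C x"] ip_self[of x]
    by (simp add: ip_expand power_mult_distrib) (simp add: complex_norm_square mult_ac flip: of_real_power)
  then have "(nrm (c *\<^sub>C x))\<^sup>2 = (cmod c * nrm x)\<^sup>2"
    using of_real_eq_iff by blast
  then show ?thesis using x by (simp add: power2_eq_iff_nonneg)
qed

lemma nrm_add_sq:
  assumes "x \<in> H" "y \<in> H"
  shows "(nrm (x + y))\<^sup>2 = (nrm x)\<^sup>2 + (nrm y)\<^sup>2 + 2 * Re (ip x y)"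
  using assms ip_commute[of x y] by (simp add: nrm_sq ip_expand)

lemma nrm_diff_sq:
  assumes "x \<in> H" "y \<in> H"
  shows "(nrm (x - y))\<^sup>2 = (nrm x)\<^sup>2 + (nrm y)\<^sup>2 - 2 * Re (ip x y)"
  using assms ip_commute[of x y] by (simp add: nrm_sq ip_expand)

lemma Cauchy_Schwarz:
  assumes "x \<in> H" "y \<in> H"
  shows "cmod (ip x y) \<le> nrm x * nrm y"
proof (cases "nrm y = 0")
  case True
  then show ?thesis using assms nrm_eq_0[of y] by simp
next
  case False
  define c where "c = ip x y / ip y y"
  have yy: "ip y y \<noteq> 0" using False assms ip_self by auto
  have "0 \<le> Re (ip (x - c *\<^sub>C y) (x - c *\<^sub>C y))"
    using assms by (intro Re_ip_self_nonneg) simp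
  also have "ip (x - c *\<^sub>C y) (x - c *\<^sub>C y) = ip x x - ip x y * cnj (ip x y) / ip y y"
    using assms yy ip_self[of y] ip_commute[of x y]
    by (simp add: ip_expand c_def field_simps power2_eq_square)
  also have "\<dots> = of_real ((nrm x)\<^sup>2 - (cmod (ip x y))\<^sup>2 / (nrm y)\<^sup>2)"
    using assms ip_self[of x] ip_self[of y] by (simp flip: complex_norm_square)
  finally have "(cmod (ip x y))\<^sup>2 / (nrm y)\<^sup>2 \<le> (nrm x)\<^sup>2"
    by (simp only: Re_complex_of_real diff_ge_0_iff_ge)
  then have "(cmod (ip x y))\<^sup>2 \<le> (nrm x * nrm y)\<^sup>2"
    using False by (simp add: field_simps power_mult_distrib)
  then show ?thesis
    using assms by (meson abs_le_square_iff nrm_nonneg mult_nonneg_nonneg power2_le_imp_le)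
qed

lemma nrm_triangle:
  assumes "x \<in> H" "y \<in> H"
  shows "nrm (x + y) \<le> nrm x + nrm y"
proof -
  have "Re (ip x y) \<le> nrm x * nrm y"
    using Cauchy_Schwarz[OF assms] complex_Re_le_cmod order_trans by blast
  then have "(nrm (x + y))\<^sup>2 \<le> (nrm x + nrm y)\<^sup>2"
    using nrm_add_sq[OF assms] by (simp add: power2_sum)
  then show ?thesis
    using assms by (meson add_nonneg_nonneg nrm_nonneg power2_le_imp_le)
qed

lemma nrm_minus_commute: "x \<in> H \<Longrightarrow> y \<in> H \<Longrightarrow> nrm (x - y) = nrm (y - x)"
  using nrm_scale[of "x - y" "-1"] by simp

lemma nrm_sum_le:
  "(\<And>i. i \<in> I \<Longrightarrow> f i \<in> H) \<Longrightarrow> nrm (sum f I) \<le> (\<Sum>i\<in>I. nrm (f i))"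
proof (induction I rule: infinite_finite_induct)
  case (insert x F)
  then show ?case using nrm_triangle[of "f x" "sum f F"] by (simp add: order_trans)
qed auto

lemma Metric_space_H: "Metric_space H (hdist H ip)"
proof
  fix x y z
  show "0 \<le> hdist H ip x y" by (simp add: hdist_def)
  show "hdist H ip x y = hdist H ip y x" by (simp add: hdist_def nrm_minus_commute)
  show "x \<in> H \<Longrightarrow> y \<in> H \<Longrightarrow> (hdist H ip x y = 0) = (x = y)"
    using nrm_eq_0[of "x - y"] by (auto simp: hdist_def)
  show "x \<in> H \<Longrightarrow> y \<in> H \<Longrightarrow> z \<in> H \<Longrightarrow> hdist H ip x z \<le> hdist H ip x y + hdist H ip y z"
    using nrm_triangle[of "x - y" "y - z"] by (simp add: hdist_def)
qed

sublocale ms: Metric_space H "hdist H ip"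
  by (rule Metric_space_H)

definition converges :: "(nat \<Rightarrow> 'v) \<Rightarrow> 'v \<Rightarrow> bool" where
  "converges x l \<longleftrightarrow> (\<forall>k. x k \<in> H) \<and> l \<in> H \<and> (\<lambda>k. nrm (x k - l)) \<longlonglongrightarrow> 0"

lemma limitin_iff_converges:
  assumes "\<And>k. x k \<in> H"
  shows "limitin ms.mtopology x l sequentially \<longleftrightarrow> converges x l"
  unfolding ms.limitin_metric_dist_null converges_def
  using assms by (auto simp: hdist_def eventually_sequentially cong: conj_cong)

lemma mem_closure_iff_converges:
  assumes "S \<subseteq> H"
  shows "l \<in> ms.mtopology closure_of S \<longleftrightarrow> (\<exists>x. (\<forall>k. x k \<in> S) \<and> converges x l)"
proof
  assume "l \<in> ms.mtopology closure_of S"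
  then have l: "l \<in> H" and near: "\<And>r. r > 0 \<Longrightarrow> \<exists>y\<in>S. y \<in> ms.mball l r"
    unfolding ms.metric_closure_of by auto
  have "\<forall>k. \<exists>y\<in>S. hdist H ip l y < inverse (real (Suc k))"
    using near[of "inverse (real (Suc _))"] by (metis ms.in_mball inverse_positive_iff_positive
        of_nat_0_less_iff zero_less_Suc)
  then obtain x where x: "\<And>k. x k \<in> S" "\<And>k. hdist H ip l (x k) < inverse (real (Suc k))"
    by metis
  have "nrm (x k - l) \<le> inverse (real (Suc k))" for k
    using x[of k] l assms nrm_minus_commute[of "x k" l] by (auto simp: hdist_def subset_iff)
  then have "(\<lambda>k. nrm (x k - l)) \<longlonglongrightarrow> 0"
    using x(1) l assms
    by (intro tendsto_sandwich[OF _ _ tendsto_const LIMSEQ_inverse_real_of_nat])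
      (auto intro!: always_eventually nrm_nonneg diff_mem)
  then show "\<exists>x. (\<forall>k. x k \<in> S) \<and> converges x l"
    using x l assms unfolding converges_def by blast
next
  assume "\<exists>x. (\<forall>k. x k \<in> S) \<and> converges x l"
  then obtain x where x: "\<And>k. x k \<in> S" "converges x l" by blast
  then have xH: "\<And>k. x k \<in> H" and l: "l \<in> H" and lim: "(\<lambda>k. nrm (x k - l)) \<longlonglongrightarrow> 0"
    unfolding converges_def by auto
  have "\<forall>r>0. \<exists>y\<in>S. y \<in> ms.mball l r"
  proof (intro allI impI)
    fix r :: real assume "r > 0"
    then have "\<forall>\<^sub>F k in sequentially. nrm (x k - l) < r"
      using order_tendstoD(2)[OF lim] by simp
    then obtain k where "nrm (x k - l) < r"
      using eventually_happens'[OF sequentially_bot] by blast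
    then have "x k \<in> ms.mball l r"
      using xH[of k] l by (simp add: hdist_def nrm_minus_commute)
    then show "\<exists>y\<in>S. y \<in> ms.mball l r"
      using x(1) by blast
  qed
  then show "l \<in> ms.mtopology closure_of S"
    using l unfolding ms.metric_closure_of by blast
qed

lemma converges_ip_left:
  assumes "converges x l" "y \<in> H"
  shows "(\<lambda>k. ip (x k) y) \<longlonglongrightarrow> ip l y"
proof (rule LIM_zero_cancel, rule Lim_null_comparison)
  have x: "\<And>k. x k \<in> H" "l \<in> H" and lim: "(\<lambda>k. nrm (x k - l)) \<longlonglongrightarrow> 0"
    using assms unfolding converges_def by auto
  show "\<forall>\<^sub>F k in sequentially. norm (ip (x k) y - ip l y) \<le> nrm (x k - l) * nrm y"
    using Cauchy_Schwarz[of "x _ - l" y] x assms(2) by (simp add: ip_diff_left)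
  show "(\<lambda>k. nrm (x k - l) * nrm y) \<longlonglongrightarrow> 0"
    using tendsto_mult_right[OF lim, of "nrm y"] by simp
qed

lemma converges_nrm:
  assumes "converges x l"
  shows "(\<lambda>k. nrm (x k)) \<longlonglongrightarrow> nrm l"
proof (rule LIM_zero_cancel, rule Lim_null_comparison)
  have x: "\<And>k. x k \<in> H" "l \<in> H" and lim: "(\<lambda>k. nrm (x k - l)) \<longlonglongrightarrow> 0"
    using assms unfolding converges_def by auto
  have "\<bar>nrm (x k) - nrm l\<bar> \<le> nrm (x k - l)" for k
    using nrm_triangle[of "x k - l" l] nrm_triangle[of "l - x k" "x k"]
      nrm_minus_commute[of "x k" l] x by simp
  then show "\<forall>\<^sub>F k in sequentially. norm (nrm (x k) - nrm l) \<le> nrm (x k - l)"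
    by simp
  show "(\<lambda>k. nrm (x k - l)) \<longlonglongrightarrow> 0" by (rule lim)
qed

lemma converges_unique: "converges x l \<Longrightarrow> converges x m \<Longrightarrow> l = m"
proof -
  assume a: "converges x l" "converges x m"
  then have m: "l \<in> H" "m \<in> H" by (auto simp: converges_def)
  have "(\<lambda>k. ip (x k) (l - m)) \<longlonglongrightarrow> ip l (l - m)" "(\<lambda>k. ip (x k) (l - m)) \<longlonglongrightarrow> ip m (l - m)"
    using a m by (auto intro: converges_ip_left)
  then have "ip l (l - m) = ip m (l - m)" by (rule LIMSEQ_unique)
  then have "ip (l - m) (l - m) = 0" using m by (simp add: ip_diff_left)
  then show "l = m" using ip_self_eq_0[of "l - m"] m by simp
qed

text \<open>
  Completeness in terms of norms alone, so that it can be transferred between a space and its subspaces,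
  whose cut-off distances are different functions.
\<close>

lemma mcompleteI:
  assumes "\<And>x. (\<And>k. x k \<in> H) \<Longrightarrow>
      (\<And>e. e > 0 \<Longrightarrow> \<exists>N. \<forall>i\<ge>N. \<forall>j\<ge>N. nrm (x i - x j) < e) \<Longrightarrow> \<exists>l. converges x l"
  shows "ms.mcomplete"
  unfolding ms.mcomplete_def
proof (intro allI impI)
  fix x assume "ms.MCauchy x"
  then have "range x \<subseteq> H" and C: "\<forall>e>0. \<exists>N. \<forall>i j. N \<le> i \<longrightarrow> N \<le> j \<longrightarrow> hdist H ip (x i) (x j) < e"
    unfolding ms.MCauchy_def by - (erule conjunct1, erule conjunct2)
  then have xH: "x k \<in> H" for k by auto
  have "\<exists>l. converges x l"
  proof (rule assms[OF xH])
    fix e :: real assume "e > 0"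
    then obtain N where "\<forall>i j. N \<le> i \<longrightarrow> N \<le> j \<longrightarrow> hdist H ip (x i) (x j) < e" using C by meson
    then show "\<exists>N. \<forall>i\<ge>N. \<forall>j\<ge>N. nrm (x i - x j) < e"
      using xH by (intro exI[of _ N]) (auto simp: hdist_def)
  qed
  then show "\<exists>l. limitin ms.mtopology x l sequentially"
    using limitin_iff_converges[of x, OF xH] by blast
qed

lemma ip_space_subspace:
  assumes "complex_vector.subspace M" "M \<subseteq> H"
  shows "ip_space M ip"
proof
  note mem = subsetD[OF assms(2)]
  show "inner_product_space M ip"
    unfolding inner_product_space_def
  proof (intro conjI ballI allI impI)
    show "complex_vector.subspace M" by fact
    fix x assume x: "x \<in> M"
    show "0 \<le> Re (ip x x)" using x mem Re_ip_self_nonneg by blast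
    show "ip x x = 0 \<Longrightarrow> x = 0" using x mem ip_self_eq_0 by blast
    fix y assume y: "y \<in> M"
    show "ip (c *\<^sub>C x) y = c * ip x y" for c using x y mem ip_scale_left by blast
    show "ip y x = cnj (ip x y)" using x y mem by (intro ip_commute) auto
    show "ip (x + y) z = ip x z + ip y z" if "z \<in> M" for z
      using x y mem that by (intro ip_add_left) auto
  qed
qed

lemma hilbert_adjoint_eqI:
  assumes "z \<in> H" "\<And>x. x \<in> H \<Longrightarrow> A x \<in> H" "\<And>x. x \<in> H \<Longrightarrow> ip (A x) y = ip x z"
  shows "hilbert_adjoint H ip A y = z"
  unfolding hilbert_adjoint_def
proof (rule the_equality)
  show "z \<in> H \<and> (\<forall>x\<in>H. ip (A x) y = ip x z)" using assms by blast
  fix z' assume z': "z' \<in> H \<and> (\<forall>x\<in>H. ip (A x) y = ip x z')"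
  have "ip (z' - z) (z' - z) = 0"
    using z' assms(1) assms(3)[of "z' - z"] by (simp add: ip_diff_right)
  then show "z' = z" using ip_self_eq_0[of "z' - z"] z' assms(1) by simp
qed

lemma orth_projection_eqI:
  assumes "complex_vector.subspace M" "M \<subseteq> H" "x \<in> H" "y \<in> M" "\<And>z. z \<in> M \<Longrightarrow> ip (x - y) z = 0"
  shows "orth_projection M ip x = y"
  unfolding orth_projection_def
proof (rule the_equality)
  show "y \<in> M \<and> (\<forall>z\<in>M. ip (x - y) z = 0)" using assms by blast
  fix y' assume y': "y' \<in> M \<and> (\<forall>z\<in>M. ip (x - y') z = 0)"
  have mem: "y \<in> H" "y' \<in> H" using assms y' by auto
  have "y' - y \<in> M" using assms(1,4) y' by (simp add: complex_vector.subspace_diff)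
  then have "ip (x - y) (y' - y) - ip (x - y') (y' - y) = 0" using assms(5) y' by simp
  then have "ip (y' - y) (y' - y) = 0" using mem assms(3) by (simp add: ip_diff_left)
  then show "y' = y" using ip_self_eq_0[of "y' - y"] mem by simp
qed

text \<open>
  Gram-Schmidt: no completeness is involved, and the projection stays in the linear span.  This is what
  makes homogeneous components polynomials.
\<close>

lemma finite_span_projection:
  assumes "finite B" "B \<subseteq> H" "x \<in> H"
  shows "\<exists>y\<in>complex_vector.span B. \<forall>z\<in>complex_vector.span B. ip (x - y) z = 0"
  using assms
proof (induction B arbitrary: x rule: finite_induct)
  case empty
  then show ?case by simp
next
  case (insert b B)
  let ?S = "complex_vector.span B"
  have S: "?S \<subseteq> H" using insert.prems subspace_H by (simp add: complex_vector.span_minimal)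
  have bH: "b \<in> H" using insert.prems by simp
  obtain q where q: "q \<in> ?S" "\<And>z. z \<in> ?S \<Longrightarrow> ip (b - q) z = 0"
    using insert.IH[of b] insert.prems by auto
  obtain y where y: "y \<in> ?S" "\<And>z. z \<in> ?S \<Longrightarrow> ip (x - y) z = 0"
    using insert.IH[of x] insert.prems by auto
  define b' where "b' = b - q"
  define c where "c = ip x b' / ip b' b'"
  have mem: "q \<in> H" "y \<in> H" "b' \<in> H" using q y S bH by (auto simp: b'_def)
  have b': "b' \<in> complex_vector.span (insert b B)"
    unfolding b'_def using subsetD[OF complex_vector.span_mono[OF subset_insertI] q(1)]
    by (intro complex_vector.span_diff complex_vector.span_base[of b]) auto
  have y': "y + c *\<^sub>C b' \<in> complex_vector.span (insert b B)"
    using subsetD[OF complex_vector.span_mono[OF subset_insertI] y(1)] b'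
    by (intro complex_vector.span_add complex_vector.span_scale)
  have zero: "ip (x - (y + c *\<^sub>C b')) z = 0" if z: "z \<in> complex_vector.span (insert b B)" for z
  proof -
    obtain k where k: "z - k *\<^sub>C b \<in> ?S" using z complex_vector.span_breakdown_eq by blast
    define s where "s = z - k *\<^sub>C b + k *\<^sub>C q"
    have s: "s \<in> ?S"
      unfolding s_def using k q(1) by (simp add: complex_vector.span_add complex_vector.span_scale)
    have sH: "s \<in> H" using s S by blast
    have zs: "z = s + k *\<^sub>C b'" by (simp add: s_def b'_def complex_vector.scale_right_diff_distrib)
    have "ip b' s = 0" using q(2)[OF s] by (simp add: b'_def)
    moreover have "ip x s = ip y s" using y(2)[OF s] insert.prems mem sH by (simp add: ip_diff_left)
    moreover have "ip y b' = 0"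
      using q(2)[OF y(1)] mem ip_commute[of "b'" y] by (simp add: b'_def)
    moreover have "c * ip b' b' = ip x b'"
      using ip_self_eq_0[of b'] mem insert.prems by (cases "b' = 0") (auto simp: c_def)
    ultimately show ?thesis
      using insert.prems mem sH by (simp add: zs ip_expand algebra_simps)
  qed
  show ?case using y' zero by blast
qed

lemma converges_image:
  assumes "converges x l" "\<And>x. x \<in> H \<Longrightarrow> A x \<in> H"
    and diff: "\<And>x y. x \<in> H \<Longrightarrow> y \<in> H \<Longrightarrow> A (x - y) = A x - A y"
    and bound: "\<And>x. x \<in> H \<Longrightarrow> nrm (A x) \<le> C * nrm x"
  shows "converges (\<lambda>k. A (x k)) (A l)"
proof -
  have x: "\<And>k. x k \<in> H" "l \<in> H" and lim: "(\<lambda>k. nrm (x k - l)) \<longlonglongrightarrow> 0"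
    using assms(1) unfolding converges_def by auto
  have "(\<lambda>k. nrm (A (x k) - A l)) \<longlonglongrightarrow> 0"
  proof (rule tendsto_sandwich[OF _ _ tendsto_const])
    show "(\<lambda>k. C * nrm (x k - l)) \<longlonglongrightarrow> 0"
      using tendsto_mult_left[OF lim, of C] by simp
    have "nrm (A (x k) - A l) \<le> C * nrm (x k - l)" for k
      using bound[of "x k - l"] diff[of "x k" l] x by simp
    then show "\<forall>\<^sub>F k in sequentially. nrm (A (x k) - A l) \<le> C * nrm (x k - l)" by simp
    show "\<forall>\<^sub>F k in sequentially. 0 \<le> nrm (A (x k) - A l)"
      using x assms(2) by (intro always_eventually allI nrm_nonneg diff_mem) auto
  qed
  then show ?thesis using x assms(2) unfolding converges_def by blast
qed

lemma orthogonal_span_right: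
  assumes "x \<in> H" "B \<subseteq> H" "\<And>b. b \<in> B \<Longrightarrow> ip x b = 0" "y \<in> complex_vector.span B"
  shows "ip x y = 0"
proof -
  have "complex_vector.span B \<subseteq> {y \<in> H. ip x y = 0}"
    using assms by (intro complex_vector.span_minimal complex_vector.subspaceI)
      (auto simp: ip_add_right ip_scale_right)
  then show ?thesis using assms by blast
qed

lemma span_subset: "B \<subseteq> H \<Longrightarrow> complex_vector.span B \<subseteq> H"
  by (rule complex_vector.span_minimal[OF _ subspace_H])

lemma orthogonal_spans:
  assumes "A \<subseteq> H" "B \<subseteq> H" "\<And>a b. a \<in> A \<Longrightarrow> b \<in> B \<Longrightarrow> ip a b = 0"
    and x: "x \<in> complex_vector.span A" and y: "y \<in> complex_vector.span B"
  shows "ip x y = 0"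
proof (rule orthogonal_span_right[OF _ assms(2) _ y])
  show xH: "x \<in> H" using x span_subset[OF assms(1)] by blast
  fix b assume b: "b \<in> B"
  have bH: "b \<in> H" using b assms(2) by blast
  have "ip b a = 0" if "a \<in> A" for a
    using assms(3)[OF that b] ip_commute[of a b] that b assms(1,2) by auto
  then have "ip b x = 0" by (rule orthogonal_span_right[OF bH assms(1) _ x])
  then show "ip x b = 0" using ip_commute[OF bH xH] by simp
qed

end

locale hilbert = ip_space H ip
  for H :: "'v::complex_vector set" and ip :: "'v \<Rightarrow> 'v \<Rightarrow> complex" +
  assumes complete: "Metric_space.mcomplete H (hdist H ip)"
begin

lemma Cauchy_converges:
  assumes "\<And>k. x k \<in> H"
    and "\<And>e. e > 0 \<Longrightarrow> \<exists>N. \<forall>i\<ge>N. \<forall>j\<ge>N. nrm (x i - x j) < e"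
  shows "\<exists>l. converges x l"
proof -
  have "ms.MCauchy x"
    unfolding ms.MCauchy_def using assms by (auto simp: hdist_def)
  then obtain l where "limitin ms.mtopology x l sequentially"
    using complete unfolding ms.mcomplete_def by blast
  then show ?thesis using limitin_iff_converges assms(1) by blast
qed

text \<open>
  The Riesz representation theorem for a functional on a subspace that need be neither closed nor dense,
  given by its graph \<open>R\<close>.  With a graph, functionals can be prescribed on
  finite linear combinations of a spanning family without first proving that the prescription is
  well defined: the bound takes care of that.  The representing vector minimizes \<open>|x|\<^sup>2 - 2 Re y\<close>; the
  parallelogram law makes minimizing sequences Cauchy, and the vector is a limit of points of the domain.
  The latter yields orthogonal projections and density criteria as further special cases.
\<close>

lemma riesz_relation:
  fixes R :: "'v \<Rightarrow> complex \<Rightarrow> bool"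
  assumes C0: "0 \<le> C"
    and zero: "R 0 0"
    and add: "\<And>x y x' y'. R x y \<Longrightarrow> R x' y' \<Longrightarrow> R (x + x') (y + y')"
    and scale: "\<And>c x y. R x y \<Longrightarrow> R (c *\<^sub>C x) (c * y)"
    and mem: "\<And>x y. R x y \<Longrightarrow> x \<in> H"
    and bound: "\<And>x y. R x y \<Longrightarrow> cmod y \<le> C * nrm x"
  shows "\<exists>h\<in>H. (\<forall>x y. R x y \<longrightarrow> y = ip x h) \<and> nrm h \<le> C \<and>
           (\<exists>u. (\<forall>k. \<exists>y. R (u k) y) \<and> converges u h)"
proof -
  define J where "J x y = (nrm x)\<^sup>2 - 2 * Re y" for x y
  define m where "m = Inf {J x y |x y. R x y}"
  have J_ge: "- C\<^sup>2 \<le> J x y" if "R x y" for x y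
  proof -
    have "Re y \<le> C * nrm x" using bound[OF that] complex_Re_le_cmod order_trans by blast
    moreover have "0 \<le> (nrm x - C)\<^sup>2" by simp
    ultimately show ?thesis by (simp add: J_def power2_diff mult_ac)
  qed
  then have bdd: "bdd_below {J x y |x y. R x y}" by (auto intro!: bdd_belowI[of _ "- C\<^sup>2"])
  have ne: "{J x y |x y. R x y} \<noteq> {}" using zero by auto
  have m_le: "m \<le> J x y" if "R x y" for x y
    unfolding m_def using that by (intro cInf_lower bdd) auto
  have "\<exists>x y. R x y \<and> J x y < m + inverse (real (Suc k))" for k
  proof -
    have "m < m + inverse (real (Suc k))" by simp
    then obtain t where "t \<in> {J x y |x y. R x y}" "t < m + inverse (real (Suc k))"
      unfolding m_def using cInf_lessD[OF ne] by blast
    then show ?thesis by auto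
  qed
  then obtain u v where uv: "\<And>k. R (u k) (v k)" "\<And>k. J (u k) (v k) < m + inverse (real (Suc k))"
    by metis
  have uH: "u k \<in> H" for k using uv mem by blast
  \<comment> \<open>The parallelogram law, applied to the midpoint of two competitors.\<close>
  have para: "(nrm (x - x'))\<^sup>2 \<le> 2 * (J x y - m) + 2 * (J x' y' - m)" if "R x y" "R x' y'" for x x' y y'
  proof -
    have H: "x \<in> H" "x' \<in> H" using that mem by auto
    have "R ((1/2) *\<^sub>C (x + x')) ((1/2) * (y + y'))" using that add scale by blast
    then have "m \<le> J ((1/2) *\<^sub>C (x + x')) ((1/2) * (y + y'))" by (rule m_le)
    also have "\<dots> = (nrm (x + x'))\<^sup>2 / 4 - Re y - Re y'"
    proof -
      have "nrm ((1/2) *\<^sub>C (x + x')) = nrm (x + x') / 2"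
        using nrm_scale[of "x + x'" "1/2"] H by simp
      from this[THEN arg_cong[where f="\<lambda>t. t\<^sup>2"]] show ?thesis
        unfolding J_def by (simp only: power_divide) (simp add: add_divide_distrib del: complex_vector.scale_right_distrib)
    qed
    finally have mid: "m \<le> (nrm (x + x'))\<^sup>2 / 4 - Re y - Re y'" .
    show ?thesis
    proof -
      have "D \<le> 2 * (a - 2 * t - m) + 2 * (b - 2 * t' - m)"
        if "m \<le> S / 4 - t - t'" "S = a + b + 2 * r" "D = a + b - 2 * r" for a b r t t' S D :: real
        using that by argo
      then show ?thesis
        using mid nrm_add_sq[OF H] nrm_diff_sq[OF H] unfolding J_def by blast
    qed
  qed
  have "\<exists>l. converges u l"
  proof (rule Cauchy_converges[OF uH])
    fix e :: real assume "e > 0"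
    then obtain N where N: "inverse (real (Suc N)) < e\<^sup>2 / 4"
      using reals_Archimedean[of "e\<^sup>2 / 4"] by auto
    show "\<exists>N. \<forall>i\<ge>N. \<forall>j\<ge>N. nrm (u i - u j) < e"
    proof (intro exI allI impI)
      fix i j assume ij: "N \<le> i" "N \<le> j"
      have "inverse (real (Suc i)) \<le> inverse (real (Suc N))"
        "inverse (real (Suc j)) \<le> inverse (real (Suc N))"
        using ij by (auto intro!: le_imp_inverse_le)
      then have "(nrm (u i - u j))\<^sup>2 < e\<^sup>2"
        using para[OF uv(1)[of i] uv(1)[of j]] uv(2)[of i] uv(2)[of j] N by argo
      then show "nrm (u i - u j) < e"
        using \<open>e > 0\<close> by (meson less_eq_real_def power_less_imp_less_base)
    qed
  qed
  then obtain h where h: "converges u h" by blast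
  then have hH: "h \<in> H" by (simp add: converges_def)
  have limJ: "(\<lambda>k. J (u k) (v k)) \<longlonglongrightarrow> m"
  proof (rule tendsto_sandwich[OF _ _ tendsto_const])
    show "(\<lambda>k. m + inverse (real (Suc k))) \<longlonglongrightarrow> m"
      using LIMSEQ_inverse_real_of_nat_add by simp
    show "\<forall>\<^sub>F k in sequentially. m \<le> J (u k) (v k)" using m_le uv by auto
    show "\<forall>\<^sub>F k in sequentially. J (u k) (v k) \<le> m + inverse (real (Suc k))"
      using uv(2) by (auto intro!: always_eventually less_imp_le)
  qed
  have var: "Re y = Re (ip x h)" if xy: "R x y" for x y
  proof -
    have xH: "x \<in> H" using xy mem by blast
    \<comment> \<open>First variation of \<open>J\<close> in the direction \<open>x\<close>, in the limit along the minimizing sequence.\<close>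
    have ineq: "0 \<le> s\<^sup>2 * (nrm x)\<^sup>2 + 2 * s * (Re (ip x h) - Re y)" for s :: real
    proof (rule LIMSEQ_le_const)
      show "(\<lambda>k. (J (u k) (v k) - m) + s\<^sup>2 * (nrm x)\<^sup>2 + 2 * s * (Re (ip (u k) x) - Re y))
          \<longlonglongrightarrow> s\<^sup>2 * (nrm x)\<^sup>2 + 2 * s * (Re (ip x h) - Re y)"
      proof -
        have "(\<lambda>k. (J (u k) (v k) - m) + s\<^sup>2 * (nrm x)\<^sup>2 + 2 * s * (Re (ip (u k) x) - Re y))
          \<longlonglongrightarrow> (m - m) + s\<^sup>2 * (nrm x)\<^sup>2 + 2 * s * (Re (ip h x) - Re y)"
          by (intro tendsto_intros limJ converges_ip_left[OF h xH])
        moreover have "Re (ip h x) = Re (ip x h)" using ip_commute[OF xH hH] by simp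
        ultimately show ?thesis by simp
      qed
      have "0 \<le> (J (u k) (v k) - m) + s\<^sup>2 * (nrm x)\<^sup>2 + 2 * s * (Re (ip (u k) x) - Re y)" for k
      proof -
        have "R (u k + of_real s *\<^sub>C x) (v k + of_real s * y)" using uv(1) xy add scale by blast
        then have "m \<le> J (u k + of_real s *\<^sub>C x) (v k + of_real s * y)" by (rule m_le)
        also have "\<dots> = J (u k) (v k) + s\<^sup>2 * (nrm x)\<^sup>2 + 2 * s * (Re (ip (u k) x) - Re y)"
          using uH xH by (simp add: J_def nrm_add_sq nrm_scale ip_scale_right power_mult_distrib
              algebra_simps)
        finally show ?thesis by simp
      qed
      then show "\<exists>N. \<forall>k\<ge>N. 0 \<le> (J (u k) (v k) - m) + s\<^sup>2 * (nrm x)\<^sup>2 + 2 * s * (Re (ip (u k) x) - Re y)"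
        by blast
    qed
    define b where "b = Re (ip x h) - Re y"
    define a where "a = (nrm x)\<^sup>2"
    have "a \<ge> 0" by (simp add: a_def)
    define q where "q = b / (a + 1)"
    have b: "b = q * (a + 1)" using \<open>a \<ge> 0\<close> by (simp add: q_def)
    have "0 \<le> q\<^sup>2 * a - 2 * q * b"
      using ineq[of "- q"] by (simp add: a_def b_def)
    also have "\<dots> = - (q\<^sup>2 * (a + 2))"
      unfolding b by (simp add: power2_eq_square algebra_simps)
    finally have "q = 0" using \<open>a \<ge> 0\<close> by (simp add: mult_le_0_iff)
    then have "b = 0" using b by simp
    then show ?thesis by (simp add: b_def)
  qed
  have rep: "y = ip x h" if xy: "R x y" for x y
  proof (rule complex_eqI)
    show "Re y = Re (ip x h)" by (rule var[OF xy])
    have "R (\<i> *\<^sub>C x) (\<i> * y)" using xy scale by blast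
    from var[OF this] show "Im y = Im (ip x h)"
      using mem[OF xy] hH by (simp add: ip_scale_left)
  qed
  have "nrm h \<le> C"
  proof -
    have "(\<lambda>k. cmod (ip (u k) h)) \<longlonglongrightarrow> cmod (ip h h)"
      by (intro tendsto_intros converges_ip_left h hH)
    moreover have "(\<lambda>k. C * nrm (u k)) \<longlonglongrightarrow> C * nrm h"
      by (intro tendsto_intros converges_nrm h)
    moreover have "cmod (ip (u k) h) \<le> C * nrm (u k)" for k
      using bound[OF uv(1)] rep[OF uv(1)] by metis
    ultimately have "cmod (ip h h) \<le> C * nrm h"
      by (intro LIMSEQ_le) auto
    then have "nrm h * nrm h \<le> C * nrm h"
      using hH ip_self by (simp add: power2_eq_square norm_mult)
    then show ?thesis
      using hH C0 nrm_nonneg[OF hH] by (cases "nrm h = 0") (auto simp: mult_le_cancel_right)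
  qed
  then show ?thesis using hH rep h uv(1) by blast
qed

lemma riesz:
  assumes C: "0 \<le> C"
    and add: "\<And>x y. x \<in> H \<Longrightarrow> y \<in> H \<Longrightarrow> \<phi> (x + y) = \<phi> x + \<phi> y"
    and scale: "\<And>c x. x \<in> H \<Longrightarrow> \<phi> (c *\<^sub>C x) = c * \<phi> x"
    and bound: "\<And>x. x \<in> H \<Longrightarrow> cmod (\<phi> x) \<le> C * nrm x"
  shows "\<exists>h\<in>H. nrm h \<le> C \<and> (\<forall>x\<in>H. \<phi> x = ip x h)"
proof -
  have "\<phi> 0 = 0" using scale[of 0 0] by simp
  then have "\<exists>h\<in>H. (\<forall>x y. x \<in> H \<and> y = \<phi> x \<longrightarrow> y = ip x h) \<and> nrm h \<le> C \<and>
           (\<exists>u. (\<forall>k. \<exists>y. u k \<in> H \<and> y = \<phi> (u k)) \<and> converges u h)"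
    by (intro riesz_relation) (use assms in auto)
  then show ?thesis by blast
qed

text \<open>
  The case \<open>y = \<langle>z, x\<rangle>\<close> of the previous principle: the representing vector is the projection of \<open>x\<close> to the
  closure of \<open>V\<close>.
\<close>

lemma approximation:
  assumes V: "complex_vector.subspace V" "V \<subseteq> H" and x: "x \<in> H"
  shows "\<exists>y\<in>H. (\<forall>z\<in>V. ip (x - y) z = 0) \<and> (\<exists>u. (\<forall>k. u k \<in> V) \<and> converges u y)"
proof -
  have "\<exists>h\<in>H. (\<forall>z y. z \<in> V \<and> y = ip z x \<longrightarrow> y = ip z h) \<and> nrm h \<le> nrm x \<and>
           (\<exists>u. (\<forall>k. \<exists>y. u k \<in> V \<and> y = ip (u k) x) \<and> converges u h)"
  proof (rule riesz_relation)
    show "cmod y \<le> nrm x * nrm z" if "z \<in> V \<and> y = ip z x" for z y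
      using Cauchy_Schwarz[of z x] that V x by (auto simp: mult.commute)
  qed (use V x in \<open>auto simp: complex_vector.subspace_0 complex_vector.subspace_add
        complex_vector.subspace_scale subsetD ip_add_left ip_scale_left\<close>)
  then obtain h u where h: "h \<in> H" "\<And>z. z \<in> V \<Longrightarrow> ip z x = ip z h" "\<And>k. u k \<in> V" "converges u h"
    by blast
  have "ip (x - h) z = 0" if "z \<in> V" for z
    using h(1) h(2)[OF that] x V(2) that ip_commute[of z x] ip_commute[of z h]
    by (auto simp: ip_diff_left)
  then show ?thesis using h by blast
qed

lemma dense_if_orthocomplement_trivial:
  assumes V: "complex_vector.subspace V" "V \<subseteq> H"
    and triv: "\<And>x. x \<in> H \<Longrightarrow> (\<And>v. v \<in> V \<Longrightarrow> ip x v = 0) \<Longrightarrow> x = 0"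
    and x: "x \<in> H"
  shows "\<exists>u. (\<forall>k. u k \<in> V) \<and> converges u x"
proof -
  obtain y u where y: "y \<in> H" "\<And>z. z \<in> V \<Longrightarrow> ip (x - y) z = 0" "\<And>k. u k \<in> V" "converges u y"
    using approximation[OF V x] by blast
  have "x - y = 0" using y x by (intro triv) auto
  then show ?thesis using y by auto
qed

lemma closed_subspace_projection:
  assumes M: "complex_vector.subspace M" "M \<subseteq> H"
    and closed: "\<And>u l. (\<And>k. u k \<in> M) \<Longrightarrow> converges u l \<Longrightarrow> l \<in> M" and x: "x \<in> H"
  shows "\<exists>y\<in>M. \<forall>z\<in>M. ip (x - y) z = 0"
  using approximation[OF M x] closed by blast

lemma hilbert_closed_subspace:
  assumes M: "complex_vector.subspace M" "M \<subseteq> H"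
    and closed: "\<And>u l. (\<And>k. u k \<in> M) \<Longrightarrow> converges u l \<Longrightarrow> l \<in> M"
  shows "hilbert M ip"
proof -
  interpret M: ip_space M ip by (rule ip_space_subspace[OF M])
  show ?thesis
  proof
    show "M.ms.mcomplete"
    proof (rule M.mcompleteI)
      fix x :: "nat \<Rightarrow> 'v"
      assume x: "\<And>k. x k \<in> M" "\<And>e. e > 0 \<Longrightarrow> \<exists>N. \<forall>i\<ge>N. \<forall>j\<ge>N. nrm (x i - x j) < e"
      have "\<exists>l. converges x l"
      proof (rule Cauchy_converges)
        show "\<And>k. x k \<in> H" using x(1) M(2) by blast
      qed (rule x(2))
      then obtain l where l: "converges x l" by blast
      then have "l \<in> M" using closed x(1) by blast
      then show "\<exists>l. M.converges x l"
        using l x(1) unfolding M.converges_def converges_def by blast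
    qed
  qed
qed

lemma adjoint_exists:
  assumes mem: "\<And>x. x \<in> H \<Longrightarrow> A x \<in> H"
    and add: "\<And>x y. x \<in> H \<Longrightarrow> y \<in> H \<Longrightarrow> A (x + y) = A x + A y"
    and scale: "\<And>c x. x \<in> H \<Longrightarrow> A (c *\<^sub>C x) = c *\<^sub>C A x"
    and bound: "\<And>x. x \<in> H \<Longrightarrow> nrm (A x) \<le> C * nrm x" and C: "0 \<le> C"
    and y: "y \<in> H"
  shows "hilbert_adjoint H ip A y \<in> H \<and> nrm (hilbert_adjoint H ip A y) \<le> C * nrm y \<and>
    (\<forall>x\<in>H. ip (A x) y = ip x (hilbert_adjoint H ip A y))"
proof -
  have "\<exists>h\<in>H. nrm h \<le> C * nrm y \<and> (\<forall>x\<in>H. ip (A x) y = ip x h)"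
  proof (rule riesz)
    show "cmod (ip (A x) y) \<le> C * nrm y * nrm x" if "x \<in> H" for x
    proof -
      have "cmod (ip (A x) y) \<le> nrm (A x) * nrm y" using that mem y by (intro Cauchy_Schwarz) auto
      also have "\<dots> \<le> C * nrm x * nrm y" using bound that y by (intro mult_right_mono) auto
      finally show ?thesis by (simp add: mult_ac)
    qed
  qed (use assms in \<open>auto simp: ip_add_left ip_scale_left\<close>)
  then obtain h where h: "h \<in> H" "nrm h \<le> C * nrm y" "\<And>x. x \<in> H \<Longrightarrow> ip (A x) y = ip x h" by blast
  have "hilbert_adjoint H ip A y = h" using h mem by (intro hilbert_adjoint_eqI) auto
  then show ?thesis using h by simp
qed

end

lemma tuple_space_ip_space:
  assumes "ip_space H ip"
  shows "ip_space (tuple_space H :: ('m::finite \<Rightarrow> 'v::complex_vector) set) (tuple_ip ip)"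
proof -
  interpret ip_space H ip by fact
  show ?thesis
  proof
    show "inner_product_space (tuple_space H :: ('m \<Rightarrow> 'v) set) (tuple_ip ip)"
      unfolding inner_product_space_def
    proof (intro conjI ballI allI impI)
      show "complex_vector.subspace (tuple_space H :: ('m \<Rightarrow> 'v) set)"
        by (auto simp: complex_vector.subspace_def tuple_space_def scaleC_fun_def)
      fix x :: "'m \<Rightarrow> 'v" assume x: "x \<in> tuple_space H"
      then have xH: "x j \<in> H" for j by (simp add: tuple_space_def)
      show "0 \<le> Re (tuple_ip ip x x)"
        unfolding tuple_ip_def using xH by (auto intro!: sum_nonneg Re_ip_self_nonneg)
      show "x = 0" if "tuple_ip ip x x = 0"
      proof -
        have "(\<Sum>j\<in>UNIV. (nrm (x j))\<^sup>2) = 0"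
          using that xH by (simp add: tuple_ip_def ip_self flip: of_real_sum of_real_power)
        then have "nrm (x j) = 0" for j by (simp add: sum_nonneg_eq_0_iff)
        then show ?thesis using nrm_eq_0 xH by (auto simp: fun_eq_iff)
      qed
      fix y :: "'m \<Rightarrow> 'v" assume y: "y \<in> tuple_space H"
      then have yH: "y j \<in> H" for j by (simp add: tuple_space_def)
      show "tuple_ip ip (c *\<^sub>C x) y = c * tuple_ip ip x y" for c
        using xH yH by (simp add: tuple_ip_def scaleC_fun_def ip_scale_left sum_distrib_left)
      have "ip (y j) (x j) = cnj (ip (x j) (y j))" for j using ip_commute[OF xH yH] .
      then show "tuple_ip ip y x = cnj (tuple_ip ip x y)"
        unfolding tuple_ip_def cnj_sum by (intro sum.cong) auto
      fix z :: "'m \<Rightarrow> 'v" assume "z \<in> tuple_space H"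
      then show "tuple_ip ip (x + y) z = tuple_ip ip x z + tuple_ip ip y z"
        using xH yH by (simp add: tuple_ip_def tuple_space_def ip_add_left sum.distrib)
    qed
  qed
qed

section \<open>The Drury-Arveson space\<close>

definition monomial :: "('d \<Rightarrow> nat) \<Rightarrow> complex ^ 'd::finite \<Rightarrow> complex" where
  "monomial \<gamma> z = (\<Prod>i\<in>UNIV. (z $ i) ^ \<gamma> i)"

lemma monomial_0 [simp]: "monomial (\<lambda>_. 0) z = 1"
  by (simp add: monomial_def)

lemma monomial_Suc: "monomial (\<gamma>(j := Suc (\<gamma> j))) z = z $ j * monomial \<gamma> z"
proof -
  have "monomial (\<gamma>(j := Suc (\<gamma> j))) z
      = (z $ j) ^ Suc (\<gamma> j) * (\<Prod>i\<in>UNIV - {j}. (z $ i) ^ (\<gamma>(j := Suc (\<gamma> j))) i)"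
    unfolding monomial_def by (subst prod.remove[of _ j]) auto
  also have "(\<Prod>i\<in>UNIV - {j}. (z $ i) ^ (\<gamma>(j := Suc (\<gamma> j))) i) = (\<Prod>i\<in>UNIV - {j}. (z $ i) ^ \<gamma> i)"
    by (intro prod.cong) auto
  also have "(z $ j) ^ Suc (\<gamma> j) * \<dots> = z $ j * ((z $ j) ^ \<gamma> j * (\<Prod>i\<in>UNIV - {j}. (z $ i) ^ \<gamma> i))"
    by simp
  also have "\<dots> = z $ j * monomial \<gamma> z"
    by (simp add: monomial_def prod.remove[of UNIV j])
  finally show ?thesis .
qed

lemma monomial_add: "monomial (\<lambda>i. \<gamma> i + \<delta> i) z = monomial \<gamma> z * monomial \<delta> z"
  by (simp add: monomial_def power_add prod.distrib)

lemma monomial_scale: "monomial \<gamma> (c *s z) = c ^ (\<Sum>i\<in>UNIV. \<gamma> i) * monomial \<gamma> z"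
  by (simp add: monomial_def power_mult_distrib prod.distrib power_sum)

text \<open>
  Building exponents by raising one entry at a time matches the factorization of a monomial into
  coordinates, so that facts about coordinate multiplications extend to all monomials.
\<close>

lemma exponent_induct [case_names zero Suc]:
  fixes \<gamma> :: "'d::finite \<Rightarrow> nat"
  assumes "P (\<lambda>_. 0)" "\<And>\<gamma> j. P \<gamma> \<Longrightarrow> P (\<gamma>(j := Suc (\<gamma> j)))"
  shows "P \<gamma>"
proof (induction "\<Sum>i\<in>UNIV. \<gamma> i" arbitrary: \<gamma>)
  case 0
  then have "\<gamma> = (\<lambda>_. 0)" by auto
  then show ?case using assms(1) by simp
next
  case (Suc m)
  then have "(\<Sum>i\<in>UNIV. \<gamma> i) \<noteq> 0" by linarith
  then obtain j where j: "\<gamma> j \<noteq> 0" by auto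
  define \<delta> where "\<delta> = \<gamma>(j := \<gamma> j - 1)"
  have \<gamma>: "\<gamma> = \<delta>(j := Suc (\<delta> j))" using j by (auto simp: \<delta>_def)
  have "(\<Sum>i\<in>UNIV. \<gamma> i) = Suc (\<Sum>i\<in>UNIV. \<delta> i)"
  proof -
    have "(\<Sum>i\<in>UNIV. \<gamma> i) = \<gamma> j + (\<Sum>i\<in>UNIV - {j}. \<gamma> i)" by (simp add: sum.remove)
    moreover have "(\<Sum>i\<in>UNIV. \<delta> i) = \<delta> j + (\<Sum>i\<in>UNIV - {j}. \<delta> i)" by (simp add: sum.remove)
    moreover have "(\<Sum>i\<in>UNIV - {j}. \<gamma> i) = (\<Sum>i\<in>UNIV - {j}. \<delta> i)"
      by (intro sum.cong) (auto simp: \<delta>_def)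
    moreover have "\<gamma> j = Suc (\<delta> j)" using j by (simp add: \<delta>_def)
    ultimately show ?thesis by linarith
  qed
  then have "P \<delta>" using Suc by auto
  then show ?case using assms(2)[of \<delta> j] \<gamma> by simp
qed

lemma poly_eval_monomial:
  "poly_eval p z = (\<Sum>a\<in>Poly_Mapping.keys p. Poly_Mapping.lookup p a * monomial (Poly_Mapping.lookup a) z)"
  by (simp add: poly_eval_def monomial_def)

abbreviation coord :: "'d \<Rightarrow> (complex ^ 'd \<Rightarrow> complex) \<Rightarrow> complex ^ 'd \<Rightarrow> complex" where
  "coord j \<equiv> mult_op (\<lambda>z. z $ j)"

lemma norm_vec_sq: "(norm (z :: complex ^ 'd::finite))\<^sup>2 = (\<Sum>i\<in>UNIV. (cmod (z $ i))\<^sup>2)"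
  by (simp add: norm_vec_def L2_set_def sum_nonneg)

lemma sum_cmod_mult_le:
  fixes w :: "complex ^ 'd::finite"
  shows "(\<Sum>i\<in>UNIV. cmod (w $ i) * \<bar>b i\<bar>) \<le> norm w * sqrt (\<Sum>i\<in>UNIV. (b i)\<^sup>2)"
  using L2_set_mult_ineq[of "\<lambda>i. cmod (w $ i)" b UNIV]
  by (simp add: norm_vec_def L2_set_def)

lemma cmod_inner_less_1:
  fixes z w :: "complex ^ 'd::finite"
  assumes "norm z < 1" "norm w < 1"
  shows "cmod (\<Sum>i\<in>UNIV. z $ i * cnj (w $ i)) < 1"
proof -
  have "cmod (\<Sum>i\<in>UNIV. z $ i * cnj (w $ i)) \<le> (\<Sum>i\<in>UNIV. cmod (z $ i) * \<bar>cmod (w $ i)\<bar>)"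
    by (rule order_trans[OF norm_sum]) (simp add: norm_mult)
  also have "\<dots> \<le> norm z * norm w"
    using sum_cmod_mult_le[of z "\<lambda>i. cmod (w $ i)"] by (simp flip: norm_vec_sq)
  also have "\<dots> < 1"
    using assms by (metis mult_strict_mono norm_ge_zero mult_1 zero_less_one)
  finally show ?thesis .
qed

lemma norm_smult_vec: "norm (s *s x) = norm s * norm x" for x :: "complex ^ 'k::finite"
  by (simp add: norm_vec_def norm_mult L2_set_def power_mult_distrib real_sqrt_mult flip: sum_distrib_left)

lemma mult_op_add: "mult_op g (x + y) = mult_op g x + mult_op g y"
  by (auto simp: mult_op_def algebra_simps)

lemma mult_op_scale: "mult_op g (c *\<^sub>C x) = c *\<^sub>C mult_op g x"
  by (auto simp: mult_op_def scaleC_fun_def scaleC_complex_def)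

lemma sum_fun_apply: "(sum f I) z = (\<Sum>i\<in>I. f i z)" for f :: "'i \<Rightarrow> 'x \<Rightarrow> 'y::ab_group_add"
  by (induction I rule: infinite_finite_induct) auto

lemma mult_op_mult_op: "mult_op f (mult_op g h) = mult_op (\<lambda>z. f z * g z) h"
  by (auto simp: mult_op_def mult.assoc)

lemma mult_op_commute: "mult_op f (mult_op g h) = mult_op g (mult_op f h)"
  by (auto simp: mult_op_def mult_ac)

lemma mult_op_monomial_0 [simp]: "mult_op (monomial (\<lambda>_. 0)) f = f"
  by (simp add: mult_op_def)

lemma mult_op_monomial_Suc:
  "mult_op (monomial (\<gamma>(j := Suc (\<gamma> j)))) f = coord j (mult_op (monomial \<gamma>) f)"
  by (simp add: mult_op_mult_op monomial_Suc[abs_def])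

lemma mult_op_poly:
  "mult_op (poly_eval p) f = (\<Sum>a\<in>Poly_Mapping.keys p.
     Poly_Mapping.lookup p a *\<^sub>C mult_op (monomial (Poly_Mapping.lookup a)) f)"
  by (auto simp: fun_eq_iff mult_op_def poly_eval_monomial sum_fun_apply scaleC_fun_def
      scaleC_complex_def sum_distrib_right mult.assoc)

lemma finite_exponents: "finite {\<gamma> :: 'd::finite \<Rightarrow> nat. (\<Sum>i\<in>UNIV. \<gamma> i) = m}"
proof (rule finite_subset)
  show "{\<gamma> :: 'd \<Rightarrow> nat. (\<Sum>i\<in>UNIV. \<gamma> i) = m} \<subseteq> (\<Pi>\<^sub>E i\<in>UNIV. {..m})"
    using member_le_sum[of _ "UNIV :: 'd set"] by (auto simp: PiE_UNIV_domain)
  show "finite ((\<Pi>\<^sub>E i\<in>UNIV. {..m}) :: ('d \<Rightarrow> nat) set)" by (intro finite_PiE) auto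
qed

locale drury_arveson =
  fixes H :: "(complex ^ 'd::finite \<Rightarrow> complex) set"
    and ip :: "(complex ^ 'd \<Rightarrow> complex) \<Rightarrow> (complex ^ 'd \<Rightarrow> complex) \<Rightarrow> complex"
  assumes DA: "drury_arveson_space H ip"
begin

sublocale hilbert H ip
  using DA by unfold_locales (simp_all add: drury_arveson_space_def rkhs_def hilbert_space_def)

definition kernel_at :: "complex ^ 'd \<Rightarrow> complex ^ 'd \<Rightarrow> complex" where
  "kernel_at w = kernel_section (ball 0 1) drury_arveson_kernel w"

lemma holomorphic: "f \<in> H \<Longrightarrow> holomorphic_in f (ball 0 1)"
  using DA by (simp add: drury_arveson_space_def)

lemma zero_outside: "f \<in> H \<Longrightarrow> \<not> norm z < 1 \<Longrightarrow> f z = 0"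
  using DA by (simp add: drury_arveson_space_def rkhs_def)

lemma kernel_at_mem [simp]: "norm w < 1 \<Longrightarrow> kernel_at w \<in> H"
  using DA by (simp add: drury_arveson_space_def rkhs_def kernel_at_def)

lemma reproducing: "f \<in> H \<Longrightarrow> norm w < 1 \<Longrightarrow> ip f (kernel_at w) = f w"
  using DA by (simp add: drury_arveson_space_def rkhs_def kernel_at_def)

lemma reproducing_left: "f \<in> H \<Longrightarrow> norm w < 1 \<Longrightarrow> ip (kernel_at w) f = cnj (f w)"
  using ip_commute[of f "kernel_at w"] reproducing by simp

lemma kernel_at_apply: "norm z < 1 \<Longrightarrow> kernel_at w z = 1 / (1 - (\<Sum>i\<in>UNIV. z $ i * cnj (w $ i)))"
  by (simp add: kernel_at_def kernel_section_def drury_arveson_kernel_def)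

lemma kernel_at_0_apply: "kernel_at 0 z = (if norm z < 1 then 1 else 0)"
  by (simp add: kernel_at_def kernel_section_def drury_arveson_kernel_def)

lemma kernel_at_denominator_nonzero:
  "norm z < 1 \<Longrightarrow> norm w < 1 \<Longrightarrow> 1 - (\<Sum>i\<in>UNIV. z $ i * cnj (w $ i)) \<noteq> 0"
  using cmod_inner_less_1[of z w] by auto

lemma ip_kernel_at_kernel_at:
  "norm z < 1 \<Longrightarrow> norm w < 1 \<Longrightarrow> ip (kernel_at w) (kernel_at z) = 1 / (1 - (\<Sum>i\<in>UNIV. z $ i * cnj (w $ i)))"
  by (simp add: reproducing kernel_at_apply)

text \<open>
  Lists keep track of the coefficients of a combination of kernel functions, which the function itself
  determines only through linear independence of the kernels.
\<close>

definition comb :: "(complex \<times> (complex ^ 'd)) list \<Rightarrow> complex ^ 'd \<Rightarrow> complex" where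
  "comb l = (\<Sum>(c, w)\<leftarrow>l. c *\<^sub>C kernel_at w)"

definition ball_list :: "(complex \<times> (complex ^ 'd)) list \<Rightarrow> bool" where
  "ball_list l \<longleftrightarrow> (\<forall>(c, w)\<in>set l. norm w < 1)"

lemma comb_simps [simp]: "comb [] = 0" "comb ((c, w) # l) = c *\<^sub>C kernel_at w + comb l"
  by (simp_all add: comb_def)

lemma ball_list_simps [simp]:
  "ball_list []" "ball_list ((c, w) # l) \<longleftrightarrow> norm w < 1 \<and> ball_list l"
  "ball_list (l @ l') \<longleftrightarrow> ball_list l \<and> ball_list l'"
  by (auto simp: ball_list_def)

lemma comb_append: "comb (l @ l') = comb l + comb l'"
  by (simp add: comb_def)

lemma comb_mem [simp]: "ball_list l \<Longrightarrow> comb l \<in> H"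
  by (induction l) auto

lemma ip_comb:
  "ball_list l \<Longrightarrow> f \<in> H \<Longrightarrow> ip f (comb l) = (\<Sum>(c, w)\<leftarrow>l. cnj c * f w)"
  by (induction l) (auto simp: ip_add_right ip_scale_right reproducing)

lemma comb_scale: "comb (map (\<lambda>(c, w). (a * c, w)) l) = a *\<^sub>C comb l"
  by (induction l) (auto simp: complex_vector.scale_right_distrib simp flip: zero_fun_def)

text \<open>
  A function belongs to the space as soon as pairing its values with finite combinations of
  kernel functions is bounded.  Membership of \<open>z\<^sub>j f\<close> and of the rotations of \<open>f\<close> is obtained from this,
  without any description of the space by power series.
\<close>

lemma kernel_criterion:
  assumes C: "0 \<le> C" and out: "\<And>z. \<not> norm z < 1 \<Longrightarrow> g z = 0"
    and bound: "\<And>l. ball_list l \<Longrightarrow> cmod (\<Sum>(c, w)\<leftarrow>l. c * cnj (g w)) \<le> C * nrm (comb l)"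
  shows "g \<in> H \<and> nrm g \<le> C"
proof -
  let ?s = "\<lambda>l. \<Sum>(c, w)\<leftarrow>l. c * cnj (g w)"
  have "\<exists>h\<in>H. (\<forall>x y. (\<exists>l. ball_list l \<and> x = comb l \<and> y = ?s l) \<longrightarrow> y = ip x h) \<and> nrm h \<le> C \<and>
           (\<exists>u. (\<forall>k. \<exists>y. (\<exists>l. ball_list l \<and> u k = comb l \<and> y = ?s l)) \<and> converges u h)"
  proof (rule riesz_relation[OF C])
    show "\<exists>l. ball_list l \<and> 0 = comb l \<and> 0 = ?s l" by (intro exI[of _ "[]"]) simp
    fix x y assume "\<exists>l. ball_list l \<and> x = comb l \<and> y = ?s l"
    then obtain l where l: "ball_list l" "x = comb l" "y = ?s l" by blast
    show "x \<in> H" using l by simp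
    show "cmod y \<le> C * nrm x" using l bound by simp
    show "\<exists>l. ball_list l \<and> a *\<^sub>C x = comb l \<and> a * y = ?s l" for a
    proof (intro exI[of _ "map (\<lambda>(c, w). (a * c, w)) l"] conjI)
      show "ball_list (map (\<lambda>(c, w). (a * c, w)) l)" using l(1) by (auto simp: ball_list_def)
      show "a *\<^sub>C x = comb (map (\<lambda>(c, w). (a * c, w)) l)" using l(2) by (simp add: comb_scale)
      show "a * y = ?s (map (\<lambda>(c, w). (a * c, w)) l)"
        unfolding l(3) by (induction l) (auto simp: algebra_simps)
    qed
    fix x' y' assume "\<exists>l. ball_list l \<and> x' = comb l \<and> y' = ?s l"
    then obtain l' where l': "ball_list l'" "x' = comb l'" "y' = ?s l'" by blast
    show "\<exists>l. ball_list l \<and> x + x' = comb l \<and> y + y' = ?s l"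
      using l l' by (intro exI[of _ "l @ l'"]) (simp add: comb_append)
  qed
  then obtain h where h: "h \<in> H" "nrm h \<le> C" and rep: "\<And>l. ball_list l \<Longrightarrow> ?s l = ip (comb l) h"
    by blast
  have "h z = g z" for z
  proof (cases "norm z < 1")
    case True
    then have "cnj (g z) = cnj (h z)" using rep[of "[(1, z)]"] h by (simp add: reproducing_left)
    then show ?thesis by simp
  next
    case False
    then show ?thesis using out zero_outside h by simp
  qed
  then have "h = g" by blast
  then show ?thesis using h by simp
qed

subsection \<open>The shift\<close>

definition shift_list :: "'d \<Rightarrow> (complex \<times> (complex ^ 'd)) list \<Rightarrow> (complex \<times> (complex ^ 'd)) list" where
  "shift_list j l = map (\<lambda>(c, w). (c * cnj (w $ j), w)) l"

lemma shift_list_simps [simp]: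
  "shift_list j [] = []" "shift_list j ((c, w) # l) = (c * cnj (w $ j), w) # shift_list j l"
  by (simp_all add: shift_list_def)

lemma ball_list_shift [simp]: "ball_list (shift_list j l) = ball_list l"
  by (induction l) auto

text \<open>
  Because \<open>(1 - \<langle>z, w\<rangle>) K(z, w) = 1\<close>.  As \<open>shift_list j\<close> is the adjoint of multiplication by \<open>z\<^sub>j\<close> on
  kernel functions, this is the operator identity \<open>\<Sum>\<^sub>j M\<^sub>j M\<^sub>j\<^sup>* = 1 - (projection to constants)\<close> on a
  dense subspace.
\<close>

lemma ip_comb_comb_shift:
  assumes "ball_list l" "ball_list l'"
  shows "ip (comb l) (comb l') =
    (\<Sum>j\<in>UNIV. ip (comb (shift_list j l)) (comb (shift_list j l'))) +
    (\<Sum>(c, w)\<leftarrow>l. c) * cnj (\<Sum>(c, w)\<leftarrow>l'. c)"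
  using assms(1)
proof (induction l)
  case Nil
  then show ?case using assms by (simp flip: zero_fun_def)
next
  case (Cons a l)
  obtain c w where a: "a = (c, w)" by force
  have w: "norm w < 1" and l: "ball_list l" using Cons.prems a by auto
  have single: "ip (kernel_at w) (comb l') =
      (\<Sum>j\<in>UNIV. cnj (w $ j) * ip (kernel_at w) (comb (shift_list j l'))) + cnj (\<Sum>(c, w)\<leftarrow>l'. c)"
    using assms(2)
  proof (induction l')
    case Nil
    then show ?case using w by (simp flip: zero_fun_def)
  next
    case (Cons b l')
    obtain d v where b: "b = (d, v)" by force
    have v: "norm v < 1" and l': "ball_list l'" using Cons.prems b by auto
    define q where "q = (\<Sum>i\<in>UNIV. v $ i * cnj (w $ i))"
    have q: "1 - q \<noteq> 0" unfolding q_def by (rule kernel_at_denominator_nonzero[OF v w])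
    have one: "(\<Sum>j\<in>UNIV. cnj (w $ j) * (cnj d * v $ j * ip (kernel_at w) (kernel_at v))) + cnj d
        = cnj d * ip (kernel_at w) (kernel_at v)"
    proof -
      have "(\<Sum>j\<in>UNIV. cnj (w $ j) * (cnj d * v $ j * ip (kernel_at w) (kernel_at v)))
          = cnj d * ip (kernel_at w) (kernel_at v) * q"
        unfolding q_def sum_distrib_left by (intro sum.cong) (auto simp: mult_ac)
      moreover have "ip (kernel_at w) (kernel_at v) = 1 / (1 - q)"
        unfolding q_def by (rule ip_kernel_at_kernel_at[OF v w])
      moreover have "cnj d * (1 / (1 - q)) * q + cnj d = cnj d * (1 / (1 - q))"
        using q by (simp add: field_simps)
      ultimately show ?thesis by simp
    qed
    show "ip (kernel_at w) (comb (b # l')) =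
      (\<Sum>j\<in>UNIV. cnj (w $ j) * ip (kernel_at w) (comb (shift_list j (b # l')))) + cnj (\<Sum>(c, w)\<leftarrow>b # l'. c)"
      using w v l' Cons.IH[OF l'] one
      by (simp add: b ip_add_right ip_scale_right distrib_left sum.distrib algebra_simps)
  qed
  show "ip (comb (a # l)) (comb l') =
    (\<Sum>j\<in>UNIV. ip (comb (shift_list j (a # l))) (comb (shift_list j l'))) +
    (\<Sum>(c, w)\<leftarrow>a # l. c) * cnj (\<Sum>(c, w)\<leftarrow>l'. c)"
    using w l Cons.IH[OF l] assms(2) single
    by (simp add: a ip_add_left ip_scale_left distrib_left sum.distrib sum_distrib_left algebra_simps)
qed

lemma comb_shift_sq:
  assumes "ball_list l"
  shows "(\<Sum>j\<in>UNIV. (nrm (comb (shift_list j l)))\<^sup>2) = (nrm (comb l))\<^sup>2 - (cmod (\<Sum>(c, w)\<leftarrow>l. c))\<^sup>2"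
proof -
  have "complex_of_real ((nrm (comb l))\<^sup>2) =
     of_real ((\<Sum>j\<in>UNIV. (nrm (comb (shift_list j l)))\<^sup>2) + (cmod (\<Sum>(c, w)\<leftarrow>l. c))\<^sup>2)"
    using ip_comb_comb_shift[OF assms assms] assms by (simp add: ip_self flip: complex_norm_square)
  then have "(nrm (comb l))\<^sup>2 =
     (\<Sum>j\<in>UNIV. (nrm (comb (shift_list j l)))\<^sup>2) + (cmod (\<Sum>(c, w)\<leftarrow>l. c))\<^sup>2"
    using of_real_eq_iff by blast
  then show ?thesis by simp
qed

lemma comb_shift_le:
  assumes "ball_list l"
  shows "nrm (comb (shift_list j l)) \<le> nrm (comb l)"
proof -
  have "(nrm (comb (shift_list j l)))\<^sup>2 \<le> (\<Sum>j\<in>UNIV. (nrm (comb (shift_list j l)))\<^sup>2)"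
    using member_le_sum[of j UNIV "\<lambda>j. (nrm (comb (shift_list j l)))\<^sup>2"] by simp
  also have "\<dots> \<le> (nrm (comb l))\<^sup>2" using comb_shift_sq[OF assms] by simp
  finally show ?thesis by (rule power2_le_imp_le) (simp add: assms)
qed

lemma coord_mem_nrm: 
  assumes f: "f \<in> H"
  shows "coord j f \<in> H \<and> nrm (coord j f) \<le> nrm f"
proof (rule kernel_criterion)
  show "0 \<le> nrm f" using f by simp
  show "coord j f z = 0" if "\<not> norm z < 1" for z using that f zero_outside by (simp add: mult_op_def)
  fix l assume l: "ball_list l"
  have l': "ball_list (shift_list j l)" using l by simp
  have "(\<Sum>(c, w)\<leftarrow>l. c * cnj (coord j f w)) = cnj (ip f (comb (shift_list j l)))"
    unfolding ip_comb[OF l' f]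
    by (induction l) (auto simp: mult_op_def)
  then have "cmod (\<Sum>(c, w)\<leftarrow>l. c * cnj (coord j f w)) \<le> nrm f * nrm (comb (shift_list j l))"
    using Cauchy_Schwarz[of f "comb (shift_list j l)"] l f by simp
  also have "\<dots> \<le> nrm f * nrm (comb l)"
    using comb_shift_le[OF l] f by (intro mult_left_mono) auto
  finally show "cmod (\<Sum>(c, w)\<leftarrow>l. c * cnj (coord j f w)) \<le> nrm f * nrm (comb l)" .
qed

lemma coord_mem [simp]: "f \<in> H \<Longrightarrow> coord j f \<in> H"
  using coord_mem_nrm by blast

lemma nrm_coord_le: "f \<in> H \<Longrightarrow> nrm (coord j f) \<le> nrm f"
  using coord_mem_nrm by blast

text \<open>
  The backward shift in the \<open>j\<close>-th variable.
\<close>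

definition bshift :: "'d \<Rightarrow> (complex ^ 'd \<Rightarrow> complex) \<Rightarrow> complex ^ 'd \<Rightarrow> complex" where
  "bshift j = hilbert_adjoint H ip (coord j)"

lemma bshift_props:
  assumes "h \<in> H"
  shows "bshift j h \<in> H \<and> nrm (bshift j h) \<le> 1 * nrm h \<and> (\<forall>f\<in>H. ip (coord j f) h = ip f (bshift j h))"
  unfolding bshift_def
  by (rule adjoint_exists) (auto simp: mult_op_add mult_op_scale nrm_coord_le assms)

lemma bshift_mem [simp]: "h \<in> H \<Longrightarrow> bshift j h \<in> H"
  using bshift_props by blast

lemma nrm_bshift_le: "h \<in> H \<Longrightarrow> nrm (bshift j h) \<le> nrm h"
  using bshift_props by simp

lemma ip_coord: "f \<in> H \<Longrightarrow> h \<in> H \<Longrightarrow> ip (coord j f) h = ip f (bshift j h)"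
  using bshift_props by blast

lemma eqI_ip:
  assumes "g \<in> H" "h \<in> H" "\<And>f. f \<in> H \<Longrightarrow> ip f g = ip f h"
  shows "g = h"
  using assms(3)[of "g - h"] ip_self_eq_0[of "g - h"] assms(1,2) by (simp add: ip_diff_right)

lemma bshift_eqI:
  assumes "h \<in> H" "g \<in> H" "\<And>f. f \<in> H \<Longrightarrow> ip (coord j f) h = ip f g"
  shows "bshift j h = g"
  using assms ip_coord[of _ h j] by (intro eqI_ip) auto

lemma bshift_add: "x \<in> H \<Longrightarrow> y \<in> H \<Longrightarrow> bshift j (x + y) = bshift j x + bshift j y"
  by (rule bshift_eqI) (simp_all add: ip_add_right ip_coord)

lemma bshift_scale: "x \<in> H \<Longrightarrow> bshift j (c *\<^sub>C x) = c *\<^sub>C bshift j x"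
  by (rule bshift_eqI) (simp_all add: ip_scale_right ip_coord)

lemma bshift_diff: "x \<in> H \<Longrightarrow> y \<in> H \<Longrightarrow> bshift j (x - y) = bshift j x - bshift j y"
  by (rule bshift_eqI) (simp_all add: ip_diff_right ip_coord)

lemma coord_commute: "coord i (coord j f) = coord j (coord i f)"
  by (auto simp: mult_op_def)

lemma bshift_commute: "h \<in> H \<Longrightarrow> bshift i (bshift j h) = bshift j (bshift i h)"
  by (rule bshift_eqI) (simp_all add: coord_commute[of j i] flip: ip_coord)

lemma bshift_comb: "ball_list l \<Longrightarrow> bshift j (comb l) = comb (shift_list j l)"
proof (rule bshift_eqI)
  assume l: "ball_list l"
  show "comb l \<in> H" "comb (shift_list j l) \<in> H" using l by auto
  fix f assume f: "f \<in> H"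
  have "ball_list (shift_list j l)" using l by simp
  from ip_comb[OF this f] show "ip (coord j f) (comb l) = ip f (comb (shift_list j l))"
    unfolding ip_comb[OF l coord_mem[OF f]]
    by (simp add: mult_op_def shift_list_def comp_def case_prod_beta' mult_ac)
qed

lemma comb_dense:
  assumes "h \<in> H"
  shows "\<exists>l. (\<forall>k. ball_list (l k)) \<and> converges (\<lambda>k. comb (l k)) h"
proof -
  have "\<exists>u. (\<forall>k. u k \<in> comb ` Collect ball_list) \<and> converges u h"
  proof (rule dense_if_orthocomplement_trivial[OF _ _ _ assms])
    show "complex_vector.subspace (comb ` Collect ball_list)"
    proof (rule complex_vector.subspaceI)
      show "0 \<in> comb ` Collect ball_list" by (rule image_eqI[of _ _ "[]"]) auto
      show "x + y \<in> comb ` Collect ball_list"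
        if xy: "x \<in> comb ` Collect ball_list" "y \<in> comb ` Collect ball_list" for x y
      proof -
        obtain l where "x = comb l" "l \<in> Collect ball_list" using xy(1) by (rule imageE)
        moreover obtain l' where "y = comb l'" "l' \<in> Collect ball_list" using xy(2) by (rule imageE)
        ultimately show ?thesis by (intro image_eqI[of _ _ "l @ l'"]) (auto simp: comb_append)
      qed
      show "c *\<^sub>C x \<in> comb ` Collect ball_list" if x: "x \<in> comb ` Collect ball_list" for c x
      proof -
        obtain l where "x = comb l" "l \<in> Collect ball_list" using x by (rule imageE)
        then show ?thesis
          by (intro image_eqI[of _ _ "map (\<lambda>(b, w). (c * b, w)) l"]) (auto simp: comb_scale ball_list_def)
      qed
    qed
    show "comb ` Collect ball_list \<subseteq> H" by auto
    show "x = 0" if x: "x \<in> H" and perp: "\<And>v. v \<in> comb ` Collect ball_list \<Longrightarrow> ip x v = 0" for x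
    proof
      fix z
      show "x z = 0 z"
      proof (cases "norm z < 1")
        case True
        then have "ip x (comb [(1, z)]) = 0" by (intro perp imageI) simp
        then show ?thesis using True x by (simp add: reproducing)
      qed (use zero_outside x in simp)
    qed
  qed
  then obtain u where u: "\<And>k. u k \<in> comb ` Collect ball_list" "converges u h" by blast
  then have "\<forall>k. \<exists>l. ball_list l \<and> u k = comb l" by blast
  then obtain l where l: "\<And>k. ball_list (l k)" "\<And>k. u k = comb (l k)" by metis
  then show ?thesis using u(2) by (metis ext)
qed

text \<open>
  The row of coordinate multiplications is a contraction whose defect is exactly the projection to the
  constants.  The norm estimates below rest on this identity.
\<close>

lemma sum_bshift_sq:
  assumes h: "h \<in> H"
  shows "(\<Sum>j\<in>UNIV. (nrm (bshift j h))\<^sup>2) = (nrm h)\<^sup>2 - (cmod (ip h (kernel_at 0)))\<^sup>2"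
proof -
  obtain l where l: "\<And>k. ball_list (l k)" "converges (\<lambda>k. comb (l k)) h"
    using comb_dense[OF h] by blast
  have eq: "(\<Sum>j\<in>UNIV. (nrm (bshift j (comb (l k))))\<^sup>2)
      = (nrm (comb (l k)))\<^sup>2 - (cmod (ip (comb (l k)) (kernel_at 0)))\<^sup>2" for k
  proof -
    have "ip (comb l') (kernel_at 0) = (\<Sum>(c, w)\<leftarrow>l'. c)" if "ball_list l'" for l'
      using that by (induction l') (auto simp: ip_add_left ip_scale_left ip_kernel_at_kernel_at)
    then show ?thesis using comb_shift_sq[OF l(1)] bshift_comb[OF l(1)] l(1) by simp
  qed
  have "converges (\<lambda>k. bshift j (comb (l k))) (bshift j h)" for j
    by (rule converges_image[OF l(2), of "bshift j" 1]) (auto simp: bshift_diff nrm_bshift_le)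
  then have "(\<lambda>k. nrm (bshift j (comb (l k)))) \<longlonglongrightarrow> nrm (bshift j h)" for j
    by (rule converges_nrm)
  then have 1: "(\<lambda>k. \<Sum>j\<in>UNIV. (nrm (bshift j (comb (l k))))\<^sup>2) \<longlonglongrightarrow> (\<Sum>j\<in>UNIV. (nrm (bshift j h))\<^sup>2)"
    by (intro tendsto_intros)
  have 2: "(\<lambda>k. (nrm (comb (l k)))\<^sup>2 - (cmod (ip (comb (l k)) (kernel_at 0)))\<^sup>2)
      \<longlonglongrightarrow> (nrm h)\<^sup>2 - (cmod (ip h (kernel_at 0)))\<^sup>2"
    by (intro tendsto_intros converges_nrm[OF l(2)] converges_ip_left[OF l(2)]) simp
  show ?thesis using LIMSEQ_unique[OF 1[unfolded eq] 2] .
qed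

lemma mult_monomial_props: "f \<in> H \<Longrightarrow> mult_op (monomial \<gamma>) f \<in> H \<and> nrm (mult_op (monomial \<gamma>) f) \<le> nrm f"
proof (induction \<gamma> rule: exponent_induct)
  case (Suc \<gamma> j)
  then show ?case
    unfolding mult_op_monomial_Suc using nrm_coord_le[of "mult_op (monomial \<gamma>) f" j] by auto
qed simp

lemma mult_monomial_mem [simp]: "f \<in> H \<Longrightarrow> mult_op (monomial \<gamma>) f \<in> H"
  using mult_monomial_props by blast

lemma nrm_mult_monomial_le: "f \<in> H \<Longrightarrow> nrm (mult_op (monomial \<gamma>) f) \<le> nrm f"
  using mult_monomial_props by blast

lemma mult_poly_mem [simp]: "f \<in> H \<Longrightarrow> mult_op (poly_eval p) f \<in> H"
  by (simp add: mult_op_poly)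

lemma nrm_mult_poly_le:
  assumes "f \<in> H"
  shows "nrm (mult_op (poly_eval p) f) \<le> (\<Sum>a\<in>Poly_Mapping.keys p. cmod (Poly_Mapping.lookup p a)) * nrm f"
  unfolding mult_op_poly sum_distrib_right using assms
  by (intro order_trans[OF nrm_sum_le] sum_mono)
    (auto simp: nrm_scale intro!: mult_left_mono nrm_mult_monomial_le)

definition mon :: "('d \<Rightarrow> nat) \<Rightarrow> complex ^ 'd \<Rightarrow> complex" where
  "mon \<gamma> = mult_op (monomial \<gamma>) (kernel_at 0)"

lemma mon_mem [simp]: "mon \<gamma> \<in> H"
  by (simp add: mon_def)

lemma mon_apply: "mon \<gamma> z = (if norm z < 1 then monomial \<gamma> z else 0)"
  by (simp add: mon_def mult_op_def kernel_at_0_apply)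

lemma mult_op_monomial_mon: "mult_op (monomial \<gamma>) (mon \<delta>) = mon (\<lambda>i. \<gamma> i + \<delta> i)"
  by (simp add: mon_def mult_op_mult_op monomial_add[abs_def])

lemma coord_mon: "coord j (mon \<gamma>) = mon (\<gamma>(j := Suc (\<gamma> j)))"
  by (simp add: mon_def mult_op_monomial_Suc)

lemma mons_subset [simp]: "mon ` A \<subseteq> H"
  by auto

subsection \<open>Density of the polynomials\<close>

text \<open>
  Multiplication by the linear form \<open>\<langle>\<cdot>, w\<rangle>\<close>.
\<close>

definition times_form :: "complex ^ 'd \<Rightarrow> (complex ^ 'd \<Rightarrow> complex) \<Rightarrow> complex ^ 'd \<Rightarrow> complex" where
  "times_form w g = (\<Sum>j\<in>UNIV. cnj (w $ j) *\<^sub>C coord j g)"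

lemma times_form_mem [simp]: "g \<in> H \<Longrightarrow> times_form w g \<in> H"
  by (simp add: times_form_def)

lemma times_form_add: "times_form w (f + g) = times_form w f + times_form w g"
  by (simp add: times_form_def mult_op_add complex_vector.scale_right_distrib sum.distrib)

text \<open>
  Duality with the row contraction property.
\<close>

lemma nrm_times_form_le:
  assumes g: "g \<in> H"
  shows "nrm (times_form w g) \<le> norm w * nrm g"
proof -
  define h where "h = times_form w g"
  have h: "h \<in> H" using g by (simp add: h_def)
  have "nrm h * nrm h = cmod (ip h h)" using h by (simp add: ip_self power2_eq_square norm_mult)
  also have "ip h h = (\<Sum>j\<in>UNIV. cnj (w $ j) * ip g (bshift j h))"
    using g h by (subst h_def) (simp add: times_form_def ip_sum_left ip_scale_left ip_coord)
  also have "cmod \<dots> \<le> (\<Sum>j\<in>UNIV. cmod (w $ j) * (nrm g * nrm (bshift j h)))"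
    using g h by (intro order_trans[OF norm_sum] sum_mono)
      (auto simp: norm_mult intro!: mult_left_mono Cauchy_Schwarz)
  also have "\<dots> = nrm g * (\<Sum>j\<in>UNIV. cmod (w $ j) * \<bar>nrm (bshift j h)\<bar>)"
    using h by (simp add: sum_distrib_left mult_ac)
  also have "\<dots> \<le> nrm g * (norm w * sqrt (\<Sum>j\<in>UNIV. (nrm (bshift j h))\<^sup>2))"
    using g by (intro mult_left_mono sum_cmod_mult_le) auto
  also have "\<dots> \<le> nrm g * (norm w * nrm h)"
    using g h sum_bshift_sq[OF h] by (intro mult_left_mono real_le_lsqrt) auto
  finally have "nrm h * nrm h \<le> norm w * nrm g * nrm h" by (simp add: mult_ac)
  then have "nrm h \<le> norm w * nrm g"
    using g h nrm_nonneg[OF h] by (cases "nrm h = 0") (auto simp: mult_le_cancel_right)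
  then show ?thesis by (simp add: h_def)
qed

lemma kernel_at_expansion:
  assumes w: "norm w < 1"
  shows "kernel_at w = kernel_at 0 + times_form w (kernel_at w)"
proof
  fix z
  show "kernel_at w z = (kernel_at 0 + times_form w (kernel_at w)) z"
  proof (cases "norm z < 1")
    case True
    have "times_form w (kernel_at w) z = (\<Sum>j\<in>UNIV. z $ j * cnj (w $ j)) * kernel_at w z"
      by (simp add: times_form_def sum_fun_apply scaleC_fun_def scaleC_complex_def mult_op_def
          sum_distrib_left mult_ac)
    then show ?thesis
      using True kernel_at_denominator_nonzero[OF True w] by (simp add: kernel_at_apply kernel_at_0_apply field_simps)
  next
    case False
    then show ?thesis
      using zero_outside[of "kernel_at w" z] zero_outside[of "times_form w (kernel_at w)" z] w
      by (simp add: kernel_at_0_apply)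
  qed
qed

lemma span_mons_coord:
  "g \<in> complex_vector.span (range mon) \<Longrightarrow> coord j g \<in> complex_vector.span (range mon)"
proof -
  have "complex_vector.span (range mon) \<subseteq> {g. coord j g \<in> complex_vector.span (range mon)}"
  proof (rule complex_vector.span_minimal)
    show "range mon \<subseteq> {g. coord j g \<in> complex_vector.span (range mon)}"
      by (auto simp: coord_mon intro: complex_vector.span_base)
    have "coord j 0 = 0" by (auto simp: mult_op_def)
    then show "complex_vector.subspace {g. coord j g \<in> complex_vector.span (range mon)}"
      by (intro complex_vector.subspaceI)
        (auto simp: mult_op_add mult_op_scale complex_vector.span_zero complex_vector.span_add
          complex_vector.span_scale)
  qed
  then show "g \<in> complex_vector.span (range mon) \<Longrightarrow> ?thesis" by blast
qed

text \<open>
  By \<open>kernel_at_expansion\<close>, \<open>k\<^sub>w = 1 + \<langle>\<cdot>, w\<rangle> + \<dots> + \<langle>\<cdot>, w\<rangle>\<^sup>N k\<^sub>w\<close>, and multiplication by the form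
  has norm at most \<open>|w| < 1\<close>.  So \<open>f(w)\<close> is, up to an error tending to zero, the pairing of \<open>f\<close> with a
  polynomial.
\<close>

lemma mons_total:
  assumes f: "f \<in> H" and perp: "\<And>\<gamma>. ip f (mon \<gamma>) = 0"
  shows "f = 0"
proof
  fix w
  show "f w = 0 w"
  proof (cases "norm w < 1")
    case True
    let ?L = "times_form w"
    have LH: "(?L ^^ N) g \<in> H" if "g \<in> H" for N g using that by (induction N) auto
    have Lspan: "(?L ^^ N) (kernel_at 0) \<in> complex_vector.span (range mon)" for N
    proof (induction N)
      case 0
      have "kernel_at 0 = mon (\<lambda>_. 0)" by (simp add: mon_def)
      then show ?case by (simp add: complex_vector.span_base)
    next
      case (Suc N)
      then show ?case
        by (auto simp: times_form_def intro!: complex_vector.span_sum complex_vector.span_scale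
            span_mons_coord)
    qed
    have Ladd: "(?L ^^ N) (x + y) = (?L ^^ N) x + (?L ^^ N) y" for N x y
    proof (induction N)
      case (Suc N)
      show "(?L ^^ Suc N) (x + y) = (?L ^^ Suc N) x + (?L ^^ Suc N) y"
        unfolding funpow.simps o_apply Suc by (rule times_form_add)
    qed simp
    have k: "kernel_at w \<in> H" using True by simp
    have eq: "ip f (kernel_at w) = ip f ((?L ^^ N) (kernel_at w))" for N
    proof (induction N)
      case (Suc N)
      have "ip f ((?L ^^ N) (kernel_at 0)) = 0"
        by (rule orthogonal_span_right[OF f _ _ Lspan]) (auto simp: perp)
      moreover have split: "(?L ^^ N) (kernel_at w) = (?L ^^ N) (kernel_at 0) + (?L ^^ Suc N) (kernel_at w)"
        using Ladd[of N "kernel_at 0" "?L (kernel_at w)"] kernel_at_expansion[OF True]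
        by (simp only: funpow.simps o_apply funpow_swap1[symmetric])
      moreover have "ip f ((?L ^^ N) (kernel_at w)) = ip f ((?L ^^ N) (kernel_at 0)) + ip f ((?L ^^ Suc N) (kernel_at w))"
        using LH[OF k, of "Suc N"] LH[OF kernel_at_mem[of 0], of N] f
        by (subst split) (rule ip_add_right; simp)
      ultimately show ?case using Suc by simp
    qed simp
    have bound: "cmod (f w) \<le> nrm f * nrm (kernel_at w) * norm w ^ N" for N
    proof -
      have "nrm ((?L ^^ N) (kernel_at w)) \<le> norm w ^ N * nrm (kernel_at w)"
      proof (induction N)
        case (Suc N)
        have "nrm ((?L ^^ Suc N) (kernel_at w)) \<le> norm w * nrm ((?L ^^ N) (kernel_at w))"
          using nrm_times_form_le[OF LH[OF k]] by simp
        also have "\<dots> \<le> norm w * (norm w ^ N * nrm (kernel_at w))"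
          by (intro mult_left_mono Suc) simp
        finally show ?case by (simp add: mult_ac)
      qed simp
      then have "nrm f * nrm ((?L ^^ N) (kernel_at w)) \<le> nrm f * (norm w ^ N * nrm (kernel_at w))"
        using f by (intro mult_left_mono) auto
      moreover have "cmod (f w) \<le> nrm f * nrm ((?L ^^ N) (kernel_at w))"
        using Cauchy_Schwarz[OF f LH[OF k, of N]] eq[of N] reproducing[OF f True] by simp
      ultimately show ?thesis by (simp add: mult_ac)
    qed
    have "(\<lambda>N. nrm f * nrm (kernel_at w) * norm w ^ N) \<longlonglongrightarrow> nrm f * nrm (kernel_at w) * 0"
      using True by (intro tendsto_intros) auto
    then have "cmod (f w) \<le> 0" using bound by (intro LIMSEQ_le_const) auto
    then show ?thesis by simp
  qed (use zero_outside f in simp)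
qed

subsection \<open>The grading\<close>

definition hom :: "nat \<Rightarrow> (complex ^ 'd \<Rightarrow> complex) set" where
  "hom m = complex_vector.span (mon ` {\<gamma>. (\<Sum>i\<in>UNIV. \<gamma> i) = m})"

lemma hom_subset: "hom m \<subseteq> H"
  unfolding hom_def by (rule span_subset) simp

lemma mon_hom: "mon \<gamma> \<in> hom (\<Sum>i\<in>UNIV. \<gamma> i)"
  unfolding hom_def by (rule complex_vector.span_base) auto

text \<open>
  The kernel is invariant under rotation of both arguments by the same unimodular factor.
\<close>

lemma rotate_mem_nrm:
  assumes f: "f \<in> H" and \<zeta>: "cmod \<zeta> = 1"
  shows "(\<lambda>z. f (\<zeta> *s z)) \<in> H \<and> nrm (\<lambda>z. f (\<zeta> *s z)) \<le> nrm f"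
proof (rule kernel_criterion)
  define rot where "rot = map (\<lambda>(c :: complex, w :: complex ^ 'd). (c, \<zeta> *s w))"
  have nr: "norm (\<zeta> *s z) = norm z" for z :: "complex ^ 'd"
    using \<zeta> by (simp add: norm_smult_vec)
  have z1: "\<zeta> * cnj \<zeta> = 1" using \<zeta> by (simp add: complex_norm_square[symmetric])
  show "0 \<le> nrm f" using f by simp
  show "f (\<zeta> *s z) = 0" if "\<not> norm z < 1" for z using that f zero_outside nr by simp
  have rot_simps: "rot [] = []" "rot ((c, w) # l) = (c, \<zeta> *s w) # rot l" for c w l
    by (simp_all add: rot_def)
  have rot_ball: "ball_list (rot l) = ball_list l" for l
    by (induction l) (auto simp: rot_simps nr)
  have kk: "ip (kernel_at (\<zeta> *s w)) (kernel_at (\<zeta> *s v)) = ip (kernel_at w) (kernel_at v)" if "norm w < 1" "norm v < 1" for v w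
  proof -
    have "(\<Sum>i\<in>UNIV. (\<zeta> *s v) $ i * cnj ((\<zeta> *s w) $ i)) = (\<Sum>i\<in>UNIV. v $ i * cnj (w $ i))"
    proof (intro sum.cong refl)
      fix i
      have "(\<zeta> *s v) $ i * cnj ((\<zeta> *s w) $ i) = (\<zeta> * cnj \<zeta>) * (v $ i * cnj (w $ i))"
        by (simp add: mult_ac)
      then show "(\<zeta> *s v) $ i * cnj ((\<zeta> *s w) $ i) = v $ i * cnj (w $ i)" using z1 by simp
    qed
    then show ?thesis using that nr by (simp add: ip_kernel_at_kernel_at)
  qed
  have ip_rot: "ip (comb (rot l)) (comb (rot l')) = ip (comb l) (comb l')"
    if "ball_list l" "ball_list l'" for l l'
    using that(1)
  proof (induction l)
    case Nil
    then show ?case using that(2) rot_ball by (simp add: rot_simps flip: zero_fun_def)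
  next
    case (Cons a l)
    obtain c w where a: "a = (c, w)" by force
    have w: "norm w < 1" and l: "ball_list l" using Cons.prems a by auto
    have "ip (kernel_at (\<zeta> *s w)) (comb (rot l')) = ip (kernel_at w) (comb l')"
      using that(2)
    proof (induction l')
      case Nil
      then show ?case using w nr by (simp add: rot_simps flip: zero_fun_def)
    next
      case (Cons b l')
      obtain d v where b: "b = (d, v)" by force
      show "ip (kernel_at (\<zeta> *s w)) (comb (rot (b # l'))) = ip (kernel_at w) (comb (b # l'))"
        using w Cons b by (simp add: rot_simps rot_ball nr kk ip_add_right ip_scale_right)
    qed
    then show "ip (comb (rot (a # l))) (comb (rot l')) = ip (comb (a # l)) (comb l')"
      using w l Cons.IH[OF l] that(2) by (simp add: a rot_simps rot_ball nr ip_add_left ip_scale_left)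
  qed
  fix l assume l: "ball_list l"
  have rl: "ball_list (rot l)" using l rot_ball by simp
  have "(\<Sum>(c, w)\<leftarrow>l. c * cnj (f (\<zeta> *s w))) = cnj (ip f (comb (rot l)))"
    unfolding ip_comb[OF rl f] by (induction l) (auto simp: rot_simps)
  moreover have "nrm (comb (rot l)) = nrm (comb l)"
    unfolding hnorm_def ip_rot[OF l l] ..
  ultimately show "cmod (\<Sum>(c, w)\<leftarrow>l. c * cnj (f (\<zeta> *s w))) \<le> nrm f * nrm (comb l)"
    using Cauchy_Schwarz[OF f comb_mem[OF rl]] by simp
qed

text \<open>
  Choose a rotation that multiplies the two monomials by opposite numbers.  Since rotations do not increase
  norms, \<open>|x - c y| \<le> |x + c y|\<close> for every scalar \<open>c\<close>, and this forces orthogonality.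
\<close>

lemma mon_orthogonal:
  assumes ne: "(\<Sum>i\<in>UNIV. \<gamma> i) \<noteq> (\<Sum>i\<in>UNIV. \<delta> i)"
  shows "ip (mon \<gamma>) (mon \<delta>) = 0"
proof -
  define m where "m = (\<Sum>i\<in>UNIV. \<gamma> i)"
  define k where "k = (\<Sum>i\<in>UNIV. \<delta> i)"
  define t where "t = pi / (real k - real m)"
  define \<zeta> where "\<zeta> = cis t"
  have \<zeta>1: "cmod \<zeta> = 1" by (simp add: \<zeta>_def)
  have "k \<noteq> m" using ne by (simp add: m_def k_def)
  then have "real k - real m \<noteq> 0" by simp
  then have "real k * t = real m * t + pi" by (simp add: t_def field_simps)
  then have flip: "\<zeta> ^ k = - (\<zeta> ^ m)"
    unfolding \<zeta>_def Complex.DeMoivre by (simp flip: cis_mult)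
  have norm_rot: "norm (\<zeta> *s z) = norm z" for z :: "complex ^ 'd"
    using \<zeta>1 by (simp add: norm_smult_vec)
  \<comment> \<open>It suffices to use four values of the scalar: the units 1, -1, i and -i.\<close>
  have pos: "0 \<le> Re (cnj c * ip (mon \<gamma>) (mon \<delta>))" for c
  proof -
    have rot: "(\<lambda>z. (mon \<gamma> + c *\<^sub>C mon \<delta>) (\<zeta> *s z)) = \<zeta> ^ m *\<^sub>C (mon \<gamma> - c *\<^sub>C mon \<delta>)"
      by (auto simp: fun_eq_iff mon_apply norm_rot scaleC_fun_def scaleC_complex_def monomial_scale
          flip[unfolded k_def] m_def algebra_simps)
    have "nrm (\<lambda>z. (mon \<gamma> + c *\<^sub>C mon \<delta>) (\<zeta> *s z)) \<le> nrm (mon \<gamma> + c *\<^sub>C mon \<delta>)"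
      using rotate_mem_nrm[of "mon \<gamma> + c *\<^sub>C mon \<delta>" \<zeta>] \<zeta>1 by simp
    then have "nrm (mon \<gamma> - c *\<^sub>C mon \<delta>) \<le> nrm (mon \<gamma> + c *\<^sub>C mon \<delta>)"
      unfolding rot by (simp add: nrm_scale norm_power \<zeta>1)
    then have "(nrm (mon \<gamma> - c *\<^sub>C mon \<delta>))\<^sup>2 \<le> (nrm (mon \<gamma> + c *\<^sub>C mon \<delta>))\<^sup>2"
      by (intro power_mono) auto
    then show ?thesis by (simp add: nrm_add_sq nrm_diff_sq ip_scale_right)
  qed
  show ?thesis
    using pos[of 1] pos[of "-1"] pos[of \<i>] pos[of "-\<i>"]
    by (intro complex_eqI) simp_all
qed

lemma hom_orthogonal:
  assumes "m \<noteq> k" "f \<in> hom m" "g \<in> hom k"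
  shows "ip f g = 0"
  using assms(2,3) unfolding hom_def
  by (rule orthogonal_spans[rotated 3]) (use assms(1) in \<open>auto intro!: mon_orthogonal\<close>)

text \<open>
  Distinct degrees are orthogonal, so projecting to one of them extracts the homogeneous component.
\<close>

definition component :: "nat \<Rightarrow> (complex ^ 'd \<Rightarrow> complex) \<Rightarrow> complex ^ 'd \<Rightarrow> complex" where
  "component m = orth_projection (hom m) ip"

lemma component_props:
  assumes "f \<in> H"
  shows "component m f \<in> hom m \<and> (\<forall>g\<in>hom m. ip (f - component m f) g = 0)"
proof -
  obtain y where y: "y \<in> hom m" "\<And>z. z \<in> hom m \<Longrightarrow> ip (f - y) z = 0"
    using finite_span_projection[of "mon ` {\<gamma>. (\<Sum>i\<in>UNIV. \<gamma> i) = m}" f] finite_exponents assms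
    unfolding hom_def by auto
  have "component m f = y"
    unfolding component_def using assms y hom_subset
    by (intro orth_projection_eqI) (auto simp: hom_def)
  then show ?thesis using y by blast
qed

lemma component_hom: "f \<in> H \<Longrightarrow> component m f \<in> hom m"
  using component_props by blast

lemma component_mem [simp]: "f \<in> H \<Longrightarrow> component m f \<in> H"
  using component_hom hom_subset by blast

lemma ip_component: "f \<in> H \<Longrightarrow> g \<in> hom m \<Longrightarrow> ip (component m f) g = ip f g"
  using component_props[of f m] subsetD[OF hom_subset, of g m] ip_diff_left[of f "component m f" g] by simp

text \<open>
  Partial sums of components are best approximations by polynomials of bounded degree, and polynomials are
  dense.
\<close>

lemma component_converges:
  assumes f: "f \<in> H"
  shows "converges (\<lambda>N. \<Sum>k\<le>N. component k f) f"
proof -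
  define F where "F N = (\<Sum>k\<le>N. component k f)" for N
  define pol where "pol N = complex_vector.span (mon ` {\<gamma>. (\<Sum>i\<in>UNIV. \<gamma> i) \<le> N})" for N
  have FH: "F N \<in> H" for N using f by (simp add: F_def)
  have pol_mono: "pol M \<subseteq> pol N" if "M \<le> N" for M N
    unfolding pol_def using that by (intro complex_vector.span_mono) auto
  have pol_sub: "complex_vector.subspace (pol N)" for N unfolding pol_def by simp
  have polH: "pol N \<subseteq> H" for N unfolding pol_def by (rule span_subset) simp
  have F_pol: "F N \<in> pol N" for N
  proof -
    have "hom k \<subseteq> pol N" if "k \<le> N" for k
      unfolding hom_def pol_def using that by (intro complex_vector.span_mono) auto
    then show ?thesis
      unfolding F_def using component_hom[OF f] by (intro complex_vector.subspace_sum pol_sub) auto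
  qed
  have perp: "ip (f - F N) g = 0" if g: "g \<in> pol N" for g N
  proof (rule orthogonal_span_right[OF _ _ _ g[unfolded pol_def]])
    fix b assume "b \<in> mon ` {\<gamma>. (\<Sum>i\<in>UNIV. \<gamma> i) \<le> N}"
    then obtain \<gamma> where b: "b = mon \<gamma>" and k: "(\<Sum>i\<in>UNIV. \<gamma> i) \<le> N" by blast
    define k where "k = (\<Sum>i\<in>UNIV. \<gamma> i)"
    have bh: "b \<in> hom k" unfolding b k_def by (rule mon_hom)
    have "ip (F N) b = (\<Sum>i\<le>N. ip (component i f) b)"
      using f by (simp add: F_def b ip_sum_left)
    also have "\<dots> = (\<Sum>i\<le>N. if i = k then ip f b else 0)"
      using bh hom_orthogonal[OF _ component_hom[OF f] bh] ip_component[OF f bh]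
      by (intro sum.cong) auto
    also have "\<dots> = ip f b" using k by (simp add: k_def)
    finally show "ip (f - F N) b = 0" using f FH by (simp add: ip_diff_left b)
  qed (use f FH in auto)
  have span_pol: "complex_vector.span (range mon) \<subseteq> {g. \<exists>N. g \<in> pol N}"
  proof (rule complex_vector.span_minimal)
    show "range mon \<subseteq> {g. \<exists>N. g \<in> pol N}"
      unfolding pol_def by (auto intro!: exI complex_vector.span_base)
    show "complex_vector.subspace {g. \<exists>N. g \<in> pol N}"
    proof (rule complex_vector.subspaceI)
      show "0 \<in> {g. \<exists>N. g \<in> pol N}" using pol_sub complex_vector.subspace_0 by blast
      show "c *\<^sub>C x \<in> {g. \<exists>N. g \<in> pol N}" if "x \<in> {g. \<exists>N. g \<in> pol N}" for c x
        using that pol_sub complex_vector.subspace_scale by blast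
      show "x + y \<in> {g. \<exists>N. g \<in> pol N}"
        if xy: "x \<in> {g. \<exists>N. g \<in> pol N}" "y \<in> {g. \<exists>N. g \<in> pol N}" for x y
      proof -
        obtain M N where "x \<in> pol M" "y \<in> pol N" using xy by blast
        then have "x \<in> pol (max M N)" "y \<in> pol (max M N)"
          using pol_mono[of M "max M N"] pol_mono[of N "max M N"] by auto
        then show ?thesis using pol_sub complex_vector.subspace_add by blast
      qed
    qed
  qed
  obtain u where u: "\<And>k. u k \<in> complex_vector.span (range mon)" "converges u f"
  proof -
    have "\<exists>u. (\<forall>k. u k \<in> complex_vector.span (range mon)) \<and> converges u f"
    proof (rule dense_if_orthocomplement_trivial[OF _ _ _ f])
      show "complex_vector.span (range mon) \<subseteq> H" by (rule span_subset) auto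
      show "x = 0" if "x \<in> H" "\<And>v. v \<in> complex_vector.span (range mon) \<Longrightarrow> ip x v = 0" for x
        using that by (intro mons_total) (auto intro: complex_vector.span_base)
    qed simp
    then show thesis using that by blast
  qed
  have "(\<lambda>N. nrm (F N - f)) \<longlonglongrightarrow> 0"
  proof (rule LIMSEQ_I)
    fix e :: real assume "e > 0"
    have "(\<lambda>k. nrm (u k - f)) \<longlonglongrightarrow> 0" using u(2) by (simp add: converges_def)
    then obtain k where k: "\<bar>nrm (u k - f)\<bar> < e" using \<open>e > 0\<close> by (auto dest!: LIMSEQ_D)
    obtain M where M: "u k \<in> pol M" using span_pol u(1) by blast
    have "norm (nrm (F N - f) - 0) < e" if "N \<ge> M" for N
    proof -
      have up: "u k \<in> pol N" using M pol_mono that by blast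
      have uH: "u k \<in> H" using up polH by blast
      have "F N - u k \<in> pol N" using F_pol up pol_sub by (simp add: complex_vector.subspace_diff)
      then have "ip (f - F N) (F N - u k) = 0" by (rule perp)
      then have "(nrm (f - u k))\<^sup>2 = (nrm (f - F N))\<^sup>2 + (nrm (F N - u k))\<^sup>2"
        using nrm_add_sq[of "f - F N" "F N - u k"] f FH uH by simp
      then have "(nrm (f - F N))\<^sup>2 \<le> (nrm (f - u k))\<^sup>2" by simp
      then have "nrm (f - F N) \<le> nrm (f - u k)" 
        using f uH by (intro power2_le_imp_le[of "nrm (f - F N)"]) auto
      then show ?thesis
        using k f uH FH nrm_minus_commute[of f "u k"] nrm_minus_commute[of f "F N"] by simp
    qed
    then show "\<exists>M. \<forall>N\<ge>M. norm (nrm (F N - f) - 0) < e" by blast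
  qed
  then show ?thesis using f FH unfolding converges_def F_def by blast
qed

end

section \<open>Taylor coefficients along the last coordinate\<close>

lemma sum_option: "(\<Sum>i\<in>UNIV. f i) = f None + (\<Sum>j\<in>UNIV. f (Some j))"
  for f :: "'m::finite option \<Rightarrow> 'b::comm_monoid_add"
  by (simp add: UNIV_option_conv sum.reindex)

lemma prod_option: "(\<Prod>i\<in>UNIV. f i) = f None * (\<Prod>j\<in>UNIV. f (Some j))"
  for f :: "'m::finite option \<Rightarrow> 'b::comm_monoid_mult"
  by (simp add: UNIV_option_conv prod.reindex)

definition point :: "complex ^ 'm::finite \<Rightarrow> complex \<Rightarrow> complex ^ 'm option" where
  "point a t = (\<chi> i. case i of None \<Rightarrow> t | Some j \<Rightarrow> a $ j)"

lemma point_nth [simp]: "point a t $ None = t" "point a t $ Some j = a $ j"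
  by (simp_all add: point_def)

lemma norm_point_sq: "(norm (point a t))\<^sup>2 = (norm a)\<^sup>2 + (cmod t)\<^sup>2"
  by (simp add: norm_vec_sq sum_option)

text \<open>
  So slices over \<open>|a| < 1/2\<close> are holomorphic on a disc larger than the one of radius \<open>3/4\<close> that is
  used for the Cauchy estimates.
\<close>

lemma norm_point_less_1:
  assumes "norm a < 1/2" "cmod t < 4/5"
  shows "norm (point a t) < 1"
proof -
  have "(norm a)\<^sup>2 \<le> (1/2)\<^sup>2" using assms by (intro power_mono) auto
  moreover have "(cmod t)\<^sup>2 \<le> (4/5)\<^sup>2" using assms by (intro power_mono) auto
  ultimately have "(norm (point a t))\<^sup>2 < 1\<^sup>2"
    unfolding norm_point_sq by (simp add: power2_eq_square)
  then show ?thesis by (rule power2_less_imp_less) simp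
qed

definition slice :: "(complex ^ ('m::finite option) \<Rightarrow> complex) \<Rightarrow> complex ^ 'm \<Rightarrow> complex \<Rightarrow> complex" where
  "slice f a t = f (point a t)"

definition taylor :: "complex ^ 'm::finite \<Rightarrow> nat \<Rightarrow> (complex ^ ('m option) \<Rightarrow> complex) \<Rightarrow> complex" where
  "taylor a k f = fps_nth (fps_expansion (slice f a) 0) k"

text \<open>
  The functional that takes the value \<open>c k\<close> on \<open>t ^ k\<close> and factors through restriction to the slice over \<open>a\<close>.
  Formally these are all joint eigenfunctionals of the first \<open>d - 1\<close> coordinates with eigenvalue \<open>a\<close>.
\<close>

definition slice_functional ::
    "complex ^ 'm::finite \<Rightarrow> (nat \<Rightarrow> complex) \<Rightarrow> (complex ^ ('m option) \<Rightarrow> complex) \<Rightarrow> complex" where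
  "slice_functional a c f = suminf (\<lambda>k. c k * taylor a k f)"

text \<open>
  The rate is smaller than \<open>3/4\<close>, which makes \<open>slice_functional\<close> bounded by the Cauchy estimates.
\<close>

definition geometric :: "(nat \<Rightarrow> complex) \<Rightarrow> bool" where
  "geometric c \<longleftrightarrow> (\<exists>C\<ge>0. \<forall>k. cmod (c k) \<le> C * (1/2) ^ k)"

lemma geometric_shift: "geometric c \<Longrightarrow> geometric (\<lambda>k. c (k + m))"
proof -
  assume "geometric c"
  then obtain C where C: "C \<ge> 0" "\<And>k. cmod (c k) \<le> C * (1/2) ^ k" by (auto simp: geometric_def)
  have "cmod (c (k + m)) \<le> C * (1/2) ^ k" for k
  proof -
    have "C * (1/2) ^ (k + m) \<le> C * (1/2::real) ^ k"
      using C(1) by (intro mult_left_mono power_decreasing) auto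
    then show ?thesis using C(2)[of "k + m"] by linarith
  qed
  then show ?thesis using C(1) by (auto simp: geometric_def)
qed

locale drury_arveson_slices = drury_arveson H ip
  for H :: "(complex ^ ('m::finite option) \<Rightarrow> complex) set" and ip
begin

lemma slice_holomorphic:
  assumes f: "f \<in> H" and a: "norm a < 1/2"
  shows "slice f a holomorphic_on ball 0 (4/5)"
proof -
  have "\<exists>D. (slice f a has_field_derivative D) (at t)" if t: "t \<in> ball 0 (4/5)" for t
  proof -
    have "point a t \<in> ball 0 1" using norm_point_less_1[OF a, of t] t by simp
    then obtain D where D: "(f has_derivative D) (at (point a t))" "\<And>c v. D (c *s v) = c * D v"
      using holomorphic[OF f] unfolding holomorphic_in_def by blast
    have "point a = (\<lambda>t. point a 0 + t *s axis None 1)"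
      by (auto simp: fun_eq_iff vec_eq_iff point_def axis_def split: option.split)
    moreover have "((\<lambda>t. point a 0 + t *s axis None 1) has_derivative (\<lambda>s. s *s axis None 1)) (at t)"
    proof -
      have "linear (\<lambda>s :: complex. s *s (axis None 1 :: complex ^ 'm option))"
        by (intro linearI) (auto simp: vec_eq_iff algebra_simps)
      then have "bounded_linear (\<lambda>s :: complex. s *s (axis None 1 :: complex ^ 'm option))"
        by (simp add: linear_conv_bounded_linear)
      then have "((\<lambda>s :: complex. s *s (axis None 1 :: complex ^ 'm option)) has_derivative
          (\<lambda>s. s *s axis None 1)) (at t)"
        by (rule bounded_linear_imp_has_derivative)
      from has_derivative_add[OF has_derivative_const this] show ?thesis by simp
    qed
    ultimately have "(point a has_derivative (\<lambda>s. s *s axis None 1)) (at t)" by simp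
    from diff_chain_at[OF this D(1)]
    have "(slice f a has_derivative (\<lambda>s. s * D (axis None 1))) (at t)"
      by (simp add: slice_def[abs_def] o_def D(2))
    then have "(slice f a has_field_derivative D (axis None 1)) (at t)"
      by (simp add: has_field_derivative_def mult_commute_abs)
    then show ?thesis by blast
  qed
  then show ?thesis
    unfolding holomorphic_on_def field_differentiable_def
    by (meson has_field_derivative_at_within)
qed

lemma slice_expansion:
  "f \<in> H \<Longrightarrow> norm a < 1/2 \<Longrightarrow> slice f a has_fps_expansion fps_expansion (slice f a) 0"
  using has_fps_expansion_fps_expansion[OF open_ball _ slice_holomorphic] by simp

lemma taylor_eqI: "slice f a has_fps_expansion F \<Longrightarrow> taylor a k f = fps_nth F k"
  by (simp add: taylor_def fps_expansion_eqI)

lemma taylor_add: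
  assumes "f \<in> H" "g \<in> H" "norm a < 1/2"
  shows "taylor a k (f + g) = taylor a k f + taylor a k g"
proof -
  have "slice (f + g) a = (\<lambda>t. slice f a t + slice g a t)" by (auto simp: slice_def)
  then have "slice (f + g) a has_fps_expansion fps_expansion (slice f a) 0 + fps_expansion (slice g a) 0"
    using assms by (simp add: has_fps_expansion_add slice_expansion)
  from taylor_eqI[OF this] show ?thesis by (simp add: taylor_def)
qed

lemma taylor_scale:
  assumes "f \<in> H" "norm a < 1/2"
  shows "taylor a k (c *\<^sub>C f) = c * taylor a k f"
proof -
  have "slice (c *\<^sub>C f) a = (\<lambda>t. c * slice f a t)"
    by (auto simp: slice_def scaleC_fun_def scaleC_complex_def)
  then have "slice (c *\<^sub>C f) a has_fps_expansion fps_const c * fps_expansion (slice f a) 0"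
    using assms by (simp add: has_fps_expansion_cmult_left slice_expansion)
  from taylor_eqI[OF this] show ?thesis by (simp add: taylor_def)
qed

lemma taylor_coord_Some:
  assumes "f \<in> H" "norm a < 1/2"
  shows "taylor a k (coord (Some j) f) = a $ j * taylor a k f"
proof -
  have "slice (coord (Some j) f) a = (\<lambda>t. a $ j * slice f a t)"
    by (auto simp: slice_def mult_op_def)
  then have "slice (coord (Some j) f) a has_fps_expansion fps_const (a $ j) * fps_expansion (slice f a) 0"
    using assms by (simp add: has_fps_expansion_cmult_left slice_expansion)
  from taylor_eqI[OF this] show ?thesis by (simp add: taylor_def)
qed

lemma taylor_coord_None:
  assumes "f \<in> H" "norm a < 1/2"
  shows "taylor a k (coord None f) = (case k of 0 \<Rightarrow> 0 | Suc i \<Rightarrow> taylor a i f)"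
proof -
  have "slice (coord None f) a = (\<lambda>t. t * slice f a t)"
    by (auto simp: slice_def mult_op_def)
  then have "slice (coord None f) a has_fps_expansion fps_X * fps_expansion (slice f a) 0"
    using assms by (simp add: has_fps_expansion_mult slice_expansion has_fps_expansion_fps_X)
  from taylor_eqI[OF this] show ?thesis by (cases k) (simp_all add: taylor_def)
qed

lemma taylor_kernel_at_0:
  assumes "norm a < 1/2"
  shows "taylor a k (kernel_at 0) = (if k = 0 then 1 else 0)"
proof -
  have "\<forall>\<^sub>F t in nhds 0. t \<in> ball (0 :: complex) (4/5)"
    by (intro eventually_nhds_in_open) auto
  then have "\<forall>\<^sub>F t in nhds 0. slice (kernel_at 0) a t = 1"
    by eventually_elim (use norm_point_less_1[OF assms] in \<open>auto simp: slice_def kernel_at_0_apply\<close>)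
  then have "slice (kernel_at 0) a has_fps_expansion 1 \<longleftrightarrow> (\<lambda>t :: complex. 1 :: complex) has_fps_expansion 1"
    by (intro has_fps_expansion_cong) auto
  then have "slice (kernel_at 0) a has_fps_expansion 1" by simp
  from taylor_eqI[OF this] show ?thesis by simp
qed

text \<open>
  The Cauchy estimate on the circle of radius \<open>3/4\<close>: over \<open>|a| < 1/2\<close> it stays in a ball on which
  kernel functions have norm at most \<open>3\<close>.
\<close>

lemma taylor_bound:
  assumes f: "f \<in> H" and a: "norm a < 1/2"
  shows "cmod (taylor a k f) \<le> 3 * nrm f * (4/3) ^ k"
proof -
  have bd: "cmod (slice f a t) \<le> 3 * nrm f" if t: "cmod t = 3/4" for t
  proof -
    have z: "norm (point a t) < 1" using norm_point_less_1[OF a] t by simp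
    have "(norm a)\<^sup>2 \<le> (1/2)\<^sup>2" using a by (intro power_mono) auto
    then have sq: "(norm (point a t))\<^sup>2 \<le> 8/9"
      unfolding norm_point_sq t by (simp add: power2_eq_square)
    have "complex_of_real ((nrm (kernel_at (point a t)))\<^sup>2) = of_real (1 / (1 - (norm (point a t))\<^sup>2))"
    proof -
      have "(\<Sum>i\<in>UNIV. point a t $ i * cnj (point a t $ i)) = of_real ((norm (point a t))\<^sup>2)"
        by (simp add: norm_vec_sq complex_norm_square del: of_real_power)
      then show ?thesis
        using ip_self[of "kernel_at (point a t)"] ip_kernel_at_kernel_at[OF z z] z by simp
    qed
    then have "(nrm (kernel_at (point a t)))\<^sup>2 = 1 / (1 - (norm (point a t))\<^sup>2)" using of_real_eq_iff by blast
    also have "\<dots> \<le> 3\<^sup>2" using sq by (simp add: field_simps)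
    finally have "nrm (kernel_at (point a t)) \<le> 3" by (rule power2_le_imp_le) simp
    then have "nrm f * nrm (kernel_at (point a t)) \<le> nrm f * 3" using f by (intro mult_left_mono) auto
    then show ?thesis
      using Cauchy_Schwarz[OF f kernel_at_mem[OF z]] reproducing[OF f z] by (simp add: slice_def)
  qed
  have "cmod ((deriv ^^ k) (slice f a) 0) \<le> fact k * (3 * nrm f) / (3/4) ^ k"
  proof (rule Cauchy_inequality)
    show "slice f a holomorphic_on ball 0 (3/4)"
      by (rule holomorphic_on_subset[OF slice_holomorphic[OF f a]]) auto
    show "continuous_on (cball 0 (3/4)) (slice f a)"
      by (rule continuous_on_subset[OF holomorphic_on_imp_continuous_on[OF slice_holomorphic[OF f a]]])
        (auto simp: subset_iff)
    show "cmod (slice f a x) \<le> 3 * nrm f" if "cmod (0 - x) = 3/4" for x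
      using bd that by simp
  qed simp
  then have "cmod ((deriv ^^ k) (slice f a) 0) / fact k \<le> 3 * nrm f / (3/4) ^ k"
    by (simp add: divide_simps mult_ac)
  then show ?thesis
    by (simp add: taylor_def fps_expansion_def norm_divide power_divide field_simps)
qed

lemma slice_functional_summable:
  assumes "f \<in> H" "norm a < 1/2" "geometric c"
  shows "summable (\<lambda>k. c k * taylor a k f)"
    and "\<exists>C\<ge>0. \<forall>f\<in>H. cmod (slice_functional a c f) \<le> C * nrm f"
proof -
  obtain C where C: "C \<ge> 0" "\<And>k. cmod (c k) \<le> C * (1/2) ^ k"
    using assms(3) by (auto simp: geometric_def)
  have tb: "norm (c k * taylor a k f) \<le> 3 * C * nrm f * (2/3) ^ k" if f: "f \<in> H" for f k
  proof -
    have "cmod (c k) * cmod (taylor a k f) \<le> (C * (1/2) ^ k) * (3 * nrm f * (4/3) ^ k)"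
      using C taylor_bound[OF f assms(2)] f by (intro mult_mono) auto
    also have "\<dots> = 3 * C * nrm f * ((1/2) * (4/3)) ^ k" by (simp only: power_mult_distrib) simp
    finally show ?thesis by (simp add: norm_mult)
  qed
  have sm: "summable (\<lambda>k. 3 * C * nrm f * (2/3 :: real) ^ k)" for f
    by (intro summable_mult summable_geometric) simp
  show "summable (\<lambda>k. c k * taylor a k f)"
    using tb[OF assms(1)] sm by (rule summable_comparison_test'[rotated])
  have "cmod (slice_functional a c f) \<le> 9 * C * nrm f" if f: "f \<in> H" for f
  proof -
    have "cmod (slice_functional a c f) \<le> suminf (\<lambda>k. 3 * C * nrm f * (2/3) ^ k)"
      unfolding slice_functional_def using tb[OF f] sm by (rule norm_suminf_le)
    also have "\<dots> = 9 * C * nrm f"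
      by (subst suminf_mult) (auto simp: suminf_geometric summable_geometric)
    finally show ?thesis .
  qed
  then show "\<exists>C\<ge>0. \<forall>f\<in>H. cmod (slice_functional a c f) \<le> C * nrm f"
    using C(1) by (intro exI[of _ "9 * C"]) auto
qed

lemma slice_functional_rep:
  assumes a: "norm a < 1/2" and c: "geometric c"
  shows "\<exists>h\<in>H. \<forall>f\<in>H. ip f h = slice_functional a c f"
proof -
  obtain C where C: "C \<ge> 0" "\<And>f. f \<in> H \<Longrightarrow> cmod (slice_functional a c f) \<le> C * nrm f"
    using slice_functional_summable(2)[OF zero_mem a c] by blast
  note sm = slice_functional_summable(1)[OF _ a c]
  have "\<exists>h\<in>H. nrm h \<le> C \<and> (\<forall>f\<in>H. slice_functional a c f = ip f h)"
  proof (rule riesz[OF C(1) _ _ C(2)])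
    show "slice_functional a c (f + g) = slice_functional a c f + slice_functional a c g"
      if "f \<in> H" "g \<in> H" for f g
      unfolding slice_functional_def
      using suminf_add[OF sm[OF that(1)] sm[OF that(2)]] that a
      by (simp add: taylor_add distrib_left)
    show "slice_functional a c (b *\<^sub>C f) = b * slice_functional a c f" if "f \<in> H" for b f
      unfolding slice_functional_def
      using suminf_mult[OF sm[OF that], of b] that a by (simp add: taylor_scale mult_ac)
  qed
  then show ?thesis by auto
qed

lemma slice_functional_coord_Some:
  assumes "f \<in> H" "norm a < 1/2" "geometric c"
  shows "slice_functional a c (coord (Some j) f) = a $ j * slice_functional a c f"
  unfolding slice_functional_def
  using suminf_mult[OF slice_functional_summable(1)[OF assms], of "a $ j"] assms
  by (simp add: taylor_coord_Some mult_ac)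

lemma slice_functional_coord_None:
  assumes "f \<in> H" "norm a < 1/2" "geometric c"
  shows "slice_functional a c (coord None f) = slice_functional a (\<lambda>k. c (Suc k)) f"
  unfolding slice_functional_def
  using suminf_split_head[OF slice_functional_summable(1)[OF coord_mem[OF assms(1), of None] assms(2,3)]] assms
  by (simp add: taylor_coord_None)

lemma slice_functional_kernel_at_0:
  assumes "norm a < 1/2"
  shows "slice_functional a c (kernel_at 0) = c 0"
proof -
  have "(\<lambda>k. c k * taylor a k (kernel_at 0)) = (\<lambda>k. if k = 0 then c 0 else 0)"
    using assms by (auto simp: taylor_kernel_at_0)
  then show ?thesis
    unfolding slice_functional_def using suminf_finite[of "{0}" "\<lambda>k. if k = 0 then c 0 else 0"] by simp
qed

lemma slice_functional_monomial:
  assumes f: "f \<in> H" and a: "norm a < 1/2" and c: "geometric c"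
  shows "slice_functional a c (mult_op (monomial \<gamma>) f) =
    monomial (\<lambda>j. \<gamma> (Some j)) a * slice_functional a (\<lambda>k. c (k + \<gamma> None)) f"
  using c
proof (induction \<gamma> arbitrary: c rule: exponent_induct)
  case zero
  then show ?case by (simp add: mult_op_def)
next
  case (Suc \<gamma> i)
  note IH = Suc.IH and c = Suc.prems
  show "slice_functional a c (mult_op (monomial (\<gamma>(i := Suc (\<gamma> i)))) f) =
    monomial (\<lambda>j. (\<gamma>(i := Suc (\<gamma> i))) (Some j)) a *
    slice_functional a (\<lambda>k. c (k + (\<gamma>(i := Suc (\<gamma> i))) None)) f"
  proof (cases i)
    case None
    have "slice_functional a c (mult_op (monomial (\<gamma>(i := Suc (\<gamma> i)))) f)
       = slice_functional a (\<lambda>k. c (k + 1)) (mult_op (monomial \<gamma>) f)"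
      unfolding mult_op_monomial_Suc None using f a c by (simp add: slice_functional_coord_None)
    also have "\<dots> = monomial (\<lambda>j. \<gamma> (Some j)) a * slice_functional a (\<lambda>k. c (k + \<gamma> None + 1)) f"
      by (rule IH[OF geometric_shift[OF c]])
    finally show ?thesis by (simp add: None)
  next
    case (Some j)
    have "(\<lambda>l. (\<gamma>(i := Suc (\<gamma> i))) (Some l)) = (\<lambda>l. \<gamma> (Some l))(j := Suc (\<gamma> (Some j)))"
      by (auto simp: Some fun_eq_iff)
    then have "monomial (\<lambda>l. (\<gamma>(i := Suc (\<gamma> i))) (Some l)) a = a $ j * monomial (\<lambda>l. \<gamma> (Some l)) a"
      using monomial_Suc[of "\<lambda>l. \<gamma> (Some l)" j a] by simp
    moreover have "slice_functional a c (mult_op (monomial (\<gamma>(i := Suc (\<gamma> i)))) f)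
       = a $ j * slice_functional a c (mult_op (monomial \<gamma>) f)"
      unfolding mult_op_monomial_Suc Some using f a c by (simp add: slice_functional_coord_Some)
    ultimately show ?thesis using IH[OF c] by (simp add: Some)
  qed
qed

lemma slice_functional_mon:
  assumes "norm a < 1/2" "geometric c"
  shows "slice_functional a c (mon \<gamma>) = monomial (\<lambda>j. \<gamma> (Some j)) a * c (\<gamma> None)"
  unfolding mon_def slice_functional_monomial[OF kernel_at_mem assms, of 0, simplified]
  by (simp add: slice_functional_kernel_at_0[OF assms(1)])

end

section \<open>The quotient module\<close>

lemma monomial_bound:
  assumes "norm a \<le> 1" "\<gamma> j > 0"
  shows "cmod (monomial \<gamma> a) \<le> norm a"
proof -
  have le1: "cmod (a $ i) \<le> 1" for i using Finite_Cartesian_Product.norm_nth_le[of a i] assms by simp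
  have "cmod (monomial \<gamma> a) = cmod (a $ j) ^ \<gamma> j * (\<Prod>i\<in>UNIV - {j}. cmod (a $ i) ^ \<gamma> i)"
    by (simp add: monomial_def norm_mult norm_power prod.remove[of UNIV j] flip: prod_norm)
  also have "\<dots> \<le> cmod (a $ j) * 1"
  proof (rule mult_mono)
    show "cmod (a $ j) ^ \<gamma> j \<le> cmod (a $ j)"
      using power_decreasing[of 1 "\<gamma> j" "cmod (a $ j)"] assms(2) le1 by simp
    show "(\<Prod>i\<in>UNIV - {j}. cmod (a $ i) ^ \<gamma> i) \<le> 1"
      using le1 by (intro prod_le_1) (auto intro: power_le_one)
  qed (auto intro: prod_nonneg)
  also have "\<dots> \<le> norm a" using Finite_Cartesian_Product.norm_nth_le[of a j] by simp
  finally show ?thesis .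
qed

lemma sums_zero_imp_coeffs_zero:
  fixes b :: "nat \<Rightarrow> complex"
  assumes "\<And>s. norm s < 1 \<Longrightarrow> (\<lambda>k. b k * s ^ k) sums 0"
  shows "b m = 0"
proof (rule ccontr)
  assume "b m \<noteq> 0"
  show False
  proof (cases "m = 0")
    case True
    have "(\<lambda>k. b k * 0 ^ k) sums b 0" by (rule powser_sums_zero)
    then show False using assms[of 0] sums_unique2 True \<open>b m \<noteq> 0\<close> by fastforce
  next
    case False
    obtain s where s: "0 < s" "\<And>z. z \<in> cball (0 :: complex) s - {0} \<Longrightarrow> (0 :: complex) \<noteq> 0"
      by (rule powser_0_nonzero[of 1 0 b "\<lambda>_. 0" m]) (use assms False \<open>b m \<noteq> 0\<close> in auto)
    have "complex_of_real s \<in> cball 0 s - {0}" using s(1) by simp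
    then show False using s(2) by blast
  qed
qed

locale homogeneous_quotient = drury_arveson_slices H ip
  for H :: "(complex ^ ('m::finite option) \<Rightarrow> complex) set" and ip +
  fixes p :: "'m option mpoly" and n :: nat
  assumes hom_p: "homogeneous_of_degree p n" and n_pos: "n > 0"
    and nonzero_axis: "poly_eval p last_unit_vector \<noteq> 0"
begin

abbreviation "pc \<equiv> Poly_Mapping.lookup p"

text \<open>
  The exponent of \<open>t\<^sup>n\<close>.  Its coefficient is the value of \<open>p\<close> at the last unit vector, and every other
  exponent of \<open>p\<close> involves one of the first \<open>d - 1\<close> coordinates, since all have the same total degree.
\<close>

definition lead :: "'m option \<Rightarrow>\<^sub>0 nat" where
  "lead = Poly_Mapping.single None n"

definition rest :: "('m option \<Rightarrow>\<^sub>0 nat) set" where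
  "rest = Poly_Mapping.keys p - {lead}"

definition rest_norm :: real where
  "rest_norm = (\<Sum>g\<in>rest. cmod (pc g))"

lemma lead_lookup [simp]:
  "Poly_Mapping.lookup lead None = n" "Poly_Mapping.lookup lead (Some j) = 0"
  by (simp_all add: lead_def lookup_single)

lemma finite_rest [simp]: "finite rest"
  by (simp add: rest_def)

lemma rest_norm_nonneg [simp]: "0 \<le> rest_norm"
  by (simp add: rest_norm_def sum_nonneg)

lemma degree_split:
  "g \<in> Poly_Mapping.keys p \<Longrightarrow>
    Poly_Mapping.lookup g None + (\<Sum>j\<in>UNIV. Poly_Mapping.lookup g (Some j)) = n"
  using hom_p by (simp add: homogeneous_of_degree_def flip: sum_option)

lemma rest_Some:
  assumes "g \<in> rest"
  shows "\<exists>j. Poly_Mapping.lookup g (Some j) > 0"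
proof (rule ccontr)
  assume "\<not> ?thesis"
  then have z: "\<And>j. Poly_Mapping.lookup g (Some j) = 0" by simp
  then have "Poly_Mapping.lookup g None = n" using degree_split[of g] assms by (simp add: rest_def)
  then have "g = lead" using z by (intro poly_mapping_eqI) (metis lead_lookup not_Some_eq)
  then show False using assms by (simp add: rest_def)
qed

lemma rest_None:
  assumes "g \<in> rest"
  shows "Poly_Mapping.lookup g None < n"
proof -
  obtain j where "Poly_Mapping.lookup g (Some j) > 0" using rest_Some[OF assms] by blast
  then have "0 < (\<Sum>j\<in>UNIV. Poly_Mapping.lookup g (Some j))"
    by (simp add: sum_pos2)
  then show ?thesis using degree_split[of g] assms by (simp add: rest_def)
qed

lemma lead_coeff: "poly_eval p last_unit_vector = pc lead"
proof -
  have "poly_eval p last_unit_vector = (\<Sum>g\<in>Poly_Mapping.keys p. if g = lead then pc lead else 0)"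
    unfolding poly_eval_monomial
  proof (intro sum.cong refl)
    fix g assume g: "g \<in> Poly_Mapping.keys p"
    have last: "last_unit_vector $ None = (1 :: complex)" "last_unit_vector $ Some j = (0 :: complex)" for j :: 'm
      by (simp_all add: last_unit_vector_def axis_def)
    show "pc g * monomial (Poly_Mapping.lookup g) last_unit_vector = (if g = lead then pc lead else 0)"
    proof (cases "g = lead")
      case True
      then show ?thesis by (simp add: monomial_def prod_option last)
    next
      case False
      then obtain j where "Poly_Mapping.lookup g (Some j) > 0" using rest_Some[of g] g by (auto simp: rest_def)
      then have "(\<Prod>j\<in>UNIV. (0 :: complex) ^ Poly_Mapping.lookup g (Some j)) = 0"
        by (auto simp: prod_zero_iff)
      then show ?thesis using False by (simp add: monomial_def prod_option last)
    qed
  qed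
  also have "\<dots> = pc lead" by (simp add: in_keys_iff)
  finally show ?thesis .
qed

lemma lead_nonzero: "pc lead \<noteq> 0"
  using nonzero_axis lead_coeff by simp

lemma lead_in_keys: "lead \<in> Poly_Mapping.keys p"
  using lead_nonzero by (simp add: in_keys_iff)

lemma sum_keys: "(\<Sum>g\<in>Poly_Mapping.keys p. F g) = F lead + (\<Sum>g\<in>rest. F g)"
  for F :: "_ \<Rightarrow> 'b::comm_monoid_add"
  unfolding rest_def using lead_in_keys by (simp add: sum.remove)

subsection \<open>Solutions of the recurrence with characteristic polynomial p(a, t)\<close>

abbreviation base_monomial :: "('m option \<Rightarrow>\<^sub>0 nat) \<Rightarrow> complex ^ 'm \<Rightarrow> complex" where
  "base_monomial g a \<equiv> monomial (\<lambda>j. Poly_Mapping.lookup g (Some j)) a"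

text \<open>
  The sequences that annihilate all \<open>t\<^sup>k p(a, t)\<close> when paired with coefficients.
\<close>

definition solution :: "complex ^ 'm \<Rightarrow> (nat \<Rightarrow> complex) \<Rightarrow> bool" where
  "solution a c \<longleftrightarrow>
    (\<forall>k. (\<Sum>g\<in>Poly_Mapping.keys p. pc g * base_monomial g a * c (k + Poly_Mapping.lookup g None)) = 0)"

lemma solution_iff:
  "solution a c \<longleftrightarrow>
    (\<forall>k. pc lead * c (k + n) = - (\<Sum>g\<in>rest. pc g * base_monomial g a * c (k + Poly_Mapping.lookup g None)))"
  unfolding solution_def sum_keys by (simp add: eq_neg_iff_add_eq_0)

lemma solution_exists: "\<exists>c. solution a c \<and> (\<forall>i<n. c i = init i)"
proof -
  \<comment> \<open>The companion operator acts on windows of \<open>n\<close> consecutive terms.\<close>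
  define step :: "(nat \<Rightarrow> complex) \<Rightarrow> nat \<Rightarrow> complex" where
    "step s i = (if Suc i < n then s (Suc i)
       else - (\<Sum>g\<in>rest. pc g * base_monomial g a * s (Poly_Mapping.lookup g None)) / pc lead)" for s i
  define s where "s k = (step ^^ k) init" for k
  define c where "c k = s k 0" for k
  have s_Suc: "s (Suc k) = step (s k)" for k by (simp add: s_def)
  have win: "i < n \<Longrightarrow> s k i = c (k + i)" for i k
  proof (induction i arbitrary: k)
    case 0
    then show ?case by (simp add: c_def)
  next
    case (Suc i)
    have "s k (Suc i) = s (Suc k) i" using Suc.prems by (simp add: s_Suc step_def)
    also have "\<dots> = c (Suc k + i)" using Suc by simp
    finally show ?case by simp
  qed
  have "pc lead * c (k + n) = - (\<Sum>g\<in>rest. pc g * base_monomial g a * c (k + Poly_Mapping.lookup g None))" for k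
  proof -
    have "c (k + n) = s (Suc k) (n - 1)" using win[of "n - 1" "Suc k"] n_pos by simp
    also have "\<dots> = - (\<Sum>g\<in>rest. pc g * base_monomial g a * s k (Poly_Mapping.lookup g None)) / pc lead"
      using n_pos by (simp add: s_Suc step_def)
    also have "(\<Sum>g\<in>rest. pc g * base_monomial g a * s k (Poly_Mapping.lookup g None))
       = (\<Sum>g\<in>rest. pc g * base_monomial g a * c (k + Poly_Mapping.lookup g None))"
      using rest_None by (intro sum.cong) (auto simp: win)
    finally show ?thesis using lead_nonzero by simp
  qed
  then have "solution a c" by (simp add: solution_iff)
  moreover have "c i = init i" if "i < n" for i
    using win[OF that, of 0] by (simp add: s_def)
  ultimately show ?thesis by blast
qed

text \<open>
  For small \<open>a\<close> the recurrence is close to \<open>c\<^sub>k\<^sub>+\<^sub>n = 0\<close>: every other coefficient contains a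
  factor bounded by \<open>|a|\<close>.  So solutions decay at the rate \<open>1/2\<close>, and there is no need to locate the roots of
  \<open>p(a, t)\<close>.
\<close>

lemma solution_geometric:
  assumes c: "solution a c" and a: "norm a \<le> 1" "norm a * rest_norm \<le> cmod (pc lead) * (1/2) ^ n"
  shows "geometric c"
proof -
  define C where "C = (\<Sum>i<n. cmod (c i) * 2 ^ i)"
  have C0: "C \<ge> 0" by (simp add: C_def sum_nonneg)
  have "cmod (c k) \<le> C * (1/2) ^ k" for k
  proof (induction k rule: less_induct)
    case (less k)
    show ?case
    proof (cases "k < n")
      case True
      then have "cmod (c k) * 2 ^ k \<le> C"
        unfolding C_def using member_le_sum[of k "{..<n}" "\<lambda>i. cmod (c i) * 2 ^ i"] by simp
      then show ?thesis by (simp add: power_divide field_simps)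
    next
      case False
      define k' where "k' = k - n"
      have k: "k = k' + n" using False by (simp add: k'_def)
      have tb: "cmod (pc g * base_monomial g a * c (k' + Poly_Mapping.lookup g None))
          \<le> cmod (pc g) * (norm a * (C * (1/2) ^ k'))" if g: "g \<in> rest" for g
      proof -
        obtain j where j: "Poly_Mapping.lookup g (Some j) > 0" using rest_Some[OF g] by blast
        have "cmod (base_monomial g a) \<le> norm a" using monomial_bound[of a "\<lambda>j. Poly_Mapping.lookup g (Some j)" j] a(1) j by simp
        moreover have "cmod (c (k' + Poly_Mapping.lookup g None)) \<le> C * (1/2) ^ k'"
        proof -
          have "cmod (c (k' + Poly_Mapping.lookup g None)) \<le> C * (1/2) ^ (k' + Poly_Mapping.lookup g None)"
            using rest_None[OF g] by (intro less) (simp add: k)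
          also have "\<dots> \<le> C * (1/2) ^ k'" using C0 by (intro mult_left_mono power_decreasing) auto
          finally show ?thesis .
        qed
        ultimately show ?thesis
          unfolding norm_mult mult.assoc by (intro mult_left_mono mult_mono) auto
      qed
      have "cmod (pc lead) * cmod (c k)
          = cmod (\<Sum>g\<in>rest. pc g * base_monomial g a * c (k' + Poly_Mapping.lookup g None))"
        using c[unfolded solution_iff, rule_format, of k'] by (simp add: k flip: norm_mult)
      also have "\<dots> \<le> (\<Sum>g\<in>rest. cmod (pc g) * (norm a * (C * (1/2) ^ k')))"
        using tb by (rule sum_norm_le)
      also have "\<dots> = norm a * rest_norm * (C * (1/2) ^ k')"
        by (simp add: rest_norm_def sum_distrib_right sum_distrib_left mult_ac)
      also have "\<dots> \<le> cmod (pc lead) * (1/2) ^ n * (C * (1/2) ^ k')"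
        using C0 a(2) by (intro mult_right_mono) auto
      also have "\<dots> = cmod (pc lead) * (C * (1/2) ^ k)" by (simp add: k power_add)
      finally show ?thesis using lead_nonzero by (simp add: mult_le_cancel_left)
    qed
  qed
  then show ?thesis using C0 unfolding geometric_def by blast
qed

text \<open>
  Homogeneity of \<open>p\<close>: if \<open>t\<close> is a root of \<open>p(a, t)\<close>, then \<open>s t\<close> is one of \<open>p(s a, t)\<close>.
\<close>

lemma solution_rescale:
  assumes "solution a c"
  shows "solution (s *s a) (\<lambda>k. s ^ k * c k)"
proof -
  have "(\<Sum>g\<in>Poly_Mapping.keys p. pc g * base_monomial g (s *s a) *
      (s ^ (k + Poly_Mapping.lookup g None) * c (k + Poly_Mapping.lookup g None))) = 0" for k
  proof -
    have "pc g * base_monomial g (s *s a) * (s ^ (k + Poly_Mapping.lookup g None) * c (k + Poly_Mapping.lookup g None))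
       = s ^ (k + n) * (pc g * base_monomial g a * c (k + Poly_Mapping.lookup g None))"
      if g: "g \<in> Poly_Mapping.keys p" for g
    proof -
      have "s ^ (\<Sum>j\<in>UNIV. Poly_Mapping.lookup g (Some j)) * s ^ (k + Poly_Mapping.lookup g None) = s ^ (k + n)"
        using degree_split[OF g] by (simp flip: power_add add: algebra_simps)
      then show ?thesis by (simp add: monomial_scale mult_ac)
    qed
    then have "(\<Sum>g\<in>Poly_Mapping.keys p. pc g * base_monomial g (s *s a) *
        (s ^ (k + Poly_Mapping.lookup g None) * c (k + Poly_Mapping.lookup g None)))
      = s ^ (k + n) * (\<Sum>g\<in>Poly_Mapping.keys p. pc g * base_monomial g a * c (k + Poly_Mapping.lookup g None))"
      unfolding sum_distrib_left by (intro sum.cong refl) blast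
    then show ?thesis using assms by (simp add: solution_def)
  qed
  then show ?thesis by (simp add: solution_def)
qed

lemma slice_functional_annihilates:
  assumes f: "f \<in> H" and a: "norm a < 1/2" and c: "geometric c" "solution a c"
  shows "slice_functional a c (mult_op (poly_eval p) f) = 0"
proof -
  obtain h where h: "h \<in> H" "\<And>f. f \<in> H \<Longrightarrow> ip f h = slice_functional a c f"
    using slice_functional_rep[OF a c(1)] by blast
  let ?c = "\<lambda>g k. c (k + Poly_Mapping.lookup g None)"
  have sm: "summable (\<lambda>k. ?c g k * taylor a k f)" for g
    using slice_functional_summable(1)[OF f a geometric_shift[OF c(1)]] .
  have "slice_functional a c (mult_op (poly_eval p) f) = ip (mult_op (poly_eval p) f) h"
    using h f by simp
  also have "\<dots> = (\<Sum>g\<in>Poly_Mapping.keys p. pc g * ip (mult_op (monomial (Poly_Mapping.lookup g)) f) h)"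
    unfolding mult_op_poly using f h(1) by (simp add: ip_sum_left ip_scale_left)
  also have "\<dots> = (\<Sum>g\<in>Poly_Mapping.keys p. pc g * slice_functional a c (mult_op (monomial (Poly_Mapping.lookup g)) f))"
    using f h(2) by simp
  also have "\<dots> = (\<Sum>g\<in>Poly_Mapping.keys p. pc g * base_monomial g a * suminf (\<lambda>k. ?c g k * taylor a k f))"
    by (simp only: slice_functional_monomial[OF f a c(1)]) (simp add: slice_functional_def mult.assoc)
  also have "\<dots> = (\<Sum>g\<in>Poly_Mapping.keys p. suminf (\<lambda>k. pc g * base_monomial g a * (?c g k * taylor a k f)))"
    by (intro sum.cong refl suminf_mult[symmetric] sm)
  also have "\<dots> = suminf (\<lambda>k. \<Sum>g\<in>Poly_Mapping.keys p. pc g * base_monomial g a * (?c g k * taylor a k f))"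
    by (intro suminf_sum[symmetric] summable_mult sm)
  also have "(\<lambda>k. \<Sum>g\<in>Poly_Mapping.keys p. pc g * base_monomial g a * (?c g k * taylor a k f)) = (\<lambda>k. 0)"
  proof
    fix k
    have "(\<Sum>g\<in>Poly_Mapping.keys p. pc g * base_monomial g a * (?c g k * taylor a k f))
       = (\<Sum>g\<in>Poly_Mapping.keys p. pc g * base_monomial g a * ?c g k) * taylor a k f"
      by (simp add: sum_distrib_right mult.assoc)
    then show "(\<Sum>g\<in>Poly_Mapping.keys p. pc g * base_monomial g a * (?c g k * taylor a k f)) = 0"
      using c(2) by (simp add: solution_def)
  qed
  finally show ?thesis by simp
qed

definition Q :: "(complex ^ ('m option) \<Rightarrow> complex) set" where
  "Q = quotient_space H ip p"

lemma Q_iff: "x \<in> Q \<longleftrightarrow> x \<in> H \<and> (\<forall>f\<in>H. ip (mult_op (poly_eval p) f) x = 0)"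
proof -
  have "ip (mult_op (poly_eval p) f) x = 0 \<longleftrightarrow> ip x (mult_op (poly_eval p) f) = 0"
    if "x \<in> H" "f \<in> H" for f
    using that ip_commute[of x "mult_op (poly_eval p) f"] by simp
  then show ?thesis
    unfolding Q_def quotient_space_def orthocomplement_def by auto
qed

lemma Q_memI:
  "x \<in> H \<Longrightarrow> (\<And>f. f \<in> H \<Longrightarrow> ip (mult_op (poly_eval p) f) x = 0) \<Longrightarrow> x \<in> Q"
  by (simp add: Q_iff)

lemma Q_perp: "x \<in> Q \<Longrightarrow> f \<in> H \<Longrightarrow> ip (mult_op (poly_eval p) f) x = 0"
  by (simp add: Q_iff)

lemma Q_perp': "x \<in> Q \<Longrightarrow> f \<in> H \<Longrightarrow> ip x (mult_op (poly_eval p) f) = 0"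
  using ip_commute[of "mult_op (poly_eval p) f" x] by (simp add: Q_iff)

lemma Q_subset: "Q \<subseteq> H"
  by (auto simp: Q_iff)

lemma Q_mem [simp]: "x \<in> Q \<Longrightarrow> x \<in> H"
  by (simp add: Q_iff)

lemma Q_subspace: "complex_vector.subspace Q"
proof (rule complex_vector.subspaceI)
  show "0 \<in> Q" by (rule Q_memI) simp_all
  show "x + y \<in> Q" if x: "x \<in> Q" and y: "y \<in> Q" for x y
  proof (rule Q_memI)
    show "x + y \<in> H" using Q_mem[OF x] Q_mem[OF y] by (rule add_mem)
    show "ip (mult_op (poly_eval p) f) (x + y) = 0" if f: "f \<in> H" for f
      using ip_add_right[OF Q_mem[OF x] Q_mem[OF y] mult_poly_mem[OF f]] Q_perp[OF x f] Q_perp[OF y f]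
      by simp
  qed
  show "c *\<^sub>C x \<in> Q" if x: "x \<in> Q" for c x
  proof (rule Q_memI)
    show "c *\<^sub>C x \<in> H" using Q_mem[OF x] by (rule scale_mem)
    show "ip (mult_op (poly_eval p) f) (c *\<^sub>C x) = 0" if f: "f \<in> H" for f
      using ip_scale_right[OF Q_mem[OF x] mult_poly_mem[OF f]] Q_perp[OF x f] by simp
  qed
qed

lemma Q_closed:
  assumes "\<And>k. u k \<in> Q" "converges u l"
  shows "l \<in> Q"
proof -
  have l: "l \<in> H" using assms(2) by (simp add: converges_def)
  have "ip (mult_op (poly_eval p) f) l = 0" if f: "f \<in> H" for f
  proof -
    have "(\<lambda>k. ip (u k) (mult_op (poly_eval p) f)) \<longlonglongrightarrow> ip l (mult_op (poly_eval p) f)"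
      using assms(2) f by (intro converges_ip_left) auto
    moreover have "ip (u k) (mult_op (poly_eval p) f) = 0" for k
      using assms(1) f by (rule Q_perp')
    ultimately have "ip l (mult_op (poly_eval p) f) = 0" by (simp add: LIMSEQ_const_iff)
    then show ?thesis using ip_commute[OF l mult_poly_mem[OF f]] by simp
  qed
  then show ?thesis by (rule Q_memI[OF l])
qed

lemma hilbert_Q: "hilbert Q ip"
  by (rule hilbert_closed_subspace[OF Q_subspace Q_subset Q_closed])

lemma bshift_Q: "h \<in> Q \<Longrightarrow> bshift j h \<in> Q"
proof -
  assume h: "h \<in> Q"
  have "ip (mult_op (poly_eval p) f) (bshift j h) = 0" if f: "f \<in> H" for f
  proof -
    have "ip (mult_op (poly_eval p) f) (bshift j h) = ip (coord j (mult_op (poly_eval p) f)) h"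
      using f Q_mem[OF h] by (simp add: ip_coord)
    also have "coord j (mult_op (poly_eval p) f) = mult_op (poly_eval p) (coord j f)"
      by (rule mult_op_commute)
    also have "ip \<dots> h = 0" using h f by (simp add: Q_perp)
    finally show ?thesis .
  qed
  then show ?thesis by (rule Q_memI[OF bshift_mem[OF Q_mem[OF h]]])
qed

lemma compression_props:
  assumes "x \<in> Q"
  shows "compression Q ip j x \<in> Q \<and> (\<forall>z\<in>Q. ip (coord j x - compression Q ip j x) z = 0)"
proof -
  have "\<exists>y\<in>Q. \<forall>z\<in>Q. ip (coord j x - y) z = 0"
    by (rule closed_subspace_projection[OF Q_subspace Q_subset]) (fact Q_closed, use assms in simp)
  then obtain y where y: "y \<in> Q" "\<And>z. z \<in> Q \<Longrightarrow> ip (coord j x - y) z = 0"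
    by blast
  have "compression Q ip j x = y"
    unfolding compression_def
    using y assms by (intro orth_projection_eqI Q_subspace Q_subset) auto
  then show ?thesis using y by simp
qed

definition adjoint_shift :: "'m \<Rightarrow> (complex ^ ('m option) \<Rightarrow> complex) \<Rightarrow> complex ^ ('m option) \<Rightarrow> complex" where
  "adjoint_shift j = hilbert_adjoint Q ip (compression Q ip (Some j))"

text \<open>
  The compressions are adjoint to restrictions, because \<open>Q\<close> is invariant under the backward shifts.
\<close>

lemma adjoint_shift_eq:
  assumes h: "h \<in> Q"
  shows "adjoint_shift j h = bshift (Some j) h"
proof -
  interpret Q: hilbert Q ip by (rule hilbert_Q)
  show ?thesis
    unfolding adjoint_shift_def
  proof (rule Q.hilbert_adjoint_eqI)
    show "bshift (Some j) h \<in> Q" using h by (rule bshift_Q)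
    fix x assume x: "x \<in> Q"
    show C: "compression Q ip (Some j) x \<in> Q" using compression_props[OF x] by blast
    have "ip (coord (Some j) x - compression Q ip (Some j) x) h = 0" using compression_props[OF x] h by blast
    then show "ip (compression Q ip (Some j) x) h = ip x (bshift (Some j) h)"
      using x h C by (simp add: ip_diff_left ip_coord)
  qed
qed

subsection \<open>The fundamental estimate\<close>

definition last_power :: "nat \<Rightarrow> complex ^ ('m option) \<Rightarrow> complex" where
  "last_power i = mon (\<lambda>x. if x = None then i else 0)"

lemma last_power_mem [simp]: "last_power i \<in> H"
  by (simp add: last_power_def)

lemma last_power_0: "last_power 0 = kernel_at 0"
  by (simp add: last_power_def mon_def)

lemma last_power_Suc: "last_power (Suc i) = coord None (last_power i)"
proof -
  have "(\<lambda>x. if x = None then Suc i else 0) =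
      (\<lambda>x :: 'm option. if x = None then i else 0)(None := Suc ((\<lambda>x :: 'm option. if x = None then i else 0) None))"
    by auto
  then show ?thesis unfolding last_power_def coord_mon by simp
qed

definition base_energy :: "(complex ^ ('m option) \<Rightarrow> complex) \<Rightarrow> real" where
  "base_energy h = (\<Sum>j\<in>UNIV. (nrm (bshift (Some j) h))\<^sup>2)"

lemma base_energy_nonneg [simp]: "0 \<le> base_energy h"
  by (simp add: base_energy_def sum_nonneg)

lemma funpow_bshift_mem [simp]: "h \<in> H \<Longrightarrow> (bshift j ^^ N) h \<in> H"
  by (induction N) auto

lemma ip_funpow_bshift_None:
  "h \<in> H \<Longrightarrow> ip ((bshift None ^^ N) h) (last_power i) = ip h (last_power (i + N))"
proof (induction N arbitrary: i)
  case (Suc N)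
  let ?g = "(bshift None ^^ N) h"
  have g: "?g \<in> H" using Suc.prems by simp
  have "ip (bshift None ?g) (last_power i) = cnj (ip (coord None (last_power i)) ?g)"
    using g ip_commute[of "last_power i" "bshift None ?g"] by (simp add: ip_coord)
  also have "\<dots> = ip ?g (last_power (Suc i))"
    using g ip_commute[of "last_power (Suc i)" ?g] by (simp add: last_power_Suc)
  finally show ?case using Suc.IH[OF Suc.prems, of "Suc i"] by simp
qed simp

text \<open>
  Apply the identity for the backward shifts to \<open>B\<^sub>d\<^sup>i h\<close> for each \<open>i < N\<close>; as the shifts commute and are
  contractions, the contributions of the other variables never exceed those at \<open>h\<close>.
\<close>

lemma energy_iteration:
  assumes h: "h \<in> H"
  shows "(nrm h)\<^sup>2 \<le> (\<Sum>i<N. (cmod (ip h (last_power i)))\<^sup>2) + real N * base_energy h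
      + (nrm ((bshift None ^^ N) h))\<^sup>2"
proof (induction N)
  case (Suc N)
  define g where "g = (bshift None ^^ N) h"
  have g: "g \<in> H" using h by (simp add: g_def)
  have comm: "bshift (Some j) g = (bshift None ^^ N) (bshift (Some j) h)" for j
    unfolding g_def
  proof (induction N)
    case (Suc N)
    then show ?case using h bshift_commute[of "(bshift None ^^ N) h" "Some j" None] by simp
  qed simp
  have contr: "nrm ((bshift None ^^ N) x) \<le> nrm x" if "x \<in> H" for x
  proof (induction N)
    case (Suc N)
    then show ?case using nrm_bshift_le[of "(bshift None ^^ N) x" None] that by simp
  qed simp
  have "(\<Sum>j\<in>UNIV. (nrm (bshift (Some j) g))\<^sup>2) \<le> base_energy h"
    unfolding base_energy_def comm using contr h by (intro sum_mono power_mono) auto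
  moreover have "ip g (kernel_at 0) = ip h (last_power N)"
    using ip_funpow_bshift_None[OF h, of N 0] by (simp add: g_def last_power_0)
  ultimately have "(nrm g)\<^sup>2 \<le> (cmod (ip h (last_power N)))\<^sup>2 + base_energy h + (nrm (bshift None g))\<^sup>2"
    using sum_bshift_sq[OF g] by (simp add: sum_option)
  then show ?case using Suc by (simp add: g_def algebra_simps)
qed simp

lemma mult_lead: "mult_op (monomial (Poly_Mapping.lookup lead)) f = (coord None ^^ n) f"
proof -
  have "mult_op (monomial (\<lambda>x :: 'm option. if x = None then N else 0)) f = (coord None ^^ N) f" for N
  proof (induction N)
    case (Suc N)
    have "(\<lambda>x. if x = None then Suc N else 0) =
      (\<lambda>x :: 'm option. if x = None then N else 0)(None := Suc ((\<lambda>x :: 'm option. if x = None then N else 0) None))"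
      by auto
    then show ?case using Suc mult_op_monomial_Suc[of "\<lambda>x :: 'm option. if x = None then N else 0" None f]
      by simp
  qed (simp add: mult_op_def)
  moreover have "Poly_Mapping.lookup lead = (\<lambda>x. if x = None then n else 0)"
    by (auto simp: fun_eq_iff lead_def lookup_single when_def)
  ultimately show ?thesis by simp
qed

lemma ip_funpow_coord:
  "f \<in> H \<Longrightarrow> h \<in> H \<Longrightarrow> ip ((coord j ^^ N) f) h = ip f ((bshift j ^^ N) h)"
proof (induction N arbitrary: f)
  case (Suc N)
  have "ip ((coord j ^^ Suc N) f) h = ip ((coord j ^^ N) (coord j f)) h" by (simp only: funpow_Suc_right o_apply)
  also have "\<dots> = ip f (bshift j ((bshift j ^^ N) h))" using Suc by (simp add: ip_coord)
  finally show ?case by simp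
qed simp

text \<open>
  Pairing \<open>h\<close> with \<open>p f\<close> gives zero; the leading term contributes
  \<open>B\<^sub>d\<^sup>n h\<close>, and in every other term some backward shift with index below \<open>d\<close> falls on \<open>h\<close>.  The choice
  \<open>f = B\<^sub>d\<^sup>n h\<close> gives the bound.
\<close>

lemma lead_estimate:
  assumes h: "h \<in> Q"
  shows "cmod (pc lead) * nrm ((bshift None ^^ n) h) \<le> rest_norm * sqrt (base_energy h)"
proof -
  define f where "f = (bshift None ^^ n) h"
  have hH: "h \<in> H" and f: "f \<in> H" using h by (auto simp: f_def)
  have tb: "cmod (pc g * ip (mult_op (monomial (Poly_Mapping.lookup g)) f) h)
      \<le> cmod (pc g) * (nrm f * sqrt (base_energy h))" if g: "g \<in> rest" for g
  proof -
    obtain j where j: "Poly_Mapping.lookup g (Some j) > 0" using rest_Some[OF g] by blast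
    define \<gamma> where "\<gamma> = (Poly_Mapping.lookup g)(Some j := Poly_Mapping.lookup g (Some j) - 1)"
    have "Poly_Mapping.lookup g = \<gamma>(Some j := Suc (\<gamma> (Some j)))" using j by (auto simp: \<gamma>_def)
    then have "ip (mult_op (monomial (Poly_Mapping.lookup g)) f) h
        = ip (mult_op (monomial \<gamma>) f) (bshift (Some j) h)"
      using f hH by (simp only: mult_op_monomial_Suc) (simp add: ip_coord)
    also have "cmod \<dots> \<le> nrm (mult_op (monomial \<gamma>) f) * nrm (bshift (Some j) h)"
      using f hH by (intro Cauchy_Schwarz) auto
    also have "\<dots> \<le> nrm f * sqrt (base_energy h)"
    proof (intro mult_mono nrm_mult_monomial_le f)
      have "(nrm (bshift (Some j) h))\<^sup>2 \<le> base_energy h"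
        unfolding base_energy_def
        using member_le_sum[of j UNIV "\<lambda>j. (nrm (bshift (Some j) h))\<^sup>2"] by simp
      then show "nrm (bshift (Some j) h) \<le> sqrt (base_energy h)" by (rule real_le_rsqrt)
    qed (use f hH in auto)
    finally show ?thesis by (simp add: norm_mult mult_left_mono)
  qed
  have "0 = ip (mult_op (poly_eval p) f) h" using h f by (simp add: Q_perp)
  also have "\<dots> = (\<Sum>g\<in>Poly_Mapping.keys p. pc g * ip (mult_op (monomial (Poly_Mapping.lookup g)) f) h)"
    unfolding mult_op_poly using f hH by (simp add: ip_sum_left ip_scale_left)
  also have "\<dots> = pc lead * ip f f + (\<Sum>g\<in>rest. pc g * ip (mult_op (monomial (Poly_Mapping.lookup g)) f) h)"
    unfolding sum_keys mult_lead using f hH by (simp add: ip_funpow_coord f_def)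
  finally have "pc lead * ip f f = - (\<Sum>g\<in>rest. pc g * ip (mult_op (monomial (Poly_Mapping.lookup g)) f) h)"
    by (simp add: eq_neg_iff_add_eq_0)
  then have "cmod (pc lead) * cmod (ip f f) = cmod (\<Sum>g\<in>rest. pc g * ip (mult_op (monomial (Poly_Mapping.lookup g)) f) h)"
    by (simp only: norm_mult[symmetric] norm_minus_cancel)
  also have "\<dots> \<le> (\<Sum>g\<in>rest. cmod (pc g) * (nrm f * sqrt (base_energy h)))"
    using tb by (rule sum_norm_le)
  also have "\<dots> = rest_norm * sqrt (base_energy h) * nrm f"
    by (simp add: rest_norm_def sum_distrib_right sum_distrib_left mult_ac)
  finally have "cmod (pc lead) * nrm f * nrm f \<le> rest_norm * sqrt (base_energy h) * nrm f"
    using f by (simp add: ip_self norm_mult power2_eq_square mult_ac)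
  then have "cmod (pc lead) * nrm f \<le> rest_norm * sqrt (base_energy h)"
    using nrm_nonneg[OF f] by (cases "nrm f = 0") (auto simp: mult_le_cancel_right)
  then show ?thesis by (simp add: f_def)
qed

definition bound_const :: real where
  "bound_const = real n + (rest_norm / cmod (pc lead))\<^sup>2"

lemma bound_const_nonneg [simp]: "0 \<le> bound_const"
  by (simp add: bound_const_def)

text \<open>
  A lower bound for the column of the first \<open>d - 1\<close> adjoints away from its kernel, which is spanned by
  \<open>1, t, \<dots>, t\<^sup>n\<^sup>-\<^sup>1\<close>.
\<close>

lemma fundamental_estimate:
  assumes h: "h \<in> Q" and z: "\<And>i. i < n \<Longrightarrow> ip h (last_power i) = 0"
  shows "(nrm h)\<^sup>2 \<le> bound_const * base_energy h"
proof -
  have "nrm ((bshift None ^^ n) h) \<le> rest_norm / cmod (pc lead) * sqrt (base_energy h)"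
    using lead_estimate[OF h] lead_nonzero by (simp add: field_simps)
  then have "(nrm ((bshift None ^^ n) h))\<^sup>2 \<le> (rest_norm / cmod (pc lead) * sqrt (base_energy h))\<^sup>2"
    using h by (intro power_mono) auto
  also have "\<dots> = (rest_norm / cmod (pc lead))\<^sup>2 * base_energy h"
    by (simp only: power_mult_distrib) simp
  finally show ?thesis
    using energy_iteration[of h n] h z by (simp add: bound_const_def algebra_simps)
qed

text \<open>
  Three smallness conditions: slices stay in the ball, solutions of the recurrence decay, and the fundamental
  estimate survives the perturbation.
\<close>

definition radius :: real where
  "radius = min (1/4) (min (cmod (pc lead) * (1/2) ^ n / (rest_norm + 1)) (1 / (4 * (bound_const + 1))))"

lemma radius_pos: "0 < radius"
  using lead_nonzero rest_norm_nonneg bound_const_nonneg by (simp add: radius_def add_nonneg_pos)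

lemma radius_props:
  assumes a: "norm a < radius"
  shows "norm a < 1/2" "norm a * rest_norm \<le> cmod (pc lead) * (1/2) ^ n"
    "4 * bound_const * (norm a)\<^sup>2 \<le> 1"
proof -
  show half: "norm a < 1/2" using a by (simp add: radius_def)
  have "norm a \<le> cmod (pc lead) * (1/2) ^ n / (rest_norm + 1)" using a by (simp add: radius_def)
  then have "norm a * (rest_norm + 1) \<le> cmod (pc lead) * (1/2) ^ n"
    using rest_norm_nonneg by (simp add: pos_le_divide_eq add_nonneg_pos)
  then show "norm a * rest_norm \<le> cmod (pc lead) * (1/2) ^ n"
    using norm_ge_zero[of a] by (simp only: distrib_left)
  have "norm a \<le> 1 / (4 * (bound_const + 1))" using a by (simp add: radius_def)
  then have "norm a * (4 * (bound_const + 1)) \<le> 1"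
    using bound_const_nonneg by (simp add: pos_le_divide_eq add_nonneg_pos)
  then have "norm a * 4 + 4 * bound_const * norm a \<le> 1" by (simp add: algebra_simps)
  moreover have "0 \<le> norm a * 4" by simp
  ultimately have "4 * bound_const * norm a \<le> 1" by linarith
  moreover have "4 * bound_const * norm a * norm a \<le> 4 * bound_const * norm a * 1"
    using half by (intro mult_left_mono) auto
  ultimately show "4 * bound_const * (norm a)\<^sup>2 \<le> 1" by (simp add: power2_eq_square mult_ac)
qed

lemma perturbed_estimate:
  assumes w: "norm w < radius" and h: "h \<in> Q" and z: "\<And>i. i < n \<Longrightarrow> ip h (last_power i) = 0"
  shows "(nrm h)\<^sup>2 \<le> 4 * bound_const * (\<Sum>j\<in>UNIV. (nrm (bshift (Some j) h - (w $ j) *\<^sub>C h))\<^sup>2)"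
proof -
  let ?D = "\<Sum>j\<in>UNIV. (nrm (bshift (Some j) h - (w $ j) *\<^sub>C h))\<^sup>2"
  have hH: "h \<in> H" using h by simp
  have "(nrm (bshift (Some j) h))\<^sup>2 \<le> 2 * (nrm (bshift (Some j) h - (w $ j) *\<^sub>C h))\<^sup>2 + 2 * ((cmod (w $ j))\<^sup>2 * (nrm h)\<^sup>2)" for j
  proof -
    have "nrm (bshift (Some j) h) \<le> nrm (bshift (Some j) h - (w $ j) *\<^sub>C h) + cmod (w $ j) * nrm h"
      using nrm_triangle[of "bshift (Some j) h - (w $ j) *\<^sub>C h" "(w $ j) *\<^sub>C h"] hH by (simp add: nrm_scale)
    then have "(nrm (bshift (Some j) h))\<^sup>2 \<le> (nrm (bshift (Some j) h - (w $ j) *\<^sub>C h) + cmod (w $ j) * nrm h)\<^sup>2"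
      using hH by (intro power_mono) auto
    also have "\<dots> \<le> 2 * (nrm (bshift (Some j) h - (w $ j) *\<^sub>C h))\<^sup>2 + 2 * (cmod (w $ j) * nrm h)\<^sup>2"
      using sum_squares_bound[of "nrm (bshift (Some j) h - (w $ j) *\<^sub>C h)" "cmod (w $ j) * nrm h"]
      by (simp add: power2_sum)
    finally show ?thesis by (simp add: power_mult_distrib)
  qed
  then have "base_energy h \<le> (\<Sum>j\<in>UNIV. 2 * (nrm (bshift (Some j) h - (w $ j) *\<^sub>C h))\<^sup>2 + 2 * ((cmod (w $ j))\<^sup>2 * (nrm h)\<^sup>2))"
    unfolding base_energy_def by (rule sum_mono)
  also have "\<dots> = 2 * ?D + 2 * ((norm w)\<^sup>2 * (nrm h)\<^sup>2)"
    by (simp add: sum.distrib norm_vec_sq sum_distrib_left sum_distrib_right)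
  finally have "bound_const * base_energy h \<le> bound_const * (2 * ?D + 2 * ((norm w)\<^sup>2 * (nrm h)\<^sup>2))"
    by (rule mult_left_mono) simp
  moreover have "4 * bound_const * (norm w)\<^sup>2 * (nrm h)\<^sup>2 \<le> 1 * (nrm h)\<^sup>2"
    using radius_props(3)[OF w] by (intro mult_right_mono) auto
  ultimately show ?thesis
    using fundamental_estimate[OF h z] by (simp add: algebra_simps)
qed

subsection \<open>Joint eigenvectors\<close>

text \<open>
  The functional represented by an eigenvector for \<open>w\<close> has the conjugate eigenvalue, because the inner product
  is antilinear in its second argument.
\<close>

definition conj_vec :: "complex ^ 'm \<Rightarrow> complex ^ 'm" where
  "conj_vec w = (\<chi> j. cnj (w $ j))"

lemma conj_vec_nth [simp]: "conj_vec w $ j = cnj (w $ j)"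
  by (simp add: conj_vec_def)

lemma conj_vec_conj_vec [simp]: "conj_vec (conj_vec w) = w"
  by (simp add: vec_eq_iff)

lemma norm_conj_vec [simp]: "norm (conj_vec w) = norm w"
  by (simp add: norm_vec_def)

definition eigenspace :: "complex ^ 'm \<Rightarrow> (complex ^ ('m option) \<Rightarrow> complex) set" where
  "eigenspace w = {h \<in> Q. \<forall>j. bshift (Some j) h = (w $ j) *\<^sub>C h}"

lemma joint_eigenspace_eq: "joint_eigenspace Q adjoint_shift w = eigenspace w"
  unfolding joint_eigenspace_def eigenspace_def by (auto simp: adjoint_shift_eq)

lemma eigenspace_Q: "h \<in> eigenspace w \<Longrightarrow> h \<in> Q"
  by (simp add: eigenspace_def)

lemma eigenspace_subspace: "complex_vector.subspace (eigenspace w)"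
proof (rule complex_vector.subspaceI)
  show "0 \<in> eigenspace w"
    using complex_vector.subspace_0[OF Q_subspace] bshift_scale[of 0 _ 0] by (simp add: eigenspace_def)
  show "x + y \<in> eigenspace w" if "x \<in> eigenspace w" "y \<in> eigenspace w" for x y
    using that complex_vector.subspace_add[OF Q_subspace, of x y]
    by (simp add: eigenspace_def bshift_add complex_vector.scale_right_distrib)
  show "c *\<^sub>C x \<in> eigenspace w" if "x \<in> eigenspace w" for c x
    using that complex_vector.subspace_scale[OF Q_subspace, of x c]
    by (simp add: eigenspace_def bshift_scale mult.commute)
qed

lemma eigenvector_of_solution:
  assumes a: "norm a < radius" and c: "solution a c"
  shows "\<exists>h\<in>eigenspace (conj_vec a). \<forall>f\<in>H. ip f h = slice_functional a c f"
proof -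
  have a2: "norm a < 1/2" using radius_props(1)[OF a] .
  have geo: "geometric c"
    using radius_props(2)[OF a] a2 by (intro solution_geometric[OF c]) auto
  obtain h where h: "h \<in> H" "\<And>f. f \<in> H \<Longrightarrow> ip f h = slice_functional a c f"
    using slice_functional_rep[OF a2 geo] by blast
  have "h \<in> Q"
    using h(1) by (rule Q_memI) (simp add: h(2) slice_functional_annihilates[OF _ a2 geo c])
  moreover have "bshift (Some j) h = (conj_vec a $ j) *\<^sub>C h" for j
    using h(1) by (intro bshift_eqI)
      (simp_all add: ip_scale_right h(2) slice_functional_coord_Some[OF _ a2 geo])
  ultimately show ?thesis using h(2) unfolding eigenspace_def by blast
qed

text \<open>
  Solutions of the recurrence with initial values \<open>0, \<dots>, 1, \<dots>, 0\<close> give eigenvectors dual to the first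
  \<open>n\<close> powers of \<open>t\<close>.
\<close>

lemma dual_eigenvectors:
  assumes w: "norm w < radius"
  shows "\<exists>e. \<forall>i<n. e i \<in> eigenspace w \<and> (\<forall>k<n. ip (last_power k) (e i) = (if k = i then 1 else 0))"
proof -
  let ?a = "conj_vec w"
  have a: "norm ?a < radius" using w by simp
  have "\<exists>h. h \<in> eigenspace w \<and> (\<forall>k<n. ip (last_power k) h = (if k = i then 1 else 0))" for i
  proof -
    obtain c where c: "solution ?a c" "\<And>k. k < n \<Longrightarrow> c k = (if k = i then 1 else 0)"
      using solution_exists[of ?a "\<lambda>k. if k = i then 1 else 0"] by blast
    have geo: "geometric c"
      using radius_props(1,2)[OF a] by (intro solution_geometric[OF c(1)]) auto
    obtain h where h: "h \<in> eigenspace w" "\<And>f. f \<in> H \<Longrightarrow> ip f h = slice_functional ?a c f"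
      using eigenvector_of_solution[OF a c(1)] by auto
    have "ip (last_power k) h = c k" for k
      using slice_functional_mon[OF radius_props(1)[OF a] geo, of "\<lambda>x. if x = None then k else 0"]
        h(2)[OF last_power_mem] by (simp add: last_power_def)
    then show ?thesis using h(1) c(2) by auto
  qed
  then show ?thesis by metis
qed

lemma ip_tpow_right:
  assumes "h \<in> H"
  shows "ip h (last_power k) = cnj (ip (last_power k) h)"
  using ip_commute[OF last_power_mem assms] .

lemma eigenspace_interpolation:
  assumes w: "norm w < radius" and e: "\<And>i. i < n \<Longrightarrow> e i \<in> eigenspace w"
    "\<And>i k. i < n \<Longrightarrow> k < n \<Longrightarrow> ip (last_power k) (e i) = (if k = i then 1 else 0)"
    and h: "h \<in> Q" and k: "k < n"
  shows "ip (h - (\<Sum>i<n. ip h (last_power i) *\<^sub>C e i)) (last_power k) = 0"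
proof -
  have eH: "e i \<in> H" if "i < n" for i using e(1)[OF that] eigenspace_Q Q_mem by blast
  have "ip (\<Sum>i<n. ip h (last_power i) *\<^sub>C e i) (last_power k) = (\<Sum>i<n. ip h (last_power i) * ip (e i) (last_power k))"
    by (subst ip_sum_left) (auto simp: eH ip_scale_left)
  also have "\<dots> = (\<Sum>i<n. if i = k then ip h (last_power k) else 0)"
    using eH e(2) k by (intro sum.cong) (auto simp: ip_tpow_right)
  also have "\<dots> = ip h (last_power k)" using k by simp
  finally have "ip (\<Sum>i<n. ip h (last_power i) *\<^sub>C e i) (last_power k) = ip h (last_power k)" .
  moreover have "(\<Sum>i<n. ip h (last_power i) *\<^sub>C e i) \<in> H" using eH by (intro sum_mem scale_mem) auto
  ultimately show ?thesis using ip_diff_left[OF Q_mem[OF h] _ last_power_mem] by simp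
qed

text \<open>
  The dual eigenvectors span: the difference between an eigenvector and its interpolation is orthogonal to
  the powers of \<open>t\<close>, where the shifted column operator is injective.
\<close>

lemma eigenspace_dim:
  assumes w: "norm w < radius"
  shows "complex_vector.dim (eigenspace w) = n"
proof -
  obtain e where e: "\<And>i. i < n \<Longrightarrow> e i \<in> eigenspace w"
    "\<And>i k. i < n \<Longrightarrow> k < n \<Longrightarrow> ip (last_power k) (e i) = (if k = i then 1 else 0)"
    using dual_eigenvectors[OF w] by blast
  have eH: "e i \<in> H" if "i < n" for i using e(1)[OF that] eigenspace_Q Q_mem by blast
  have inj: "inj_on e {..<n}"
  proof (rule inj_onI)
    fix i k assume ik: "i \<in> {..<n}" "k \<in> {..<n}" "e i = e k"
    then have "ip (last_power i) (e i) = ip (last_power i) (e k)" by simp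
    then show "i = k" using e(2)[of i i] e(2)[of k i] ik by (simp split: if_splits)
  qed
  show ?thesis
  proof (rule complex_vector.dim_unique)
    show "e ` {..<n} \<subseteq> eigenspace w" using e(1) by auto
    show "card (e ` {..<n}) = n" using card_image[OF inj] by simp
    show "complex_vector.independent (e ` {..<n})"
    proof (rule complex_vector.independent_if_scalars_zero)
      fix u x assume s: "(\<Sum>x\<in>e ` {..<n}. u x *\<^sub>C x) = 0" and x: "x \<in> e ` {..<n}"
      obtain k where k: "k < n" "x = e k" using x by auto
      have "(\<Sum>i<n. u (e i) *\<^sub>C e i) = 0" using s by (simp add: sum.reindex[OF inj])
      then have "ip (last_power k) (\<Sum>i<n. u (e i) *\<^sub>C e i) = 0" by simp
      then have "(\<Sum>i<n. cnj (u (e i)) * ip (last_power k) (e i)) = 0"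
        by (subst (asm) ip_sum_right) (auto simp: eH ip_scale_right)
      also have "(\<Sum>i<n. cnj (u (e i)) * ip (last_power k) (e i)) = (\<Sum>i<n. if i = k then cnj (u (e k)) else 0)"
        using e(2) k by (intro sum.cong) auto
      finally show "u x = 0" using k by simp
    qed simp
    show "eigenspace w \<subseteq> complex_vector.span (e ` {..<n})"
    proof
      fix h assume h: "h \<in> eigenspace w"
      define g where "g = h - (\<Sum>i<n. ip h (last_power i) *\<^sub>C e i)"
      have g: "g \<in> eigenspace w"
        unfolding g_def using h e(1)
        by (intro complex_vector.subspace_diff[OF eigenspace_subspace]
            complex_vector.subspace_sum[OF eigenspace_subspace]
            complex_vector.subspace_scale[OF eigenspace_subspace]) auto
      have z: "ip g (last_power k) = 0" if "k < n" for k
        unfolding g_def using eigenspace_interpolation[OF w e eigenspace_Q[OF h] that] .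
      have "(nrm g)\<^sup>2 \<le> 0"
        using perturbed_estimate[OF w eigenspace_Q[OF g] z] g by (simp add: eigenspace_def)
      then have "g = 0" using nrm_eq_0[OF Q_mem[OF eigenspace_Q[OF g]]] by simp
      then have "h = (\<Sum>i<n. ip h (last_power i) *\<^sub>C e i)" by (simp add: g_def)
      then show "h \<in> complex_vector.span (e ` {..<n})"
        by (metis (no_types, lifting) complex_vector.span_base complex_vector.span_scale
            complex_vector.span_sum image_eqI)
    qed
  qed
qed

subsection \<open>Closed range\<close>

text \<open>
  By interpolation with eigenvectors every element of the range has a preimage in the subspace \<open>V\<close> orthogonal
  to \<open>1, \<dots>, t\<^sup>n\<^sup>-\<^sup>1\<close>.  The operator is bounded below on \<open>V\<close>, so the preimages in \<open>V\<close> of a convergent sequence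
  form a Cauchy sequence.
\<close>

lemma shifted_range_closed:
  assumes w: "norm w < radius"
  shows "closedin (hilbert_topology (tuple_space Q) (tuple_ip ip)) (shifted_tuple adjoint_shift w ` Q)"
proof -
  interpret Q: hilbert Q ip by (rule hilbert_Q)
  interpret tup: ip_space "tuple_space Q :: ('m \<Rightarrow> _) set" "tuple_ip ip"
    by (rule tuple_space_ip_space) (rule Q.ip_space_axioms)
  let ?D = "shifted_tuple adjoint_shift w"
  have D_apply: "?D h j = bshift (Some j) h - (w $ j) *\<^sub>C h" if "h \<in> Q" for h j
    using that by (simp add: shifted_tuple_def adjoint_shift_eq)
  have DQ: "?D h \<in> tuple_space Q" if h: "h \<in> Q" for h
    using D_apply[OF h] bshift_Q[OF h] h by (simp add: tuple_space_def)
  have D_diff: "?D (g - h) = ?D g - ?D h" if "g \<in> Q" "h \<in> Q" for g h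
    using that complex_vector.subspace_diff[OF Q_subspace, of g h]
    by (auto simp: fun_eq_iff D_apply bshift_diff complex_vector.scale_right_diff_distrib)
  have nrm_tup: "(tup.nrm x)\<^sup>2 = (\<Sum>j\<in>UNIV. (nrm (x j))\<^sup>2)" if "x \<in> tuple_space Q" for x
    using that unfolding tup.nrm_sq[OF that] by (simp add: tuple_ip_def tuple_space_def Q.nrm_sq)
  obtain e where e: "\<And>i. i < n \<Longrightarrow> e i \<in> eigenspace w"
    "\<And>i k. i < n \<Longrightarrow> k < n \<Longrightarrow> ip (last_power k) (e i) = (if k = i then 1 else 0)"
    using dual_eigenvectors[OF w] by blast
  define V where "V = {h \<in> Q. \<forall>k<n. ip h (last_power k) = 0}"
  have VQ: "h \<in> Q" if "h \<in> V" for h using that by (simp add: V_def)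
  have range_V: "\<exists>g\<in>V. ?D g = ?D h" if h: "h \<in> Q" for h
  proof -
    define s where "s = (\<Sum>i<n. ip h (last_power i) *\<^sub>C e i)"
    have s: "s \<in> eigenspace w"
      unfolding s_def using e(1)
      by (intro complex_vector.subspace_sum[OF eigenspace_subspace]
          complex_vector.subspace_scale[OF eigenspace_subspace]) auto
    have "?D s = 0" using s D_apply[OF eigenspace_Q[OF s]] by (auto simp: fun_eq_iff eigenspace_def)
    then have "?D (h - s) = ?D h" using D_diff[OF h eigenspace_Q[OF s]] by simp
    moreover have "h - s \<in> V"
      unfolding V_def s_def
      using eigenspace_interpolation[OF w e h] eigenspace_Q[OF s] h
        complex_vector.subspace_diff[OF Q_subspace, of h s] by (simp add: s_def)
    ultimately show ?thesis by blast
  qed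
  define L where "L = 2 * sqrt bound_const"
  have below: "nrm h \<le> L * tup.nrm (?D h)" if h: "h \<in> V" for h
  proof -
    have "(nrm h)\<^sup>2 \<le> 4 * bound_const * (tup.nrm (?D h))\<^sup>2"
      using perturbed_estimate[OF w VQ[OF h]] h nrm_tup[OF DQ[OF VQ[OF h]]] D_apply[OF VQ[OF h]]
      by (simp add: V_def)
    also have "\<dots> = (L * tup.nrm (?D h))\<^sup>2" by (simp add: L_def power_mult_distrib)
    finally show ?thesis
      using tup.nrm_nonneg[OF DQ[OF VQ[OF h]]] by (auto intro: power2_le_imp_le simp: L_def)
  qed
  have "x \<in> ?D ` Q" if x: "\<And>k. u k \<in> ?D ` Q" "tup.converges u x" for u x
  proof -
    have "\<exists>g\<in>V. ?D g = u k" for k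
    proof -
      obtain h where "u k = ?D h" "h \<in> Q" using x(1)[of k] by (rule imageE)
      then show ?thesis using range_V[of h] by simp
    qed
    then obtain v where v: "\<And>k. v k \<in> V" "\<And>k. ?D (v k) = u k" by metis
    have vQ: "v k \<in> Q" for k using v(1) VQ by blast
    have ut: "u k \<in> tuple_space Q" and xt: "x \<in> tuple_space Q" for k
      using x(2) by (auto simp: tup.converges_def)
    have diffV: "v i - v j \<in> V" for i j
      using v(1)[of i] v(1)[of j] complex_vector.subspace_diff[OF Q_subspace, of "v i" "v j"]
      by (auto simp: V_def ip_diff_left)
    have "\<exists>l. Q.converges v l"
    proof (rule Q.Cauchy_converges[OF vQ])
      fix r :: real assume r: "r > 0"
      have "L \<ge> 0" by (simp add: L_def)
      have "(\<lambda>k. tup.nrm (u k - x)) \<longlonglongrightarrow> 0" using x(2) by (simp add: tup.converges_def)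
      moreover define d where "d = r / (L + 1) / 2"
      moreover have "d > 0" using r \<open>L \<ge> 0\<close> by (simp add: d_def)
      ultimately have "\<forall>\<^sub>F k in sequentially. tup.nrm (u k - x) < d" by (intro order_tendstoD(2))
      then obtain N where N: "\<And>k. k \<ge> N \<Longrightarrow> tup.nrm (u k - x) < d"
        unfolding eventually_sequentially by blast
      show "\<exists>N. \<forall>i\<ge>N. \<forall>j\<ge>N. nrm (v i - v j) < r"
      proof (intro exI allI impI)
        fix i j assume ij: "i \<ge> N" "j \<ge> N"
        have "tup.nrm (u i - u j) \<le> tup.nrm (u i - x) + tup.nrm (u j - x)"
          using tup.nrm_triangle[of "u i - x" "x - u j"] tup.nrm_minus_commute[of x "u j"] ut xt by simp
        also have "\<dots> \<le> r / (L + 1)" 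
        proof -
          have "r / (L + 1) = d + d" unfolding d_def by (rule field_sum_of_halves[symmetric])
          then show ?thesis using N[OF ij(1)] N[OF ij(2)] by linarith
        qed
        finally have le: "tup.nrm (u i - u j) \<le> r / (L + 1)" .
        have "nrm (v i - v j) \<le> L * tup.nrm (u i - u j)"
          using below[OF diffV] D_diff[OF vQ vQ] v(2) by metis
        also have "\<dots> \<le> L * (r / (L + 1))" using le \<open>L \<ge> 0\<close> by (rule mult_left_mono)
        also have "\<dots> < r" using r \<open>L \<ge> 0\<close> by (simp add: field_simps)
        finally show "nrm (v i - v j) < r" .
      qed
    qed
    then obtain l where l: "Q.converges v l" by blast
    then have lQ: "l \<in> Q" by (simp add: Q.converges_def)
    have conv: "converges v l" using l vQ Q_mem unfolding Q.converges_def converges_def by blast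
    have "x j = ?D l j" for j
    proof -
      have "converges (\<lambda>k. bshift (Some j) (v k) - (w $ j) *\<^sub>C v k) (bshift (Some j) l - (w $ j) *\<^sub>C l)"
      proof (rule converges_image[OF conv, of _ "1 + cmod (w $ j)"])
        show "nrm (bshift (Some j) h - (w $ j) *\<^sub>C h) \<le> (1 + cmod (w $ j)) * nrm h" if "h \<in> H" for h
          using nrm_triangle[of "bshift (Some j) h" "(- (w $ j)) *\<^sub>C h"] nrm_bshift_le[OF that, of "Some j"]
            nrm_scale[OF that, of "- (w $ j)"] scale_mem[OF that, of "- (w $ j)"] that
          by (simp add: algebra_simps)
        show "bshift (Some j) h - (w $ j) *\<^sub>C h \<in> H" if "h \<in> H" for h
          using that by (intro diff_mem scale_mem bshift_mem)
        show "bshift (Some j) (g - h) - (w $ j) *\<^sub>C (g - h)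
            = (bshift (Some j) g - (w $ j) *\<^sub>C g) - (bshift (Some j) h - (w $ j) *\<^sub>C h)"
          if "g \<in> H" "h \<in> H" for g h
          using bshift_diff[OF that] by (simp add: complex_vector.scale_right_diff_distrib)
      qed
      moreover have "converges (\<lambda>k. bshift (Some j) (v k) - (w $ j) *\<^sub>C v k) (x j)"
      proof -
        have "(\<lambda>k. nrm (u k j - x j)) \<longlonglongrightarrow> 0"
        proof (rule tendsto_sandwich[OF _ _ tendsto_const])
          show "(\<lambda>k. tup.nrm (u k - x)) \<longlonglongrightarrow> 0" using x(2) by (simp add: tup.converges_def)
          have "nrm (u k j - x j) \<le> tup.nrm (u k - x)" for k
          proof -
            have "u k - x \<in> tuple_space Q" using ut xt by simp
            then have "(nrm (u k j - x j))\<^sup>2 \<le> (tup.nrm (u k - x))\<^sup>2"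
              using member_le_sum[of j UNIV "\<lambda>j. (nrm ((u k - x) j))\<^sup>2"] by (simp add: nrm_tup)
            moreover have "0 \<le> tup.nrm (u k - x)" using ut xt by simp
            ultimately show ?thesis by (rule power2_le_imp_le)
          qed
          then show "\<forall>\<^sub>F k in sequentially. nrm (u k j - x j) \<le> tup.nrm (u k - x)" by simp
          have "u k j - x j \<in> H" for k
            using ut[of k] xt by (simp add: tuple_space_def)
          then show "\<forall>\<^sub>F k in sequentially. 0 \<le> nrm (u k j - x j)" by simp
        qed
        moreover have "u k j = bshift (Some j) (v k) - (w $ j) *\<^sub>C v k" for k
          using v(2)[of k] D_apply[OF vQ] by metis
        moreover have "u k j \<in> H" "x j \<in> H" for k using ut xt by (auto simp: tuple_space_def)
        ultimately show ?thesis unfolding converges_def by simp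
      qed
      ultimately have "x j = bshift (Some j) l - (w $ j) *\<^sub>C l" by (rule converges_unique[rotated])
      then show ?thesis by (simp add: D_apply[OF lQ])
    qed
    then have "x = ?D l" by blast
    then show ?thesis using lQ by blast
  qed
  note seq = this
  show ?thesis
    unfolding hilbert_topology_def tup.ms.metric_closedin_iff_sequentially_closed
  proof (intro conjI allI impI)
    show "?D ` Q \<subseteq> tuple_space Q" using DQ by (rule image_subsetI)
    fix u x assume "range u \<subseteq> ?D ` Q \<and> limitin tup.ms.mtopology u x sequentially"
    then have r: "range u \<subseteq> ?D ` Q" and lim: "limitin tup.ms.mtopology u x sequentially" 
      by (rule conjunct1, rule conjunct2)
    have uD: "u k \<in> ?D ` Q" for k using r by (rule subsetD) (rule rangeI)
    have "u k \<in> tuple_space Q" for k using uD[of k] DQ by (elim imageE) simp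
    then have "tup.converges u x" using lim tup.limitin_iff_converges[of u x] by simp
    with uD show "x \<in> ?D ` Q" by (rule seq)
  qed
qed

subsection \<open>Totality of the eigenvectors\<close>

lemma slice_functional_rescale:
  assumes a: "norm a < radius" and c: "solution a c" and s: "norm s < 1" and g: "g \<in> hom m"
  shows "slice_functional (s *s a) (\<lambda>k. s ^ k * c k) g = s ^ m * slice_functional a c g"
proof -
  have norm_sa: "norm (s *s a) = norm s * norm a"
    by (rule norm_smult_vec)
  also have "\<dots> \<le> 1 * norm a" using s by (intro mult_right_mono) auto
  finally have sa: "norm (s *s a) < radius" using a by simp
  obtain h where h: "h \<in> H" "\<And>f. f \<in> H \<Longrightarrow> ip f h = slice_functional a c f"
    using eigenvector_of_solution[OF a c] eigenspace_Q Q_mem by blast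
  obtain h' where h': "h' \<in> H" "\<And>f. f \<in> H \<Longrightarrow> ip f h' = slice_functional (s *s a) (\<lambda>k. s ^ k * c k) f"
    using eigenvector_of_solution[OF sa solution_rescale[OF c]] eigenspace_Q Q_mem by blast
  have geo: "geometric c"
    using radius_props(1,2)[OF a] by (intro solution_geometric[OF c]) auto
  have geo': "geometric (\<lambda>k. s ^ k * c k)"
    using radius_props(1,2)[OF sa] by (intro solution_geometric[OF solution_rescale[OF c]]) auto
  have "hom m \<subseteq> {g \<in> H. ip g h' = s ^ m * ip g h}"
    unfolding hom_def
  proof (rule complex_vector.span_minimal)
    show "mon ` {\<gamma>. (\<Sum>i\<in>UNIV. \<gamma> i) = m} \<subseteq> {g \<in> H. ip g h' = s ^ m * ip g h}"
    proof clarify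
      fix \<gamma> :: "'m option \<Rightarrow> nat" assume m: "m = (\<Sum>i\<in>UNIV. \<gamma> i)"
      have "ip (mon \<gamma>) h' = s ^ (\<Sum>j\<in>UNIV. \<gamma> (Some j)) * s ^ \<gamma> None * ip (mon \<gamma>) h"
        using h h' slice_functional_mon[OF radius_props(1)[OF a] geo] slice_functional_mon[OF radius_props(1)[OF sa] geo']
        by (simp add: monomial_scale)
      also have "s ^ (\<Sum>j\<in>UNIV. \<gamma> (Some j)) * s ^ \<gamma> None = s ^ m"
        by (simp add: m sum_option add.commute flip: power_add)
      finally show "mon \<gamma> \<in> H \<and> ip (mon \<gamma>) h' = s ^ (\<Sum>i\<in>UNIV. \<gamma> i) * ip (mon \<gamma>) h"
        by (simp add: m)
    qed
    show "complex_vector.subspace {g \<in> H. ip g h' = s ^ m * ip g h}"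
      using h(1) h'(1)
      by (intro complex_vector.subspaceI) (auto simp: ip_add_left ip_scale_left algebra_simps)
  qed
  then have "g \<in> H" "ip g h' = s ^ m * ip g h" using g by auto
  then show ?thesis using h(2) h'(2) by simp
qed

text \<open>
  Multiplication by \<open>p\<close> raises degrees by \<open>n\<close>, so its adjoint respects the grading; vanishing of the adjoint
  on a component can be tested on monomials.
\<close>

lemma component_Q:
  assumes f: "f \<in> Q"
  shows "component m f \<in> Q"
proof -
  have fH: "f \<in> H" and mH: "component m f \<in> H" using f by auto
  have deg: "mult_op (poly_eval p) (mon \<gamma>) \<in> hom (n + (\<Sum>i\<in>UNIV. \<gamma> i))" for \<gamma>
  proof -
    have "mult_op (monomial (Poly_Mapping.lookup g)) (mon \<gamma>) \<in> hom (n + (\<Sum>i\<in>UNIV. \<gamma> i))"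
      if g: "g \<in> Poly_Mapping.keys p" for g
    proof -
      have "(\<Sum>i\<in>UNIV. Poly_Mapping.lookup g i + \<gamma> i) = n + (\<Sum>i\<in>UNIV. \<gamma> i)"
        using hom_p g by (simp add: homogeneous_of_degree_def sum.distrib)
      then show ?thesis
        unfolding mult_op_monomial_mon using mon_hom[of "\<lambda>i. Poly_Mapping.lookup g i + \<gamma> i"] by simp
    qed
    then show ?thesis
      unfolding mult_op_poly hom_def
      by (intro complex_vector.span_sum complex_vector.span_scale)
  qed
  have mons: "ip (mult_op (poly_eval p) (mon \<gamma>)) (component m f) = 0" for \<gamma>
  proof (cases "n + (\<Sum>i\<in>UNIV. \<gamma> i) = m")
    case True
    then have "ip (component m f) (mult_op (poly_eval p) (mon \<gamma>)) = ip f (mult_op (poly_eval p) (mon \<gamma>))"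
      using deg[of \<gamma>] by (intro ip_component[OF fH]) simp
    also have "\<dots> = 0" using f by (simp add: Q_perp')
    finally show ?thesis using ip_commute[OF mH mult_poly_mem[OF mon_mem]] by simp
  next
    case False
    then show ?thesis using hom_orthogonal[OF _ deg component_hom[OF fH]] by blast
  qed
  have bounded: "\<And>x. x \<in> H \<Longrightarrow> nrm (mult_op (poly_eval p) x)
      \<le> (\<Sum>a\<in>Poly_Mapping.keys p. cmod (pc a)) * nrm x"
    by (rule nrm_mult_poly_le)
  have adj: "hilbert_adjoint H ip (mult_op (poly_eval p)) (component m f) \<in> H \<and>
     nrm (hilbert_adjoint H ip (mult_op (poly_eval p)) (component m f))
       \<le> (\<Sum>a\<in>Poly_Mapping.keys p. cmod (pc a)) * nrm (component m f) \<and>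
     (\<forall>x\<in>H. ip (mult_op (poly_eval p) x) (component m f)
        = ip x (hilbert_adjoint H ip (mult_op (poly_eval p)) (component m f)))"
    by (rule adjoint_exists[OF _ _ _ bounded _ mH]) (auto simp: mult_op_add mult_op_scale sum_nonneg)
  \<comment> \<open>Passing to the adjoint replaces a limit argument over all multiples of \<open>p\<close> by totality of the monomials.\<close>
  define g where "g = hilbert_adjoint H ip (mult_op (poly_eval p)) (component m f)"
  have g: "g \<in> H" "\<And>x. x \<in> H \<Longrightarrow> ip (mult_op (poly_eval p) x) (component m f) = ip x g"
    using adj by (auto simp: g_def)
  have "g = 0"
  proof (rule mons_total[OF g(1)])
    show "ip g (mon \<gamma>) = 0" for \<gamma>
      using g(2)[of "mon \<gamma>"] mons[of \<gamma>] ip_commute[of "mon \<gamma>" g] g(1) by simp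
  qed
  then show ?thesis using g(2) by (intro Q_memI[OF mH]) simp
qed

text \<open>
  The functional for \<open>s a\<close> and the rescaled solution vanishes on \<open>f\<close>.  It acts on the component of degree \<open>k\<close>
  as \<open>s\<^sup>k\<close> times the functional for \<open>a\<close>, so all coefficients of a power series in \<open>s\<close> vanish.
\<close>

lemma component_annihilated:
  assumes f: "f \<in> Q"
    and perp: "\<And>w h. norm w < radius \<Longrightarrow> h \<in> eigenspace w \<Longrightarrow> ip f h = 0"
    and a: "norm a < radius" and c: "solution a c"
  shows "slice_functional a c (component m f) = 0"
proof (rule sums_zero_imp_coeffs_zero[of "\<lambda>k. slice_functional a c (component k f)"])
  fix s :: complex assume s: "norm s < 1"
  have fH: "f \<in> H" using f by simp
  have norm_sa: "norm (s *s a) = norm s * norm a"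
    by (rule norm_smult_vec)
  also have "\<dots> \<le> 1 * norm a" using s by (intro mult_right_mono) auto
  finally have sa: "norm (s *s a) < radius" using a by simp
  obtain h where h: "h \<in> eigenspace (conj_vec (s *s a))"
    "\<And>f. f \<in> H \<Longrightarrow> ip f h = slice_functional (s *s a) (\<lambda>k. s ^ k * c k) f"
    using eigenvector_of_solution[OF sa solution_rescale[OF c]] by blast
  have hH: "h \<in> H" using h(1) eigenspace_Q Q_mem by blast
  have "ip f h = 0" using perp[OF _ h(1)] sa by simp
  moreover have "(\<lambda>N. ip (\<Sum>k\<le>N. component k f) h) \<longlonglongrightarrow> ip f h"
    by (rule converges_ip_left[OF component_converges[OF fH] hH])
  moreover have "ip (\<Sum>k\<le>N. component k f) h = (\<Sum>k\<le>N. slice_functional a c (component k f) * s ^ k)" for N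
  proof -
    have "ip (component k f) h = slice_functional a c (component k f) * s ^ k" for k
      using h(2)[OF component_mem[OF fH]] slice_functional_rescale[OF a c s component_hom[OF fH]]
      by (simp add: mult.commute)
    then show ?thesis using fH hH by (simp add: ip_sum_left)
  qed
  ultimately show "(\<lambda>k. slice_functional a c (component k f) * s ^ k) sums 0"
    by (simp add: sums_def_le)
qed

text \<open>
  Homogeneous polynomials of degree below \<open>n\<close> in \<open>t\<close>: the possible remainders of division by \<open>p\<close>.
\<close>

definition remainders :: "nat \<Rightarrow> (complex ^ ('m option) \<Rightarrow> complex) set" where
  "remainders m = complex_vector.span (mon ` {\<gamma>. (\<Sum>i\<in>UNIV. \<gamma> i) = m \<and> \<gamma> None < n})"

lemma remainders_hom: "remainders m \<subseteq> hom m"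
  unfolding remainders_def hom_def by (intro complex_vector.span_mono) auto

text \<open>
  Division by \<open>p\<close>, which is monic in \<open>t\<close> up to a constant: induction on the exponent of \<open>t\<close>, replacing \<open>t\<^sup>n\<close> by
  \<open>p\<close> minus terms of lower degree in \<open>t\<close>.
\<close>

lemma division:
  assumes "f \<in> hom m"
  shows "\<exists>G\<in>H. \<exists>r\<in>remainders m. f = mult_op (poly_eval p) G + r"
proof -
  define D where "D = {f. \<exists>G\<in>H. \<exists>r\<in>remainders m. f = mult_op (poly_eval p) G + r}"
  have R: "complex_vector.subspace (remainders m)" by (simp add: remainders_def)
  have D_sub: "complex_vector.subspace D"
  proof (rule complex_vector.subspaceI)
    have "(0 :: complex ^ 'm option \<Rightarrow> complex) = mult_op (poly_eval p) 0 + 0" by (auto simp: mult_op_def)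
    then show "0 \<in> D" unfolding D_def using complex_vector.subspace_0[OF R] zero_mem by blast
    show "x + y \<in> D" if xy: "x \<in> D" "y \<in> D" for x y
    proof -
      obtain G r G' r' where "G \<in> H" "r \<in> remainders m" "x = mult_op (poly_eval p) G + r"
        "G' \<in> H" "r' \<in> remainders m" "y = mult_op (poly_eval p) G' + r'"
        using xy unfolding D_def by blast
      then have "G + G' \<in> H" "r + r' \<in> remainders m" "x + y = mult_op (poly_eval p) (G + G') + (r + r')"
        by (auto simp: mult_op_add intro: complex_vector.subspace_add[OF R])
      then show ?thesis unfolding D_def by blast
    qed
    show "c *\<^sub>C x \<in> D" if x: "x \<in> D" for c x
    proof -
      obtain G r where "G \<in> H" "r \<in> remainders m" "x = mult_op (poly_eval p) G + r"
        using x unfolding D_def by blast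
      then have "c *\<^sub>C G \<in> H" "c *\<^sub>C r \<in> remainders m" "c *\<^sub>C x = mult_op (poly_eval p) (c *\<^sub>C G) + c *\<^sub>C r"
        by (auto simp: mult_op_scale complex_vector.scale_right_distrib intro: complex_vector.subspace_scale[OF R])
      then show ?thesis unfolding D_def by blast
    qed
  qed
  have "mon \<gamma> \<in> D" if "(\<Sum>i\<in>UNIV. \<gamma> i) = m" for \<gamma> :: "'m option \<Rightarrow> nat"
    using that
  proof (induction "\<gamma> None" arbitrary: \<gamma> rule: less_induct)
    case less
    show ?case
    proof (cases "\<gamma> None < n")
      case True
      then have "mon \<gamma> \<in> remainders m"
        unfolding remainders_def using less.prems by (intro complex_vector.span_base) auto
      moreover have "mon \<gamma> = mult_op (poly_eval p) 0 + mon \<gamma>" by (auto simp: mult_op_def)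
      ultimately show ?thesis unfolding D_def using zero_mem by blast
    next
      case False
      define \<beta> where "\<beta> = \<gamma>(None := \<gamma> None - n)"
      have \<gamma>: "(\<lambda>i. Poly_Mapping.lookup lead i + \<beta> i) = \<gamma>"
        using False by (auto simp: fun_eq_iff \<beta>_def lead_def lookup_single when_def)
      have sum\<beta>: "n + (\<Sum>i\<in>UNIV. \<beta> i) = m"
        using less.prems False by (simp add: sum_option \<beta>_def)
      have other: "mon (\<lambda>i. Poly_Mapping.lookup g i + \<beta> i) \<in> D" if g: "g \<in> rest" for g
      proof (rule less.hyps)
        show "Poly_Mapping.lookup g None + \<beta> None < \<gamma> None"
          using rest_None[OF g] False by (simp add: \<beta>_def)
        show "(\<Sum>i\<in>UNIV. Poly_Mapping.lookup g i + \<beta> i) = m"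
          using hom_p g sum\<beta> by (simp add: homogeneous_of_degree_def rest_def sum.distrib)
      qed
      have "mult_op (poly_eval p) (mon \<beta>) = pc lead *\<^sub>C mon \<gamma> + (\<Sum>g\<in>rest. pc g *\<^sub>C mon (\<lambda>i. Poly_Mapping.lookup g i + \<beta> i))"
        unfolding mult_op_poly sum_keys mult_op_monomial_mon \<gamma> ..
      then have "pc lead *\<^sub>C mon \<gamma> = mult_op (poly_eval p) (mon \<beta>) - (\<Sum>g\<in>rest. pc g *\<^sub>C mon (\<lambda>i. Poly_Mapping.lookup g i + \<beta> i))"
        by (simp add: algebra_simps)
      moreover have "mult_op (poly_eval p) (mon \<beta>) \<in> D"
      proof -
        have "mult_op (poly_eval p) (mon \<beta>) = mult_op (poly_eval p) (mon \<beta>) + 0" by simp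
        then show ?thesis unfolding D_def using complex_vector.subspace_0[OF R] mon_mem by blast
      qed
      ultimately have "pc lead *\<^sub>C mon \<gamma> \<in> D"
        using other by (auto intro!: complex_vector.subspace_diff[OF D_sub]
            complex_vector.subspace_sum[OF D_sub] complex_vector.subspace_scale[OF D_sub])
      then have "(1 / pc lead) *\<^sub>C (pc lead *\<^sub>C mon \<gamma>) \<in> D"
        by (rule complex_vector.subspace_scale[OF D_sub])
      then show ?thesis using lead_nonzero by simp
    qed
  qed
  then have "hom m \<subseteq> D"
    unfolding hom_def by (intro complex_vector.span_minimal D_sub) auto
  then show ?thesis using assms unfolding D_def by blast
qed

text \<open>
  The solution with initial values \<open>1, t, \<dots>, t\<^sup>n\<^sup>-\<^sup>1\<close> evaluates a remainder at \<open>(a, t)\<close>, since a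
  remainder sees only the first \<open>n\<close> terms.  So the remainder vanishes near the \<open>t\<close>-axis, and by homogeneity
  everywhere.
\<close>

lemma remainder_zero:
  assumes r: "r \<in> remainders m"
    and ann: "\<And>a c. norm a < radius \<Longrightarrow> solution a c \<Longrightarrow> slice_functional a c r = 0"
  shows "r = 0"
proof -
  have rH: "r \<in> H" using r remainders_hom hom_subset by blast
  have near: "r (point a t) = 0" if a: "norm a < radius" and z: "norm (point a t) < 1" for a t
  proof -
    obtain c where c: "solution a c" "\<And>i. i < n \<Longrightarrow> c i = t ^ i"
      using solution_exists[of a "\<lambda>i. t ^ i"] by blast
    have geo: "geometric c"
      using radius_props(1,2)[OF a] by (intro solution_geometric[OF c(1)]) auto
    obtain h where h: "h \<in> H" "\<And>f. f \<in> H \<Longrightarrow> ip f h = slice_functional a c f"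
      using eigenvector_of_solution[OF a c(1)] eigenspace_Q Q_mem by blast
    have "remainders m \<subseteq> {g \<in> H. ip g h = g (point a t)}"
      unfolding remainders_def
    proof (rule complex_vector.span_minimal)
      show "mon ` {\<gamma>. (\<Sum>i\<in>UNIV. \<gamma> i) = m \<and> \<gamma> None < n} \<subseteq> {g \<in> H. ip g h = g (point a t)}"
        using z h(2) slice_functional_mon[OF radius_props(1)[OF a] geo] c(2)
        by (auto simp: mon_apply monomial_def prod_option)
      show "complex_vector.subspace {g \<in> H. ip g h = g (point a t)}"
      proof -
        have "(b *\<^sub>C g) v = b * g v" for b v and g :: "complex ^ 'm option \<Rightarrow> complex"
          by (simp add: scaleC_fun_def scaleC_complex_def)
        then show ?thesis
          using h(1) by (intro complex_vector.subspaceI) (auto simp: ip_add_left ip_scale_left)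
      qed
    qed
    then have "r (point a t) = ip r h" using r by auto
    also have "\<dots> = 0" using h(2)[OF rH] ann[OF a c(1)] by simp
    finally show ?thesis .
  qed
  show ?thesis
  proof
    fix z
    show "r z = 0 z"
    proof (cases "norm z < 1")
      case True
      define s where "s = complex_of_real radius"
      have s: "cmod s = radius" "s \<noteq> 0" "cmod s < 1"
      proof -
        have "radius \<le> 1/4" unfolding radius_def by (rule min.cobounded1)
        then show "cmod s = radius" "s \<noteq> 0" "cmod s < 1" using radius_pos by (auto simp: s_def)
      qed
      have norm_s: "norm (s *s x) = radius * norm x" for x :: "complex ^ 'k::finite"
        using s(1) by (simp add: norm_smult_vec)
      define a where "a = (\<chi> j. z $ Some j)"
      have z: "z = point a (z $ None)"
        by (auto simp: vec_eq_iff a_def point_def split: option.split)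
      have sz: "s *s z = point (s *s a) (s * z $ None)"
        by (auto simp: vec_eq_iff a_def point_def split: option.split)
      have "(norm z)\<^sup>2 = (norm a)\<^sup>2 + (cmod (z $ None))\<^sup>2"
        using norm_point_sq[of a "z $ None"] unfolding z[symmetric] .
      then have "(norm a)\<^sup>2 \<le> (norm z)\<^sup>2" by simp
      then have "norm a \<le> norm z" by (rule power2_le_imp_le) simp
      then have "norm (s *s a) < radius" using True radius_pos by (simp add: norm_s)
      moreover have nsz: "norm (s *s z) < 1"
      proof -
        have "radius * norm z \<le> 1 * norm z" using s by (intro mult_right_mono) auto
        then show ?thesis using True by (simp add: norm_s)
      qed
      ultimately have "r (s *s z) = 0" using near[of "s *s a" "s * z $ None"] sz by simp
      moreover have "r (s *s z) = s ^ m * r z"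
      proof -
        have "remainders m \<subseteq> {g. g (s *s z) = s ^ m * g z}"
          unfolding remainders_def
        proof (rule complex_vector.span_minimal)
          show "mon ` {\<gamma>. (\<Sum>i\<in>UNIV. \<gamma> i) = m \<and> \<gamma> None < n} \<subseteq> {g. g (s *s z) = s ^ m * g z}"
            using True nsz by (auto simp: mon_apply monomial_scale)
          show "complex_vector.subspace {g. g (s *s z) = s ^ m * g z}"
            by (intro complex_vector.subspaceI)
              (auto simp: scaleC_fun_def scaleC_complex_def algebra_simps)
        qed
        then show ?thesis using r by auto
      qed
      ultimately show ?thesis using s(2) by simp
    qed (use zero_outside[OF rH] in simp)
  qed
qed

lemma eigenvectors_total:
  assumes f: "f \<in> Q"
    and perp: "\<And>w h. norm w < radius \<Longrightarrow> h \<in> eigenspace w \<Longrightarrow> ip f h = 0"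
  shows "f = 0"
proof -
  have fH: "f \<in> H" using f by simp
  \<comment> \<open>A component is a multiple of \<open>p\<close> that belongs to \<open>Q\<close>, hence orthogonal to itself.\<close>
  have zero: "component m f = 0" for m
  proof -
    obtain G r where G: "G \<in> H" and r: "r \<in> remainders m"
      and eq: "component m f = mult_op (poly_eval p) G + r"
      using division[OF component_hom[OF fH]] by blast
    have rH: "r \<in> H" using r remainders_hom hom_subset by blast
    have "r = 0"
    proof (rule remainder_zero[OF r])
      fix a c assume a: "norm a < radius" and c: "solution a c"
      obtain h where h: "h \<in> eigenspace (conj_vec a)" "\<And>f. f \<in> H \<Longrightarrow> ip f h = slice_functional a c f"
        using eigenvector_of_solution[OF a c] by blast
      have hQ: "h \<in> Q" using h(1) by (rule eigenspace_Q)
      have "ip (component m f) h = 0"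
        using h(2)[of "component m f"] fH component_annihilated[OF f perp a c] by simp
      moreover have "ip (mult_op (poly_eval p) G) h = 0" using hQ G by (rule Q_perp)
      ultimately have "ip r h = 0"
        using G rH hQ unfolding eq by (simp add: ip_add_left)
      then show "slice_functional a c r = 0" using h(2)[OF rH] by simp
    qed
    then have "ip (component m f) (component m f) = 0"
      using Q_perp'[OF component_Q[OF f, of m] G] eq by simp
    then show ?thesis using ip_self_eq_0 fH by simp
  qed
  have "converges (\<lambda>N. 0) f" using component_converges[OF fH] by (simp add: zero)
  then have "nrm (0 - f) = 0" by (simp add: converges_def LIMSEQ_const_iff)
  then show ?thesis using nrm_eq_0[of "0 - f"] diff_mem[OF zero_mem fH] by simp
qed

lemma cowen_douglas_eigenvectors:
  "cowen_douglas Q ip adjoint_shift (ball 0 radius)"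
proof -
  interpret Q: hilbert Q ip by (rule hilbert_Q)
  let ?S = "complex_vector.span (\<Union>w\<in>ball 0 radius. eigenspace w)"
  have S: "?S \<subseteq> Q"
    using eigenspace_Q by (intro complex_vector.span_minimal Q_subspace) auto
  have dense: "hilbert_topology Q ip closure_of ?S = Q"
  proof
    show "hilbert_topology Q ip closure_of ?S \<subseteq> Q"
      unfolding hilbert_topology_def using closure_of_subset_topspace[of Q.ms.mtopology ?S] by simp
    show "Q \<subseteq> hilbert_topology Q ip closure_of ?S"
    proof
      fix f assume f: "f \<in> Q"
      have "\<exists>u. (\<forall>k. u k \<in> ?S) \<and> Q.converges u f"
      proof (rule Q.dense_if_orthocomplement_trivial[OF _ S _ f])
        fix x assume x: "x \<in> Q" "\<And>v. v \<in> ?S \<Longrightarrow> ip x v = 0"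
        show "x = 0"
          by (rule eigenvectors_total[OF x(1)]) (auto intro!: x(2) complex_vector.span_base)
      qed simp
      then show "f \<in> hilbert_topology Q ip closure_of ?S"
        unfolding hilbert_topology_def using Q.mem_closure_iff_converges[OF S] by blast
    qed
  qed
  have "bounded_operator Q ip (adjoint_shift j)" for j
    unfolding bounded_operator_def
  proof (intro conjI ballI allI)
    show "adjoint_shift j x \<in> Q" if "x \<in> Q" for x using that by (simp add: adjoint_shift_eq bshift_Q)
    show "adjoint_shift j (x + y) = adjoint_shift j x + adjoint_shift j y" if "x \<in> Q" "y \<in> Q" for x y
      using that complex_vector.subspace_add[OF Q_subspace that] by (simp add: adjoint_shift_eq bshift_add)
    show "adjoint_shift j (c *\<^sub>C x) = c *\<^sub>C adjoint_shift j x" if "x \<in> Q" for c x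
      using that complex_vector.subspace_scale[OF Q_subspace that] by (simp add: adjoint_shift_eq bshift_scale)
    show "\<exists>C. \<forall>x\<in>Q. nrm (adjoint_shift j x) \<le> C * nrm x"
      by (intro exI[of _ 1]) (simp add: adjoint_shift_eq nrm_bshift_le)
  qed
  moreover have "adjoint_shift i (adjoint_shift j x) = adjoint_shift j (adjoint_shift i x)" if "x \<in> Q" for i j x
    using that bshift_commute[OF Q_mem[OF that]] by (simp add: adjoint_shift_eq bshift_Q)
  ultimately have "commuting_bounded_tuple Q ip adjoint_shift"
    unfolding commuting_bounded_tuple_def by blast
  moreover have "hilbert_space Q ip"
    using Q.ips Q.complete by (simp add: hilbert_space_def)
  ultimately show ?thesis
    unfolding cowen_douglas_def joint_eigenspace_eq
    using n_pos dense shifted_range_closed eigenspace_dim by (auto intro!: exI[of _ n])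
qed

end

theorem theoremB:
  fixes H2 :: "(complex ^ ('m::finite option) \<Rightarrow> complex) set"
    and ip :: "(complex ^ ('m option) \<Rightarrow> complex) \<Rightarrow> (complex ^ ('m option) \<Rightarrow> complex) \<Rightarrow> complex"
    and p :: "'m option mpoly"
    and n :: nat
  assumes "drury_arveson_space H2 ip"
    and "homogeneous_of_degree p n"
    and "n > 0"
    and "poly_eval p last_unit_vector \<noteq> 0"
  shows "\<exists>U :: (complex ^ 'm) set.
           open U \<and> connected U \<and> 0 \<in> U \<and> U \<subseteq> ball 0 1 \<and>
           cowen_douglas (quotient_space H2 ip p) ip
             (\<lambda>j. hilbert_adjoint (quotient_space H2 ip p) ip
                   (compression (quotient_space H2 ip p) ip (Some j))) U"
proof -
  interpret homogeneous_quotient H2 ip p n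
    using assms by unfold_locales
  show ?thesis
  proof (intro exI conjI)
    show "open (ball (0 :: complex ^ 'm) radius)" "connected (ball (0 :: complex ^ 'm) radius)"
      by (simp_all add: convex_connected)
    show "0 \<in> ball (0 :: complex ^ 'm) radius" using radius_pos by simp
    show "ball 0 radius \<subseteq> ball (0 :: complex ^ 'm) 1" by (rule subset_ball) (simp add: radius_def)
    show "cowen_douglas (quotient_space H2 ip p) ip
             (\<lambda>j. hilbert_adjoint (quotient_space H2 ip p) ip
                   (compression (quotient_space H2 ip p) ip (Some j))) (ball 0 radius)"
      using cowen_douglas_eigenvectors unfolding adjoint_shift_def Q_def .
  qed
qed

end
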